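(* Let $X_0,\ldots,X_n$ be a sample from a stationary FAR(1) process $X_{t+1}=\Psi(X_t)+\epsilon_{t+1}$, $t\in\mathbb{Z}$, in $\mathcal{H}$ with $\mathrm{E}X_t=0$, satisfying (i) $\{\epsilon_t\}$ are i.i.d. with $\mathrm{E}\epsilon_t=0$ and $\mathrm{E}\Vert\epsilon_t\Vert^4<\infty$; (ii) $\Psi$ is a Hilbert-Schmidt operator with $\Vert\Psi\Vert_{\mathcal{L}}<1$; (iii) the eigenvalues $\lambda_1>\lambda_2>\ldots$ of $\Gamma$ are all positive and have multiplicity 1. Put $a_1=\lambda_1-\lambda_2$ and $a_j=\min(\lambda_{j-1}-\lambda_j,\ \lambda_j-\lambda_{j+1})$ for $j\ge 2$. Suppose that $k_n\to\infty$ and that $$\frac{k_n}{n}\sum_{j=1}^{k_n}\frac{1}{a_j^2}\to 0 \ \text{ for } n\to\infty \quad\text{and}\quad \frac{1}{\lambda_{k_n}}=O\left(\frac{n^{1/4}}{(\log n)^{\beta}}\right)\ \text{ for some } \beta>\frac12 .$$ Then $$d_2(\hat F_n,F)\to 0 \quad\text{in probability as } n\to\infty .$$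
   Context: $\mathcal{H}$ is a real separable Hilbert space with scalar product $\langle\cdot,\cdot\rangle$ and norm $\Vert\cdot\Vert$. For $y,z\in\mathcal{H}$, $y\otimes z$ is the linear operator $(y\otimes z)(x)=\langle y,x\rangle z$. $\Vert A\Vert_{\mathcal{L}}$ is the operator norm of a bounded linear operator $A$ on $\mathcal{H}$. A FAR(1) process is a sequence of $\mathcal{H}$-valued random variables with $X_{t+1}=\Psi(X_t)+\epsilon_{t+1}$, where $\Psi:\mathcal{H}\to\mathcal{H}$ is a bounded linear operator and the innovations $\epsilon_t$ are i.i.d. $\mathcal{H}$-valued random variables. $\Gamma=\mathrm{E}\,X_t\otimes X_t$ is the covariance operator, with eigenvalues $\lambda_1\ge\lambda_2\ge\ldots$. Estimates: $$\hat\Gamma_n=\frac1n\sum_{j=0}^{n-1}X_j\otimes X_j,\qquad \hat C_n=\frac1n\sum_{j=0}^{n-1}X_j\otimes X_{j+1}.$$ $\hat\lambda_1\ge\hat\lambda_2\ge\ldots$ and $\hat v_1,\hat v_2,\ldots$ are the eigenvalues and corresponding orthonormal eigenvectors of $\hat\Gamma_n$. $(k_n)$ is a deterministic sequence of positive integers, $$\hat\Gamma_n^\dagger=\sum_{j=1}^{k_n}\frac{1}{\hat\lambda_j}\hat v_j\otimes\hat v_j$$ (well defined when $\hat\lambda_{k_n}>0$), and $\hat\Psi_n=\hat C_n\hat\Gamma_n^\dagger$. Sample residuals: $\hat\epsilon_j=X_j-\hat\Psi_n(X_{j-1})$, and centered sample residuals $\tilde\epsilon_j=\hat\epsilon_j-\frac1n\sum_{k=1}^n\hat\epsilon_k$,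 $j=1,\ldots,n$. $F$ is the distribution of $\epsilon_t$, and $\hat F_n$ is the (random) empirical distribution of $\tilde\epsilon_1,\ldots,\tilde\epsilon_n$. Mallows metric: for distributions $F,G$ on $\mathcal{H}$, $d_2^2(F,G)=\inf \mathrm{E}\Vert X-Y\Vert^2$, the infimum being over all pairs of $\mathcal{H}$-valued random variables $X,Y$ with marginal distributions $F$ and $G$ respectively. *)

theory Defs
  imports "HOL-Probability.Probability" "HOL-Library.Landau_Symbols"
begin

(* The sort {real_inner, banach, second_countable_topology} describes the real separable
   Hilbert spaces. Operators on such a space are plain functions. Sequences that are
   numbered from 1 in the mathematics are functions on nat whose value at 0 is never used. *)

subsection \<open>Operators\<close>

definition tensor_op :: "'a::real_inner \<Rightarrow> 'a \<Rightarrow> 'a \<Rightarrow> 'a" where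
  "tensor_op y z = (\<lambda>x. inner y x *\<^sub>R z)"

definition orthonormal_basis :: "'a::real_inner set \<Rightarrow> bool" where
  "orthonormal_basis B \<longleftrightarrow>
     pairwise orthogonal B \<and> (\<forall>b\<in>B. norm b = 1) \<and> closure (span B) = UNIV"

definition hilbert_schmidt :: "('a::real_inner \<Rightarrow> 'a) \<Rightarrow> bool" where
  "hilbert_schmidt A \<longleftrightarrow>
     bounded_linear A \<and> (\<exists>B. orthonormal_basis B \<and> (\<lambda>b. (norm (A b))\<^sup>2) summable_on B)"

definition eigenspace :: "('a::real_vector \<Rightarrow> 'a) \<Rightarrow> real \<Rightarrow> 'a set" where
  "eigenspace A c = {x. A x = c *\<^sub>R x}"

definition eigenvalues :: "('a::real_vector \<Rightarrow> 'a) \<Rightarrow> real set" where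
  "eigenvalues A = {c. \<exists>x. x \<noteq> 0 \<and> A x = c *\<^sub>R x}"

(* For a compact positive semidefinite A on an infinite-dimensional space: mu lists the
   eigenvalues of A in decreasing order with v a corresponding orthonormal sequence of
   eigenvectors. The last clause says that each nonzero eigenvalue is listed with its full
   multiplicity. If A has finite rank, mu is 0 beyond the rank; the eigenvectors for the
   eigenvalue 0 need not span the whole kernel. *)
definition ordered_eigensystem ::
    "('a::real_inner \<Rightarrow> 'a) \<Rightarrow> (nat \<Rightarrow> real) \<Rightarrow> (nat \<Rightarrow> 'a) \<Rightarrow> bool" where
  "ordered_eigensystem A \<mu> v \<longleftrightarrow>
     (\<forall>j\<ge>1. \<mu> (Suc j) \<le> \<mu> j) \<and>
     (\<forall>i\<ge>1. \<forall>j\<ge>1. inner (v i) (v j) = (if i = j then 1 else 0)) \<and>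
     (\<forall>j\<ge>1. A (v j) = \<mu> j *\<^sub>R v j) \<and>
     (\<forall>c. c \<noteq> 0 \<longrightarrow> eigenspace A c = span {v j | j. 1 \<le> j \<and> \<mu> j = c})"

subsection \<open>Processes\<close>

definition strictly_stationary ::
    "'w measure \<Rightarrow> (int \<Rightarrow> 'w \<Rightarrow> 'a::topological_space) \<Rightarrow> bool" where
  "strictly_stationary M X \<longleftrightarrow>
     (\<forall>t. X t \<in> borel_measurable M) \<and>
     (\<forall>h. distr M (Pi\<^sub>M UNIV (\<lambda>_. borel)) (\<lambda>\<omega> t. X (t + h) \<omega>) =
          distr M (Pi\<^sub>M UNIV (\<lambda>_. borel)) (\<lambda>\<omega> t. X t \<omega>))"

definition iid :: "'w measure \<Rightarrow> (int \<Rightarrow> 'w \<Rightarrow> 'a::topological_space) \<Rightarrow> bool" where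
  "iid M e \<longleftrightarrow>
     prob_space.indep_vars M (\<lambda>_. borel) e UNIV \<and>
     (\<forall>s t. distr M borel (e s) = distr M borel (e t))"

(* The expectation of the random operator tensor_op Y Y is taken pointwise (strongly): the
   Bochner integral of the library needs a separable target space, which the space of bounded
   operators is not. For square integrable Y this gives the same operator. *)
definition covariance_op ::
    "'w measure \<Rightarrow> ('w \<Rightarrow> 'a::{real_inner, banach, second_countable_topology}) \<Rightarrow> 'a \<Rightarrow> 'a" where
  "covariance_op M Y x = (\<integral>\<omega>. tensor_op (Y \<omega>) (Y \<omega>) x \<partial>M)"

definition eigen_gap :: "(nat \<Rightarrow> real) \<Rightarrow> nat \<Rightarrow> real" where
  "eigen_gap lam j =
     (if j = 1 then lam 1 - lam 2 else min (lam (j - 1) - lam j) (lam j - lam (j + 1)))"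

subsection \<open>Estimators, as functions of an observed path\<close>

definition emp_cov :: "nat \<Rightarrow> (int \<Rightarrow> 'a::real_inner) \<Rightarrow> 'a \<Rightarrow> 'a" where
  "emp_cov n x y = (1 / real n) *\<^sub>R (\<Sum>j<n. tensor_op (x (int j)) (x (int j)) y)"

definition emp_cross_cov :: "nat \<Rightarrow> (int \<Rightarrow> 'a::real_inner) \<Rightarrow> 'a \<Rightarrow> 'a" where
  "emp_cross_cov n x y = (1 / real n) *\<^sub>R (\<Sum>j<n. tensor_op (x (int j)) (x (int j + 1)) y)"

(* Meant for mu k > 0. If some of the mu j are 0, the convention 1 / 0 = 0 drops those terms. *)
definition truncated_inverse ::
    "nat \<Rightarrow> (nat \<Rightarrow> real) \<Rightarrow> (nat \<Rightarrow> 'a::real_inner) \<Rightarrow> 'a \<Rightarrow> 'a" where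
  "truncated_inverse k \<mu> v y = (\<Sum>j=1..k. (1 / \<mu> j) *\<^sub>R tensor_op (v j) (v j) y)"

definition Psi_hat ::
    "nat \<Rightarrow> nat \<Rightarrow> (nat \<Rightarrow> real) \<Rightarrow> (nat \<Rightarrow> 'a) \<Rightarrow> (int \<Rightarrow> 'a::real_inner) \<Rightarrow> 'a \<Rightarrow> 'a" where
  "Psi_hat n k \<mu> v x = emp_cross_cov n x \<circ> truncated_inverse k \<mu> v"

definition residual ::
    "nat \<Rightarrow> nat \<Rightarrow> (nat \<Rightarrow> real) \<Rightarrow> (nat \<Rightarrow> 'a) \<Rightarrow> (int \<Rightarrow> 'a::real_inner) \<Rightarrow> nat \<Rightarrow> 'a" where
  "residual n k \<mu> v x j = x (int j) - Psi_hat n k \<mu> v x (x (int j - 1))"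

definition centered_residual ::
    "nat \<Rightarrow> nat \<Rightarrow> (nat \<Rightarrow> real) \<Rightarrow> (nat \<Rightarrow> 'a) \<Rightarrow> (int \<Rightarrow> 'a::real_inner) \<Rightarrow> nat \<Rightarrow> 'a" where
  "centered_residual n k \<mu> v x j =
     residual n k \<mu> v x j - (1 / real n) *\<^sub>R (\<Sum>i=1..n. residual n k \<mu> v x i)"

definition empirical_distribution :: "nat \<Rightarrow> (nat \<Rightarrow> 'a::topological_space) \<Rightarrow> 'a measure" where
  "empirical_distribution n y = distr (uniform_count_measure {1..n}) borel y"

subsection \<open>Mallows metric and convergence in probability\<close>

(* A pair of random variables with marginals F and G is represented by its joint law. *)
definition couplings ::
    "'a::second_countable_topology measure \<Rightarrow> 'a measure \<Rightarrow> ('a \<times> 'a) measure set" where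
  "couplings F G =
     {\<pi>. prob_space \<pi> \<and> sets \<pi> = sets (borel \<Otimes>\<^sub>M borel) \<and>
         distr \<pi> borel fst = F \<and> distr \<pi> borel snd = G}"

(* The infimum is finite whenever F and G have finite second moments, so that enn2real
   then loses nothing. *)
definition mallows_dist ::
    "'a::{real_normed_vector, second_countable_topology} measure \<Rightarrow> 'a measure \<Rightarrow> real" where
  "mallows_dist F G =
     sqrt (enn2real (INF \<pi>\<in>couplings F G. \<integral>\<^sup>+ z. ennreal ((norm (fst z - snd z))\<^sup>2) \<partial>\<pi>))"

(* outer_measure_of agrees with the measure M on measurable sets. Thus this is ordinary
   convergence in probability if the Z n are measurable, and it is not made vacuous by the
   value 0 of measure on non-measurable sets if they are not. *)
definition tendsto_in_probability ::
    "'w measure \<Rightarrow> (nat \<Rightarrow> 'w \<Rightarrow> 'b::metric_space) \<Rightarrow> 'b \<Rightarrow> bool" where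
  "tendsto_in_probability M Z c \<longleftrightarrow>
     (\<forall>e>0. (\<lambda>n. outer_measure_of M {\<omega>\<in>space M. dist (Z n \<omega>) c > e}) \<longlonglongrightarrow> 0)"

end

theory Submission
  imports Defs "HOL-Real_Asymp.Real_Asymp"
begin

text \<open>Write \<open>P\<close> for the projection on the first \<open>k\<close> empirical eigenvectors, \<open>G\<close> for the empirical covariance
operator and \<open>S = (1/n) \<Sum> X\<^sub>j \<otimes> \<epsilon>\<^sub>j\<^sub>+\<^sub>1\<close>. The autoregressive equation gives the empirical cross covariance
as \<open>\<Psi> G + S\<close>, and composing it with the truncated inverse of \<open>G\<close> turns the estimator into
\<open>\<Psi> P + S G\<^sup>\<dagger>\<close>. A residual therefore differs from its innovation by
\<open>\<Psi> (X\<^sub>j - P X\<^sub>j) - S G\<^sup>\<dagger> X\<^sub>j\<close>, and the mean square of this error has two parts.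

The first part is at most the mean squared distance of the observations from the space of the
empirical principal components. Principal components are optimal, so this is at most the distance
from any fixed space of dimension at most \<open>k\<close> (\<open>pca_optimal\<close>); its expectation is made small by a
fixed space of large dimension, because \<open>X\<^sub>0\<close> is square integrable and \<open>k\<close> tends to infinity. Since
that space is deterministic, stationarity gives the expectation for all \<open>n\<close> at once.

In the second part the empirical scores are uncorrelated with variances \<open>\<mu>\<^sub>j\<close>, so it is at most
\<open>1/\<mu>\<^sub>k\<close> times the squared Hilbert--Schmidt norm of \<open>S\<close> (\<open>sum_norm_scores\<close>). The stationary solution
is a function of past innovations, hence the summands of \<open>S\<close> are orthogonal in mean and the squared
norm has expectation of order \<open>1/n\<close> (\<open>E_noise_hs\<close>). What is left is to bound \<open>\<mu>\<^sub>k\<close> below by half of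
the true eigenvalue \<open>\<lambda>\<^sub>k\<close>.

By the min-max principle \<open>\<mu>\<^sub>k\<close> is at least \<open>\<lambda>\<^sub>k\<close> minus the supremum \<open>Q\<close>, over functionals \<open>f\<close> of norm at
most 1, of \<open>\<bar>(1/n) \<Sum> f(X\<^sub>j)\<^sup>2 - E f(X\<^sub>0)\<^sup>2\<bar>\<close>. Stationarity turns the autoregressive equation into a fixed
point inequality for \<open>Q\<close>: squaring \<open>f(X\<^sub>j\<^sub>+\<^sub>1) = f(\<Psi> X\<^sub>j) + f(\<epsilon>\<^sub>j\<^sub>+\<^sub>1)\<close> and averaging replaces \<open>f\<close> by \<open>f \<circ> \<Psi>\<close>, which
contracts \<open>Q\<close> by the factor \<open>\<parallel>\<Psi>\<parallel>\<^sup>2 < 1\<close>, at the price of a cross term bounded by the norm of \<open>S\<close>, a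
boundary term, and the same deviation for the innovations (\<open>X_form_err_bound\<close>). The innovations are
independent with fourth moments, so all of these are of order at most \<open>n\<^sup>-\<^sup>1\<^sup>/\<^sup>2\<close> in probability, whereas
\<open>\<lambda>\<^sub>k\<close> is at least of order \<open>n\<^sup>-\<^sup>1\<^sup>/\<^sup>4\<close> by the hypothesis on \<open>1/\<lambda>\<^sub>k\<close>.

Finally the Mallows distance between the empirical law of the centered residuals and the law of an
innovation is bounded by an explicit coupling (\<open>mallows_dist_empirical_le\<close>): after quantizing to
finitely many cells, an index \<open>j\<close> and an innovation value are drawn from the same cell as often as the
cell frequencies permit. The cost consists of the residual errors, the quantization error, and the
total variation distance between cell frequencies and cell probabilities. All bounds are in mean, so
Markov's inequality concludes.\<close>

section \<open>Finite orthonormal sets and projections\<close>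

definition orthonormal_set :: "'a::real_inner set \<Rightarrow> bool" where
  "orthonormal_set C \<longleftrightarrow> finite C \<and> pairwise orthogonal C \<and> (\<forall>c\<in>C. norm c = 1)"

definition proj :: "'a::real_inner set \<Rightarrow> 'a \<Rightarrow> 'a" where
  "proj C x = (\<Sum>c\<in>C. inner c x *\<^sub>R c)"

lemma orthonormal_set_finite: "orthonormal_set C \<Longrightarrow> finite C"
  by (simp add: orthonormal_set_def)

lemma orthonormal_set_inner:
  assumes "orthonormal_set C" "c \<in> C" "d \<in> C"
  shows "inner c d = (if c = d then 1 else 0)"
  using assms by (auto simp: orthonormal_set_def pairwise_def orthogonal_def norm_eq_1)

lemma orthonormal_set_imageI:
  assumes "finite I" and "\<And>i j. i \<in> I \<Longrightarrow> j \<in> I \<Longrightarrow> inner (v i) (v j) = (if i = j then 1 else 0)"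
  shows "orthonormal_set (v ` I)" "inj_on v I"
proof -
  show "inj_on v I"
    by (rule inj_onI) (metis assms(2) zero_neq_one)
  show "orthonormal_set (v ` I)"
    unfolding orthonormal_set_def pairwise_def orthogonal_def
    using assms by (auto simp: norm_eq_1)
qed

lemma inner_sum_orthonormal:
  assumes "orthonormal_set C" "c \<in> C"
  shows "inner c (\<Sum>d\<in>C. g d *\<^sub>R d) = g c"
proof -
  have "inner c (\<Sum>d\<in>C. g d *\<^sub>R d) = (\<Sum>d\<in>C. if c = d then g d else 0)"
    unfolding inner_sum_right using assms
    by (intro sum.cong) (auto simp: orthonormal_set_inner)
  also have "\<dots> = g c"
    using assms orthonormal_set_finite[OF assms(1)] by simp
  finally show ?thesis .
qed

lemma norm_sum_orthonormal:
  assumes "orthonormal_set C"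
  shows "(norm (\<Sum>d\<in>C. g d *\<^sub>R d))\<^sup>2 = (\<Sum>d\<in>C. (g d)\<^sup>2)"
proof -
  have "(norm (\<Sum>d\<in>C. g d *\<^sub>R d))\<^sup>2 = (\<Sum>c\<in>C. g c * inner c (\<Sum>d\<in>C. g d *\<^sub>R d))"
    by (simp add: power2_norm_eq_inner inner_sum_left)
  then show ?thesis
    using assms by (simp add: inner_sum_orthonormal power2_eq_square)
qed

lemma proj_in_span: "proj C x \<in> span C"
  unfolding proj_def by (intro span_sum span_scale span_base)

lemma inner_proj:
  assumes "orthonormal_set C" "y \<in> span C"
  shows "inner y (x - proj C x) = 0"
  using assms(2)
proof (induction rule: span_induct_alt)
  case base then show ?case by simp
next
  case (step a c y)
  then show ?case
    using inner_sum_orthonormal[OF assms(1), of c "\<lambda>c. inner c x"]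
    by (simp add: inner_add_left proj_def inner_diff_right)
qed

lemma proj_span:
  assumes "orthonormal_set C" "x \<in> span C"
  shows "proj C x = x"
proof -
  have "x - proj C x \<in> span C"
    using assms(2) proj_in_span by (rule span_diff)
  then show ?thesis
    using inner_proj[OF assms(1), of "x - proj C x" x] by simp
qed

lemma norm_proj:
  assumes "orthonormal_set C"
  shows "(norm (proj C x))\<^sup>2 = (\<Sum>c\<in>C. (inner c x)\<^sup>2)"
  unfolding proj_def by (rule norm_sum_orthonormal[OF assms])

lemma norm_diff_proj:
  assumes "orthonormal_set C"
  shows "(norm (x - proj C x))\<^sup>2 = (norm x)\<^sup>2 - (\<Sum>c\<in>C. (inner c x)\<^sup>2)"
proof -
  have "inner (proj C x) (x - proj C x) = 0"
    using assms proj_in_span by (rule inner_proj)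
  then have "(norm (x - proj C x))\<^sup>2 = (norm x)\<^sup>2 - (norm (proj C x))\<^sup>2"
    unfolding power2_norm_eq_inner by (simp add: inner_diff_right inner_diff_left inner_commute)
  then show ?thesis
    using norm_proj[OF assms] by simp
qed

lemma bessel_ineq:
  assumes "orthonormal_set C"
  shows "(\<Sum>c\<in>C. (inner c x)\<^sup>2) \<le> (norm x)\<^sup>2"
  using norm_diff_proj[OF assms, of x] by (smt (verit) zero_le_power2)

lemma norm_proj_le:
  assumes "orthonormal_set C"
  shows "norm (proj C x) \<le> norm x"
  using norm_proj[OF assms, of x] bessel_ineq[OF assms, of x] by (simp add: power2_le_imp_le)

lemma norm_diff_proj_le:
  assumes "orthonormal_set C"
  shows "norm (x - proj C x) \<le> norm x"
proof (rule power2_le_imp_le)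
  show "(norm (x - proj C x))\<^sup>2 \<le> (norm x)\<^sup>2"
    unfolding norm_diff_proj[OF assms] by (simp add: sum_nonneg)
qed simp

lemma proj_nearest:
  assumes "orthonormal_set C" "y \<in> span C"
  shows "norm (x - proj C x) \<le> norm (x - y)"
proof -
  have "inner (proj C x - y) (x - proj C x) = 0"
    using assms by (intro inner_proj span_diff proj_in_span)
  moreover have "x - y = (x - proj C x) + (proj C x - y)"
    by simp
  ultimately have "(norm (x - y))\<^sup>2 = (norm (x - proj C x))\<^sup>2 + (norm (proj C x - y))\<^sup>2"
    using norm_add_Pythagorean[of "x - proj C x" "proj C x - y"]
    by (simp add: orthogonal_def inner_commute)
  then show ?thesis
    by (metis le_add_same_cancel1 norm_ge_zero power2_le_imp_le zero_le_power2)
qed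

lemma orthonormal_set_independent:
  assumes "orthonormal_set C"
  shows "independent C"
  using assms unfolding orthonormal_set_def
  by (intro pairwise_orthogonal_independent) auto

text \<open>Gram--Schmidt yields an orthogonal set with the same span; it may contain 0, which is
removed before normalizing.\<close>

lemma orthonormal_basis_of_span:
  fixes S :: "'a::real_inner set"
  assumes "finite S"
  obtains C where "orthonormal_set C" "card C \<le> card S" "span C = span S"
proof -
  obtain C where C: "finite C" "card C \<le> card S" "span C = span S" "pairwise orthogonal C"
    using basis_orthogonal[OF assms] by blast
  define D where "D = sgn ` (C - {0})"
  have "orthonormal_set D"
    unfolding orthonormal_set_def D_def
  proof (intro conjI)
    show "finite (sgn ` (C - {0}))" using C by simp
    show "pairwise orthogonal (sgn ` (C - {0}))"
      using C(4) unfolding pairwise_def orthogonal_def by (fastforce simp: sgn_div_norm)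
    show "\<forall>c\<in>sgn ` (C - {0}). norm c = 1" by (auto simp: norm_sgn)
  qed
  moreover have "card D \<le> card S"
    using C card_image_le[of "C - {0}" sgn] card_Diff_subset_Int[of C "{0}"] unfolding D_def
    by (smt (verit) card_Diff1_le finite_Diff order_trans)
  moreover have "span D = span S"
  proof -
    have "c \<in> span D" if "c \<in> C" for c
    proof (cases "c = 0")
      case False
      then have "norm c *\<^sub>R sgn c \<in> span D"
        using that unfolding D_def by (intro span_scale span_base) auto
      then show ?thesis using False by (simp add: sgn_div_norm)
    qed (simp add: span_zero)
    moreover have "d \<in> span C" if "d \<in> D" for d
      using that unfolding D_def by (auto simp: sgn_div_norm intro: span_scale span_base)
    ultimately show ?thesis
      using C(3) by (metis (full_types) span_eq subsetI)
  qed
  ultimately show ?thesis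
    using that by blast
qed

text \<open>Evaluate \<open>f\<close> at \<open>\<Sum> f(c) c\<close>, whose norm is the square root of the left-hand side.\<close>

lemma functional_bessel:
  fixes f :: "'a::real_inner \<Rightarrow> real"
  assumes f: "bounded_linear f" and C: "orthonormal_set C"
  shows "(\<Sum>c\<in>C. (f c)\<^sup>2) \<le> (onorm f)\<^sup>2"
proof -
  let ?s = "\<Sum>c\<in>C. (f c)\<^sup>2"
  interpret bounded_linear f by fact
  have "f (\<Sum>c\<in>C. f c *\<^sub>R c) = ?s"
    by (simp add: sum scaleR power2_eq_square)
  then have "?s \<le> onorm f * norm (\<Sum>c\<in>C. f c *\<^sub>R c)"
    using onorm[OF f, of "\<Sum>c\<in>C. f c *\<^sub>R c"] by simp
  also have "norm (\<Sum>c\<in>C. f c *\<^sub>R c) = sqrt ?s"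
    using norm_sum_orthonormal[OF C, of f] by (metis norm_ge_zero real_sqrt_unique)
  finally have "sqrt ?s * sqrt ?s \<le> onorm f * sqrt ?s"
    by (simp add: sum_nonneg)
  then have "sqrt ?s \<le> onorm f"
    using onorm_pos_le[OF f] mult_le_cancel_right[of "sqrt ?s" "sqrt ?s" "onorm f"]
    by (cases "sqrt ?s > 0") linarith+
  then have "(sqrt ?s)\<^sup>2 \<le> (onorm f)\<^sup>2"
    by (intro power_mono) (simp_all add: sum_nonneg)
  then show ?thesis
    by (simp add: sum_nonneg)
qed

lemma functional_on_span:
  fixes f :: "'a::real_inner \<Rightarrow> real"
  assumes f: "bounded_linear f" and C: "orthonormal_set C" and x: "x \<in> span C"
  shows "f x = (\<Sum>c\<in>C. inner c x * f c)"
proof -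
  interpret bounded_linear f by fact
  have "f x = f (proj C x)" using proj_span[OF C x] by simp
  then show ?thesis by (simp add: proj_def sum scaleR)
qed

text \<open>The \<open>m\<close>-th set spans the first \<open>m\<close> members of a dense sequence. Projections minimize the distance,
so they converge pointwise to the identity. These projections replace a basis expansion throughout: all
sums stay finite.\<close>

lemma finite_rank_approximation:
  obtains C :: "nat \<Rightarrow> 'a::{real_inner, second_countable_topology} set"
  where "\<And>m. orthonormal_set (C m)" "\<And>m. card (C m) \<le> m"
    "\<And>x. (\<lambda>m. proj (C m) x) \<longlonglongrightarrow> x"
proof -
  obtain D :: "'a set" where D: "countable D" "\<And>S. open S \<Longrightarrow> S \<noteq> {} \<Longrightarrow> \<exists>d\<in>D. d \<in> S"
    using countable_dense_setE by blast
  then have "D \<noteq> {}" by blast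
  define d where "d = from_nat_into D"
  have range: "range d = D"
    unfolding d_def using D(1) \<open>D \<noteq> {}\<close> by (simp add: range_from_nat_into)
  have "\<exists>C. orthonormal_set C \<and> card C \<le> m \<and> span C = span (d ` {..<m})" for m
  proof -
    obtain C where "orthonormal_set C" "card C \<le> card (d ` {..<m})" "span C = span (d ` {..<m})"
      using orthonormal_basis_of_span[of "d ` {..<m}"] by blast
    then show ?thesis
      using card_image_le[of "{..<m}" d] by (intro exI[of _ C]) auto
  qed
  then obtain C where C: "\<And>m. orthonormal_set (C m)" "\<And>m. card (C m) \<le> m"
      "\<And>m. span (C m) = span (d ` {..<m})"
    by metis
  have "(\<lambda>m. proj (C m) x) \<longlonglongrightarrow> x" for x
  proof (rule metric_LIMSEQ_I)
    fix e :: real assume "e > 0"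
    then obtain i where i: "d i \<in> ball x e"
      using D(2)[of "ball x e"] range by (metis centre_in_ball empty_iff open_ball rangeE)
    have "dist (proj (C m) x) x < e" if "m \<ge> Suc i" for m
    proof -
      have "d i \<in> span (C m)"
        unfolding C(3) using that by (intro span_base) auto
      from proj_nearest[OF C(1) this, of x] i show ?thesis
        by (simp add: dist_norm norm_minus_commute)
    qed
    then show "\<exists>N. \<forall>m\<ge>N. dist (proj (C m) x) x < e" by blast
  qed
  with C show ?thesis using that by blast
qed

section \<open>Hilbert--Schmidt norms of finite sums of tensors\<close>

text \<open>This is the squared Hilbert--Schmidt norm of the operator \<open>\<Sum> a\<^sub>i \<otimes> b\<^sub>i\<close>, written through the two
Gram matrices, so that expectations can be taken entry by entry.\<close>

definition hs_norm_sq :: "'i set \<Rightarrow> ('i \<Rightarrow> 'a::real_inner) \<Rightarrow> ('i \<Rightarrow> 'b::real_inner) \<Rightarrow> real" where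
  "hs_norm_sq I a b = (\<Sum>i\<in>I. \<Sum>j\<in>I. inner (a i) (a j) * inner (b i) (b j))"

lemma hs_norm_sq_commute: "hs_norm_sq I a b = hs_norm_sq I b a"
  by (simp add: hs_norm_sq_def mult.commute)

lemma norm_sum_scaleR_sq:
  "(norm (\<Sum>i\<in>I. g i *\<^sub>R b i))\<^sup>2 = (\<Sum>i\<in>I. \<Sum>j\<in>I. g i * g j * inner (b i) (b j))"
  unfolding power2_norm_eq_inner inner_sum_left unfolding inner_sum_right
  by (subst sum.swap) (simp add: sum_distrib_left ac_simps inner_commute)

lemma hs_norm_sq_parseval:
  assumes C: "orthonormal_set C" and a: "\<And>i. i \<in> I \<Longrightarrow> a i \<in> span C"
  shows "(\<Sum>c\<in>C. (norm (\<Sum>i\<in>I. inner (a i) c *\<^sub>R b i))\<^sup>2) = hs_norm_sq I a b"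
proof -
  have *: "inner (a i) (a j) = (\<Sum>c\<in>C. inner (a i) c * inner (a j) c)" if "i \<in> I" "j \<in> I" for i j
  proof -
    have "inner (a i) (a j) = inner (proj C (a i)) (a j)"
      using proj_span[OF C a[OF that(1)]] by simp
    also have "\<dots> = (\<Sum>c\<in>C. inner (a i) c * inner (a j) c)"
      unfolding proj_def inner_sum_left by (simp add: inner_commute)
    finally show ?thesis .
  qed
  have "(\<Sum>c\<in>C. (norm (\<Sum>i\<in>I. inner (a i) c *\<^sub>R b i))\<^sup>2) =
      (\<Sum>i\<in>I. \<Sum>j\<in>I. \<Sum>c\<in>C. inner (a i) c * inner (a j) c * inner (b i) (b j))"
    unfolding norm_sum_scaleR_sq by (subst sum.swap, intro sum.cong refl, rule sum.swap)
  also have "\<dots> = hs_norm_sq I a b"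
    unfolding hs_norm_sq_def by (intro sum.cong refl) (simp add: * sum_distrib_right)
  finally show ?thesis .
qed

text \<open>Expand the values in an orthonormal basis of the span of the \<open>b\<^sub>i\<close> and apply Bessel's inequality
to the adjoint operator \<open>\<Sum> b\<^sub>i \<otimes> a\<^sub>i\<close>, which has the same Hilbert--Schmidt norm.\<close>

lemma hs_norm_sq_bessel:
  assumes "finite I" and V: "orthonormal_set V"
  shows "(\<Sum>v\<in>V. (norm (\<Sum>i\<in>I. inner (a i) v *\<^sub>R b i))\<^sup>2) \<le> hs_norm_sq I a b"
proof -
  obtain D where D: "orthonormal_set D" "span D = span (b ` I)"
    using orthonormal_basis_of_span[of "b ` I"] \<open>finite I\<close> by blast
  have b: "b i \<in> span D" if "i \<in> I" for i
    using that D(2) by (simp add: span_base)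
  have "(norm (\<Sum>i\<in>I. inner (a i) v *\<^sub>R b i))\<^sup>2 = (\<Sum>d\<in>D. (inner v (\<Sum>i\<in>I. inner (b i) d *\<^sub>R a i))\<^sup>2)" for v
  proof -
    have "(\<Sum>i\<in>I. inner (a i) v *\<^sub>R b i) \<in> span D"
      by (intro span_sum span_scale b)
    from proj_span[OF D(1) this] norm_proj[OF D(1), of "\<Sum>i\<in>I. inner (a i) v *\<^sub>R b i"]
    show ?thesis
      by (simp add: inner_sum_right inner_commute mult.commute)
  qed
  then have "(\<Sum>v\<in>V. (norm (\<Sum>i\<in>I. inner (a i) v *\<^sub>R b i))\<^sup>2) =
      (\<Sum>d\<in>D. \<Sum>v\<in>V. (inner v (\<Sum>i\<in>I. inner (b i) d *\<^sub>R a i))\<^sup>2)"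
    by (simp add: sum.swap[of _ D V])
  also have "\<dots> \<le> (\<Sum>d\<in>D. (norm (\<Sum>i\<in>I. inner (b i) d *\<^sub>R a i))\<^sup>2)"
    by (intro sum_mono bessel_ineq[OF V])
  also have "\<dots> = hs_norm_sq I a b"
    unfolding hs_norm_sq_commute[of I a b] by (rule hs_norm_sq_parseval[OF D(1) b])
  finally show ?thesis .
qed

lemma hs_norm_sq_nonneg: "finite I \<Longrightarrow> 0 \<le> hs_norm_sq I a b"
  using hs_norm_sq_bessel[of I "{}" a b] by (simp add: orthonormal_set_def)

text \<open>The Hilbert--Schmidt norm dominates the operator norm, here in the form needed for functionals that
are not given as inner products.\<close>

lemma hs_norm_sq_functional:
  fixes f :: "'a::real_inner \<Rightarrow> real" and b :: "'i \<Rightarrow> 'b::real_inner"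
  assumes f: "bounded_linear f" and I: "finite I"
  shows "(norm (\<Sum>i\<in>I. f (a i) *\<^sub>R b i))\<^sup>2 \<le> (onorm f)\<^sup>2 * hs_norm_sq I a b"
proof -
  obtain C where C: "orthonormal_set C" "span C = span (a ` I)"
    using orthonormal_basis_of_span[of "a ` I"] I by blast
  have a: "a i \<in> span C" if "i \<in> I" for i
    using that C(2) by (simp add: span_base)
  define w where "w c = (\<Sum>i\<in>I. inner (a i) c *\<^sub>R b i)" for c
  have "(\<Sum>i\<in>I. f (a i) *\<^sub>R b i) = (\<Sum>i\<in>I. \<Sum>c\<in>C. f c *\<^sub>R (inner (a i) c *\<^sub>R b i))"
    using functional_on_span[OF f C(1) a]
    by (intro sum.cong refl) (simp add: scaleR_sum_left inner_commute mult.commute)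
  also have "\<dots> = (\<Sum>c\<in>C. f c *\<^sub>R w c)"
    unfolding w_def scaleR_sum_right by (rule sum.swap)
  finally have "norm (\<Sum>i\<in>I. f (a i) *\<^sub>R b i) \<le> (\<Sum>c\<in>C. \<bar>f c\<bar> * norm (w c))"
    by (simp add: norm_sum order_trans[OF norm_sum])
  then have "(norm (\<Sum>i\<in>I. f (a i) *\<^sub>R b i))\<^sup>2 \<le> (\<Sum>c\<in>C. \<bar>f c\<bar> * norm (w c))\<^sup>2"
    by (intro power_mono) auto
  also have "\<dots> \<le> (\<Sum>c\<in>C. \<bar>f c\<bar>\<^sup>2) * (\<Sum>c\<in>C. (norm (w c))\<^sup>2)"
    by (rule Cauchy_Schwarz_ineq_sum)
  also have "\<dots> \<le> (onorm f)\<^sup>2 * hs_norm_sq I a b"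
    using functional_bessel[OF f C(1)] hs_norm_sq_parseval[OF C(1) a, where b=b and I=I]
    hs_norm_sq_nonneg[OF I]
    unfolding w_def by (intro mult_mono) (auto simp: sum_nonneg)
  finally show ?thesis .
qed


section \<open>Empirical principal components\<close>

text \<open>A dimension count: the projections of \<open>U\<close> to the span of \<open>W\<close> span too small a space to contain all
of \<open>W\<close>, and removing from some \<open>w \<in> W\<close> its component in that space leaves the required vector.\<close>

lemma orthogonal_vector_in_span:
  fixes W U :: "'a::real_inner set"
  assumes W: "orthonormal_set W" and U: "finite U" "card U < card W"
  obtains x where "x \<in> span W" "x \<noteq> 0" "\<And>u. u \<in> U \<Longrightarrow> inner u x = 0"
proof -
  obtain D where D: "orthonormal_set D" "card D \<le> card (proj W ` U)" "span D = span (proj W ` U)"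
    using orthonormal_basis_of_span[of "proj W ` U"] U(1) by blast
  have "card D < card W"
    using D(2) card_image_le[OF U(1), of "proj W"] U(2) by linarith
  then have "\<not> W \<subseteq> span D"
    using independent_span_bound[OF orthonormal_set_finite[OF D(1)] orthonormal_set_independent[OF W]]
    by auto
  then obtain w where w: "w \<in> W" "w \<notin> span D" by blast
  have "span D \<subseteq> span W"
    unfolding D(3) by (intro span_minimal) (auto simp: proj_in_span)
  then have in_span: "w - proj D w \<in> span W"
    using w(1) proj_in_span[of D w] by (intro span_diff) (auto intro: span_base)
  show ?thesis
  proof (rule that[OF in_span])
    show "w - proj D w \<noteq> 0"
      using w(2) proj_in_span[of D w] by auto
    show "inner u (w - proj D w) = 0" if "u \<in> U" for u
    proof -
      have "inner (proj W u) (w - proj D w) = 0"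
        using that by (intro inner_proj[OF D(1)]) (simp add: D(3) span_base)
      moreover have "inner (w - proj D w) (u - proj W u) = 0"
        by (intro inner_proj[OF W] in_span)
      ultimately show ?thesis
        by (simp add: inner_diff_right inner_diff_left inner_commute)
    qed
  qed
qed

text \<open>One application of the Bolzano--Weierstrass theorem for each index, refining the subsequence.\<close>

lemma simultaneous_convergent_subsequence:
  fixes f :: "'j \<Rightarrow> nat \<Rightarrow> real"
  assumes "finite J" and "\<And>j. j \<in> J \<Longrightarrow> bounded (range (f j))"
  shows "\<exists>r. strict_mono r \<and> (\<forall>j\<in>J. convergent (f j \<circ> r))"
  using assms
proof (induction J rule: finite_induct)
  case empty
  show ?case by (intro exI[of _ id]) (simp add: strict_mono_id)
next
  case (insert j J)
  have "\<exists>r. strict_mono r \<and> (\<forall>i\<in>J. convergent (f i \<circ> r))"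
    using insert.IH insert.prems by blast
  then obtain r where r: "strict_mono r" "\<forall>i\<in>J. convergent (f i \<circ> r)" by blast
  have "bounded (range (f j \<circ> r))"
    using insert.prems[of j] by (auto intro: bounded_subset)
  then obtain l s where s: "strict_mono s" "(f j \<circ> r \<circ> s) \<longlonglongrightarrow> l"
    using bounded_imp_convergent_subsequence by blast
  have "convergent (f i \<circ> (r \<circ> s))" if "i \<in> insert j J" for i
    using that r(2) s convergent_subseq_convergent[of "f i \<circ> r" s]
    by (auto simp: o_assoc convergent_def)
  then show ?case
    using r(1) s(1) strict_mono_o by blast
qed

text \<open>The symmetric bilinear form of the empirical covariance operator.\<close>

definition emp_form :: "nat \<Rightarrow> (int \<Rightarrow> 'a::real_inner) \<Rightarrow> 'a \<Rightarrow> 'a \<Rightarrow> real" where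
  "emp_form n x y z = (1 / real n) * (\<Sum>j<n. inner (x (int j)) y * inner (x (int j)) z)"

lemma inner_emp_cov: "inner (emp_cov n x y) z = emp_form n x y z"
  unfolding emp_cov_def tensor_op_def emp_form_def by (simp add: inner_sum_left)

lemma emp_form_commute: "emp_form n x y z = emp_form n x z y"
  by (simp add: emp_form_def mult.commute)

lemma emp_form_add_left: "emp_form n x (y + y') z = emp_form n x y z + emp_form n x y' z"
  by (simp add: emp_form_def inner_add_right distrib_right sum.distrib distrib_left)

lemma emp_form_add_right: "emp_form n x y (z + z') = emp_form n x y z + emp_form n x y z'"
  by (simp add: emp_form_def inner_add_right distrib_right sum.distrib distrib_left)

lemma emp_form_scaleR_left: "emp_form n x (c *\<^sub>R y) z = c * emp_form n x y z"
  by (simp add: emp_form_def sum_distrib_left ac_simps)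

lemma emp_form_scaleR_right: "emp_form n x y (c *\<^sub>R z) = c * emp_form n x y z"
  by (simp add: emp_form_def sum_distrib_left ac_simps)

lemma emp_form_zero_left: "emp_form n x 0 z = 0"
  by (simp add: emp_form_def)

lemma emp_form_sum_left: "emp_form n x (\<Sum>i\<in>I. g i) z = (\<Sum>i\<in>I. emp_form n x (g i) z)"
  by (induction I rule: infinite_finite_induct)
     (simp_all add: emp_form_add_left emp_form_zero_left)

lemma emp_form_nonneg: "0 \<le> emp_form n x y y"
  unfolding emp_form_def by (simp add: sum_nonneg)

locale empirical_eigensystem =
  fixes n :: nat and x :: "int \<Rightarrow> 'a::real_inner" and \<mu> :: "nat \<Rightarrow> real" and v :: "nat \<Rightarrow> 'a"
  assumes n: "n \<ge> 1" and eig: "ordered_eigensystem (emp_cov n x) \<mu> v"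
begin

lemma v_inner: "i \<ge> 1 \<Longrightarrow> j \<ge> 1 \<Longrightarrow> inner (v i) (v j) = (if i = j then 1 else 0)"
  and cov_v: "j \<ge> 1 \<Longrightarrow> emp_cov n x (v j) = \<mu> j *\<^sub>R v j"
  and eigenspace_eq: "c \<noteq> 0 \<Longrightarrow> eigenspace (emp_cov n x) c = span {v j | j. 1 \<le> j \<and> \<mu> j = c}"
  using eig unfolding ordered_eigensystem_def by blast+

lemma \<mu>_antimono:
  assumes "1 \<le> i" "i \<le> j"
  shows "\<mu> j \<le> \<mu> i"
  using assms(2)
proof (induction j rule: dec_induct)
  case (step j)
  have "\<mu> (Suc j) \<le> \<mu> j"
    using eig assms(1) step.hyps unfolding ordered_eigensystem_def by auto
  then show ?case using step by linarith
qed simp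

lemma form_v: "j \<ge> 1 \<Longrightarrow> emp_form n x (v j) y = \<mu> j * inner (v j) y"
  using inner_emp_cov[of n x "v j" y] by (simp add: cov_v)

lemma \<mu>_nonneg: "j \<ge> 1 \<Longrightarrow> 0 \<le> \<mu> j"
  using form_v[of j "v j"] emp_form_nonneg[of n x "v j"] by (simp add: v_inner)

lemma orthonormal_v: "orthonormal_set (v ` {1..k})" "inj_on v {1..k}"
  by (rule orthonormal_set_imageI, simp, simp add: v_inner)+

lemma sum_image_v: "(\<Sum>c\<in>v ` {1..k}. g c) = (\<Sum>l=1..k. g (v l))"
  using sum.reindex[OF orthonormal_v(2), of g k] by (simp only: o_def)

text \<open>The supremum \<open>s\<close> of the form over unit vectors orthogonal to the first \<open>k - 1\<close> eigenvectors is an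
eigenvalue of the covariance operator. The operator has finite rank: along a maximizing sequence its
values are determined by the \<open>n\<close> scores, so a subsequence of the values converges to some \<open>z\<close>, and
equality in the Cauchy--Schwarz inequality makes \<open>z\<close> an eigenvector. If \<open>s > \<mu> k\<close>, the complete
listing of eigenspaces puts \<open>z\<close> into the span of the earlier eigenvectors, to which it is
orthogonal.\<close>

lemma rayleigh_bound:
  assumes k: "k \<ge> 1" and y: "\<And>i. 1 \<le> i \<Longrightarrow> i < k \<Longrightarrow> inner (v i) y = 0"
  shows "emp_form n x y y \<le> \<mu> k * (norm y)\<^sup>2"
proof -
  define S where "S = {y. \<forall>i. 1 \<le> i \<and> i < k \<longrightarrow> inner (v i) y = 0}"
  define T where "T = {y \<in> S. norm y = 1}"
  let ?q = "\<lambda>y. emp_form n x y y"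
  have S_scale: "c *\<^sub>R y \<in> S" if "y \<in> S" for c y
    using that by (auto simp: S_def)
  define s where "s = Sup (?q ` T)"
  have vk: "v k \<in> T"
    using k v_inner by (auto simp: T_def S_def norm_eq_1)
  have bdd: "bdd_above (?q ` T)"
  proof (rule bdd_aboveI2)
    fix y assume "y \<in> T"
    then have "norm y = 1" by (simp add: T_def)
    then show "?q y \<le> (1 / real n) * (\<Sum>j<n. (norm (x (int j)))\<^sup>2)"
      unfolding emp_form_def
      by (intro mult_left_mono sum_mono)
         (auto simp flip: power2_eq_square intro!: abs_le_square_iff[THEN iffD1] Cauchy_Schwarz_ineq2[THEN order_trans])
  qed
  have q_le: "?q y \<le> s * (norm y)\<^sup>2" if "y \<in> S" for y
  proof (cases "y = 0")
    case False
    have "sgn y \<in> T"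
      using that False S_scale[of y "inverse (norm y)"] by (simp add: T_def norm_sgn sgn_div_norm)
    then have "?q (sgn y) \<le> s"
      unfolding s_def by (intro cSUP_upper bdd)
    moreover have "?q y = (norm y)\<^sup>2 * ?q (sgn y)"
      using False by (simp add: sgn_div_norm emp_form_scaleR_left emp_form_scaleR_right power2_eq_square field_simps)
    ultimately show ?thesis
      by (metis mult.commute mult_left_mono zero_le_power2)
  qed (simp add: emp_form_def)
  have "s \<le> \<mu> k"
  proof (rule ccontr)
    assume "\<not> s \<le> \<mu> k"
    then have s: "s > \<mu> k" "s > 0" using \<mu>_nonneg[OF k] by auto
    have "\<exists>y\<in>T. ?q y > s - 1 / real (Suc m)" for m
      using less_cSupD[of "?q ` T" "s - 1 / real (Suc m)"] vk unfolding s_def[symmetric] by auto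
    then obtain Y where Y: "\<And>m. Y m \<in> T" "\<And>m. ?q (Y m) > s - 1 / real (Suc m)"
      by metis
    have "bounded (range (\<lambda>m. inner (x (int j)) (Y m)))" for j
    proof (rule boundedI[of _ "norm (x (int j))"], safe)
      fix m show "norm (inner (x (int j)) (Y m)) \<le> norm (x (int j))"
        using Y(1)[of m] Cauchy_Schwarz_ineq2[of "x (int j)" "Y m"] by (simp add: T_def)
    qed
    then obtain r where r: "strict_mono r"
        and conv: "\<forall>j\<in>{..<n}. convergent ((\<lambda>m. inner (x (int j)) (Y m)) \<circ> r)"
      using simultaneous_convergent_subsequence[of "{..<n}" "\<lambda>j m. inner (x (int j)) (Y m)"] by auto
    define c where "c j = lim (\<lambda>m. inner (x (int j)) (Y (r m)))" for j
    have c: "(\<lambda>m. inner (x (int j)) (Y (r m))) \<longlonglongrightarrow> c j" if "j < n" for j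
      using conv that unfolding c_def by (simp add: convergent_LIMSEQ_iff o_def)
    have "(\<lambda>m. ?q (Y (r m))) \<longlonglongrightarrow> s"
    proof (rule LIMSEQ_subseq_LIMSEQ[OF _ r, unfolded o_def])
      show "(\<lambda>m. ?q (Y m)) \<longlonglongrightarrow> s"
      proof (rule tendsto_sandwich[of "\<lambda>m. s - 1 / real (Suc m)" _ _ "\<lambda>_. s"])
        show "\<forall>\<^sub>F m in sequentially. s - 1 / real (Suc m) \<le> ?q (Y m)"
          using Y(2) by (intro always_eventually allI less_imp_le)
        show "\<forall>\<^sub>F m in sequentially. ?q (Y m) \<le> s"
          using q_le Y(1) by (intro always_eventually allI) (fastforce simp: T_def)
        have "(\<lambda>m. s - 1 / real (Suc m)) \<longlonglongrightarrow> s - 0"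
          by (intro tendsto_diff tendsto_const LIMSEQ_Suc[OF lim_1_over_n])
        then show "(\<lambda>m. s - 1 / real (Suc m)) \<longlonglongrightarrow> s" by simp
      qed simp
    qed
    moreover have "(\<lambda>m. ?q (Y (r m))) \<longlonglongrightarrow> (1 / real n) * (\<Sum>j<n. c j * c j)"
      unfolding emp_form_def by (intro tendsto_intros c) auto
    ultimately have s_eq: "s = (1 / real n) * (\<Sum>j<n. c j * c j)"
      by (rule LIMSEQ_unique)
    \<comment> \<open>the limit of the values of the covariance operator along the maximizing subsequence\<close>
    define z where "z = (1 / real n) *\<^sub>R (\<Sum>j<n. c j *\<^sub>R x (int j))"
    have inner_z: "inner z y = (1 / real n) * (\<Sum>j<n. c j * inner (x (int j)) y)" for y
      by (simp add: z_def inner_sum_left)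
    have "(\<lambda>m. inner z (Y (r m))) \<longlonglongrightarrow> (1 / real n) * (\<Sum>j<n. c j * c j)"
      unfolding inner_z by (intro tendsto_intros c) auto
    then have inner_zY: "(\<lambda>m. inner z (Y (r m))) \<longlonglongrightarrow> s"
      unfolding s_eq .
    have "z \<in> S"
      unfolding S_def
    proof safe
      fix i :: nat assume i: "1 \<le> i" "i < k"
      have "(\<lambda>m. emp_form n x (v i) (Y (r m))) \<longlonglongrightarrow> (1 / real n) * (\<Sum>j<n. inner (x (int j)) (v i) * c j)"
        unfolding emp_form_def by (intro tendsto_intros c) auto
      moreover have "emp_form n x (v i) (Y (r m)) = 0" for m
        using Y(1)[of "r m"] i form_v[of i] by (simp add: T_def S_def)
      ultimately have "(1 / real n) * (\<Sum>j<n. inner (x (int j)) (v i) * c j) = 0"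
        using LIMSEQ_unique[OF _ tendsto_const] by fastforce
      then show "inner (v i) z = 0"
        using inner_z[of "v i"] by (simp add: inner_commute mult.commute)
    qed
    have "s \<le> norm z"
    proof (rule LIMSEQ_le_const2[OF inner_zY], intro exI allI impI)
      fix m show "inner z (Y (r m)) \<le> norm z"
        using norm_cauchy_schwarz[of z "Y (r m)"] Y(1)[of "r m"] by (simp add: T_def)
    qed
    then have "z \<noteq> 0" and s2: "s\<^sup>2 \<le> (norm z)\<^sup>2"
      using s by (auto intro: power_mono)
    have zz: "(1 / real n) * (\<Sum>j<n. c j * inner (x (int j)) z) = (norm z)\<^sup>2"
      using inner_z[of z] by (simp add: power2_norm_eq_inner)
    \<comment> \<open>equality in Cauchy--Schwarz: the score vector of \<open>z\<close> is \<open>s\<close> times the limiting score vector \<open>c\<close>\<close>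
    have "(1 / real n) * (\<Sum>j<n. (inner (x (int j)) z - s * c j)\<^sup>2) =
        ?q z - 2 * s * ((1 / real n) * (\<Sum>j<n. c j * inner (x (int j)) z)) + s\<^sup>2 * ((1 / real n) * (\<Sum>j<n. c j * c j))"
      unfolding emp_form_def
      by (simp add: power2_eq_square algebra_simps sum.distrib sum_subtractf sum_distrib_left)
    also have "\<dots> = ?q z - 2 * s * (norm z)\<^sup>2 + s\<^sup>2 * s"
      using zz s_eq by simp
    also have "\<dots> \<le> s * (s\<^sup>2 - (norm z)\<^sup>2)"
      using q_le[OF \<open>z \<in> S\<close>] by (simp add: algebra_simps)
    also have "\<dots> \<le> 0"
      using s2 s by (simp add: mult_nonneg_nonpos)
    finally have "(\<Sum>j<n. (inner (x (int j)) z - s * c j)\<^sup>2) \<le> 0"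
      using n by (simp add: divide_le_0_iff)
    then have "(\<Sum>j<n. (inner (x (int j)) z - s * c j)\<^sup>2) = 0"
      by (intro antisym sum_nonneg) auto
    then have c_eq: "inner (x (int j)) z = s * c j" if "j < n" for j
      using that by (simp add: sum_nonneg_eq_0_iff)
    have "emp_cov n x z = s *\<^sub>R z"
      unfolding emp_cov_def tensor_op_def z_def[unfolded, symmetric]
      unfolding z_def scaleR_sum_right using c_eq[unfolded z_def scaleR_sum_right]
      by (intro sum.cong) (auto simp: mult.commute)
    then have "z \<in> span {v j | j. 1 \<le> j \<and> \<mu> j = s}"
      using s eigenspace_eq[of s] by (auto simp: eigenspace_def)
    moreover have "orthogonal z w" if "w \<in> {v j | j. 1 \<le> j \<and> \<mu> j = s}" for w
    proof -
      from that obtain j where j: "w = v j" "1 \<le> j" "\<mu> j = s" by blast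
      then have "j < k"
        using \<mu>_antimono[of k j] k s by (meson not_le)
      then show ?thesis
        using j \<open>z \<in> S\<close> by (auto simp: S_def orthogonal_def inner_commute)
    qed
    ultimately have "orthogonal z z"
      using orthogonal_to_span by blast
    then show False
      using \<open>z \<noteq> 0\<close> by (simp add: orthogonal_self)
  qed
  moreover have "y \<in> S" using y by (simp add: S_def)
  ultimately show ?thesis
    using q_le[of y] by (meson mult_right_mono order_trans zero_le_power2)
qed

text \<open>The half of the Courant--Fischer principle that bounds an eigenvalue from below: some vector of the
test space is orthogonal to the first \<open>k - 1\<close> eigenvectors.\<close>

lemma min_max_lower_bound:
  assumes W: "orthonormal_set W" "card W = k" "k \<ge> 1"
    and m: "\<And>y. y \<in> span W \<Longrightarrow> m * (norm y)\<^sup>2 \<le> emp_form n x y y"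
  shows "m \<le> \<mu> k"
proof -
  have "card (v ` {1..<k}) < card W"
    using W(2,3) card_image_le[of "{1..<k}" v] by simp
  then obtain y where y: "y \<in> span W" "y \<noteq> 0" "\<And>u. u \<in> v ` {1..<k} \<Longrightarrow> inner u y = 0"
    using orthogonal_vector_in_span[OF W(1), of "v ` {1..<k}"] by blast
  have "emp_form n x y y \<le> \<mu> k * (norm y)\<^sup>2"
    using y(3) by (intro rayleigh_bound W(3)) auto
  then have "m * (norm y)\<^sup>2 \<le> \<mu> k * (norm y)\<^sup>2"
    using m[OF y(1)] by linarith
  then show ?thesis
    using y(2) by simp
qed

text \<open>Split \<open>c\<close> into its projection on the first \<open>k\<close> eigenvectors, on which the form is diagonal, and a
remainder, on which the form is at most \<open>\<mu> k\<close>.\<close>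

lemma form_le:
  assumes k: "k \<ge> 1" and c: "norm c = 1"
  shows "emp_form n x c c \<le> \<mu> k + (\<Sum>l=1..k. (\<mu> l - \<mu> k) * (inner (v l) c)\<^sup>2)"
proof -
  define p where "p = proj (v ` {1..k}) c"
  have p: "p = (\<Sum>l=1..k. inner (v l) c *\<^sub>R v l)"
    unfolding p_def proj_def by (rule sum_image_v)
  have v_p: "inner (v l) (c - p) = 0" if "l \<in> {1..k}" for l
    unfolding p_def using that by (intro inner_proj[OF orthonormal_v(1)] span_base) auto
  have "emp_form n x p (c - p) = 0"
    by (subst p) (simp add: emp_form_sum_left emp_form_scaleR_left form_v v_p)
  moreover have "emp_form n x p p = (\<Sum>l=1..k. \<mu> l * (inner (v l) c)\<^sup>2)"
  proof -
    have "inner (v l) p = inner (v l) c" if "l \<in> {1..k}" for l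
      using v_p[OF that] by (simp add: inner_diff_right)
    then have "(\<Sum>l=1..k. emp_form n x (inner (v l) c *\<^sub>R v l) p) = (\<Sum>l=1..k. \<mu> l * (inner (v l) c)\<^sup>2)"
      by (intro sum.cong refl) (simp add: emp_form_scaleR_left form_v power2_eq_square)
    then show ?thesis
      using emp_form_sum_left[of n x "\<lambda>l. inner (v l) c *\<^sub>R v l" "{1..k}" p] p by simp
  qed
  moreover have "emp_form n x (c - p) (c - p) \<le> \<mu> k * (1 - (\<Sum>l=1..k. (inner (v l) c)\<^sup>2))"
  proof -
    have "(norm (c - p))\<^sup>2 = 1 - (\<Sum>l=1..k. (inner (v l) c)\<^sup>2)"
      using norm_diff_proj[OF orthonormal_v(1)[of k], of c] c
      unfolding p_def sum_image_v by simp
    then show ?thesis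
      using rayleigh_bound[of k "c - p"] k v_p by auto
  qed
  moreover have "emp_form n x c c = emp_form n x p p + 2 * emp_form n x p (c - p) + emp_form n x (c - p) (c - p)"
    using emp_form_add_left[of n x p "c - p"] emp_form_add_right[of n x _ p "c - p"] emp_form_commute[of n x p "c - p"]
    by simp
  ultimately show ?thesis
    by (simp add: algebra_simps sum_subtractf sum_distrib_left)
qed

text \<open>Sum the preceding bound over \<open>C\<close>; the weight that \<open>C\<close> gives to each eigenvector is at most 1 by
Bessel's inequality.\<close>

lemma ky_fan:
  assumes C: "orthonormal_set C" "card C \<le> k" and k: "k \<ge> 1"
  shows "(\<Sum>c\<in>C. emp_form n x c c) \<le> (\<Sum>l=1..k. \<mu> l)"
proof -
  have "(\<Sum>c\<in>C. emp_form n x c c) \<le> (\<Sum>c\<in>C. \<mu> k + (\<Sum>l=1..k. (\<mu> l - \<mu> k) * (inner (v l) c)\<^sup>2))"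
    using C(1) k by (intro sum_mono form_le) (auto simp: orthonormal_set_def)
  also have "\<dots> = real (card C) * \<mu> k + (\<Sum>l=1..k. (\<mu> l - \<mu> k) * (\<Sum>c\<in>C. (inner c (v l))\<^sup>2))"
    by (simp add: sum.distrib sum_distrib_left sum.swap[of _ _ C] inner_commute)
  also have "\<dots> \<le> real k * \<mu> k + (\<Sum>l=1..k. (\<mu> l - \<mu> k) * 1)"
  proof (intro add_mono mult_right_mono sum_mono mult_left_mono)
    show "0 \<le> \<mu> k" using \<mu>_nonneg k .
    show "(\<Sum>c\<in>C. (inner c (v l))\<^sup>2) \<le> 1" if "l \<in> {1..k}" for l
      using bessel_ineq[OF C(1), of "v l"] v_inner[of l l] that by (simp add: power2_norm_eq_inner)
    show "0 \<le> \<mu> l - \<mu> k" if "l \<in> {1..k}" for l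
      using \<mu>_antimono[of l k] that by simp
  qed (use C(2) in simp)
  also have "\<dots> = (\<Sum>l=1..k. \<mu> l)"
    by (simp add: sum_subtractf)
  finally show ?thesis .
qed

lemma sum_norm_diff_proj:
  assumes C: "orthonormal_set C"
  shows "(\<Sum>j<n. (norm (x (int j) - proj C (x (int j))))\<^sup>2) =
    (\<Sum>j<n. (norm (x (int j)))\<^sup>2) - real n * (\<Sum>c\<in>C. emp_form n x c c)"
  using n unfolding norm_diff_proj[OF C] emp_form_def
  by (simp add: sum_subtractf sum_distrib_left sum.swap[of _ C] inner_commute power2_eq_square)

text \<open>The squared distances and the form values over an orthonormal set add up to a constant, so the
maximum principle for the form is a minimum principle for the distance.\<close>

lemma pca_optimal:
  assumes C: "orthonormal_set C" "card C \<le> k" and k: "k \<ge> 1"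
  shows "(\<Sum>j<n. (norm (x (int j) - proj (v ` {1..k}) (x (int j))))\<^sup>2) \<le>
    (\<Sum>j<n. (norm (x (int j) - proj C (x (int j))))\<^sup>2)"
proof -
  have "(\<Sum>c\<in>v ` {1..k}. emp_form n x c c) = (\<Sum>l=1..k. \<mu> l)"
    unfolding sum_image_v by (intro sum.cong refl) (simp add: form_v v_inner)
  then show ?thesis
    unfolding sum_norm_diff_proj[OF C(1)] sum_norm_diff_proj[OF orthonormal_v(1)]
    using ky_fan[OF C k] by (simp add: mult_left_mono)
qed

end

section \<open>Prediction error of the estimated operator\<close>

lemma norm_add_sq_le: "(norm (x + y))\<^sup>2 \<le> 2 * (norm x)\<^sup>2 + 2 * (norm (y::'a::real_inner))\<^sup>2"
proof -
  have "(norm (x + y))\<^sup>2 + (norm (x - y))\<^sup>2 = 2 * (norm x)\<^sup>2 + 2 * (norm y)\<^sup>2"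
    by (simp add: power2_norm_eq_inner inner_add_left inner_add_right inner_diff_left inner_diff_right)
  then show ?thesis
    by (smt (verit) zero_le_power2)
qed

lemma norm_diff_sq_le: "(norm (x - y))\<^sup>2 \<le> 2 * (norm x)\<^sup>2 + 2 * (norm (y::'a::real_inner))\<^sup>2"
  using norm_add_sq_le[of x "- y"] by simp

text \<open>The mean minimizes the sum of squared distances.\<close>

lemma sum_norm_centered_le:
  fixes d :: "'i \<Rightarrow> 'a::real_inner"
  assumes "finite I" "I \<noteq> {}"
  shows "(\<Sum>i\<in>I. (norm (d i - (1 / real (card I)) *\<^sub>R (\<Sum>j\<in>I. d j)))\<^sup>2) \<le> (\<Sum>i\<in>I. (norm (d i))\<^sup>2)"
proof -
  let ?N = "real (card I)"
  define m where "m = (1 / ?N) *\<^sub>R (\<Sum>j\<in>I. d j)"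
  have N: "?N > 0" using assms by (simp add: card_gt_0_iff)
  then have m: "(\<Sum>j\<in>I. d j) = ?N *\<^sub>R m" by (simp add: m_def)
  have "(\<Sum>i\<in>I. (norm (d i - m))\<^sup>2) = (\<Sum>i\<in>I. (norm (d i))\<^sup>2) - 2 * inner (\<Sum>j\<in>I. d j) m + ?N * (norm m)\<^sup>2"
    by (simp add: power2_norm_eq_inner inner_diff_left inner_diff_right inner_sum_left inner_sum_right sum.distrib
        sum_subtractf sum_distrib_left inner_commute algebra_simps)
  also have "\<dots> = (\<Sum>i\<in>I. (norm (d i))\<^sup>2) - ?N * (norm m)\<^sup>2"
    by (simp add: m power2_norm_eq_inner)
  finally show ?thesis
    using N by (simp add: m_def)
qed

context empirical_eigensystem
begin

text \<open>The empirical scores \<open>inner (v l) (x j)\<close> are uncorrelated over \<open>j\<close>, with variances \<open>\<mu> l\<close>: this is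
the diagonalization of the empirical covariance. Hence mixed terms vanish.\<close>

lemma sum_norm_scores:
  fixes w :: "nat \<Rightarrow> 'b::real_inner"
  assumes \<mu>k: "\<mu> k > 0"
  shows "(1 / real n) * (\<Sum>j<n. (norm (\<Sum>l=1..k. ((1 / \<mu> l) * inner (v l) (x (int j))) *\<^sub>R w l))\<^sup>2) =
    (\<Sum>l=1..k. (1 / \<mu> l) * (norm (w l))\<^sup>2)"
proof -
  have pos: "\<mu> l > 0" if "l \<in> {1..k}" for l
    using \<mu>_antimono[of l k] that \<mu>k by auto
  have "(1 / real n) * (\<Sum>j<n. (norm (\<Sum>l=1..k. ((1 / \<mu> l) * inner (v l) (x (int j))) *\<^sub>R w l))\<^sup>2) =
     (\<Sum>l=1..k. \<Sum>l'=1..k. (1 / \<mu> l) * (1 / \<mu> l') * inner (w l) (w l') * emp_form n x (v l) (v l'))"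
    unfolding norm_sum_scaleR_sq sum_distrib_left emp_form_def
    by (rule trans[OF sum.swap], rule sum.cong[OF refl], rule trans[OF sum.swap], intro sum.cong refl)
       (simp add: inner_commute ac_simps)
  also have "\<dots> = (\<Sum>l=1..k. \<Sum>l'=1..k. if l = l' then (1 / \<mu> l) * (norm (w l))\<^sup>2 else 0)"
    using pos by (intro sum.cong refl) (auto simp: form_v v_inner power2_norm_eq_inner dest: less_imp_neq)
  also have "\<dots> = (\<Sum>l=1..k. (1 / \<mu> l) * (norm (w l))\<^sup>2)"
    by simp
  finally show ?thesis .
qed

end

text \<open>A fixed path that satisfies the autoregressive equation at the observed times. All statements here
are deterministic.\<close>

locale empirical_ar = empirical_eigensystem +
  fixes e :: "int \<Rightarrow> 'a::real_inner" and \<Psi> :: "'a \<Rightarrow> 'a"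
  assumes Psi: "bounded_linear \<Psi>"
    and ar: "\<And>j. j < n \<Longrightarrow> x (int j + 1) = \<Psi> (x (int j)) + e (int j + 1)"
begin

definition noise_cov :: "'a \<Rightarrow> 'a" where
  "noise_cov y = (1 / real n) *\<^sub>R (\<Sum>j<n. inner (x (int j)) y *\<^sub>R e (int j + 1))"

lemma emp_cross_cov_eq: "emp_cross_cov n x y = \<Psi> (emp_cov n x y) + noise_cov y"
proof -
  interpret bounded_linear \<Psi> by (rule Psi)
  have "(\<Sum>j<n. tensor_op (x (int j)) (x (int j + 1)) y) =
      (\<Sum>j<n. inner (x (int j)) y *\<^sub>R \<Psi> (x (int j)) + inner (x (int j)) y *\<^sub>R e (int j + 1))"
    by (intro sum.cong refl) (simp add: tensor_op_def ar scaleR_add_right)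
  then show ?thesis
    unfolding emp_cross_cov_def noise_cov_def emp_cov_def
    by (simp add: tensor_op_def scaleR sum sum.distrib scaleR_add_right)
qed

lemma linear_noise_cov: "linear noise_cov"
  unfolding noise_cov_def
  by (intro linearI) (simp_all add: inner_add_right scaleR_add_left sum.distrib scaleR_add_right scaleR_sum_right ac_simps)

lemma linear_emp_cov: "linear (emp_cov n x)"
  unfolding emp_cov_def tensor_op_def
  by (intro linearI) (simp_all add: inner_add_right scaleR_add_left sum.distrib scaleR_add_right scaleR_sum_right ac_simps)

text \<open>The empirical covariance operator composed with its truncated inverse is the projection on the
leading eigenvectors.\<close>

lemma Psi_hat_eq:
  assumes \<mu>k: "\<mu> k > 0"
  shows "Psi_hat n k \<mu> v x y =
    \<Psi> (proj (v ` {1..k}) y) + (\<Sum>l=1..k. ((1 / \<mu> l) * inner (v l) y) *\<^sub>R noise_cov (v l))"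
proof -
  have pos: "\<mu> l > 0" if "l \<in> {1..k}" for l
    using \<mu>_antimono[of l k] that \<mu>k by auto
  define z where "z = truncated_inverse k \<mu> v y"
  have z: "z = (\<Sum>l=1..k. ((1 / \<mu> l) * inner (v l) y) *\<^sub>R v l)"
    unfolding z_def truncated_inverse_def tensor_op_def by simp
  have "emp_cov n x z = (\<Sum>l=1..k. ((1 / \<mu> l) * inner (v l) y) *\<^sub>R \<mu> l *\<^sub>R v l)"
    unfolding z linear_sum[OF linear_emp_cov] linear_scale[OF linear_emp_cov]
    by (intro sum.cong refl) (simp add: cov_v)
  also have "\<dots> = (\<Sum>l=1..k. inner (v l) y *\<^sub>R v l)"
  proof (intro sum.cong refl)
    fix l assume "l \<in> {1..k}"
    then show "((1 / \<mu> l) * inner (v l) y) *\<^sub>R \<mu> l *\<^sub>R v l = inner (v l) y *\<^sub>R v l"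
      using pos[of l] by simp
  qed
  also have "\<dots> = proj (v ` {1..k}) y"
    unfolding proj_def sum_image_v ..
  finally have "emp_cov n x z = proj (v ` {1..k}) y" .
  moreover have "noise_cov z = (\<Sum>l=1..k. ((1 / \<mu> l) * inner (v l) y) *\<^sub>R noise_cov (v l))"
    unfolding z linear_sum[OF linear_noise_cov] linear_scale[OF linear_noise_cov] ..
  ultimately show ?thesis
    unfolding Psi_hat_def using emp_cross_cov_eq[of z] by (simp add: z_def)
qed

lemma sum_norm_noise_cov:
  "(\<Sum>l=1..k. (norm (noise_cov (v l)))\<^sup>2) \<le>
     hs_norm_sq {..<n} (\<lambda>j. x (int j)) (\<lambda>j. e (int j + 1)) / (real n)\<^sup>2"
proof -
  have "(\<Sum>l=1..k. (norm (noise_cov (v l)))\<^sup>2) =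
      (\<Sum>c\<in>v ` {1..k}. (norm (\<Sum>j<n. inner (x (int j)) c *\<^sub>R e (int j + 1)))\<^sup>2) / (real n)\<^sup>2"
    unfolding sum_image_v noise_cov_def by (simp add: power_divide sum_divide_distrib)
  then show ?thesis
    using hs_norm_sq_bessel[OF finite_lessThan[of n] orthonormal_v(1)[of k], of "\<lambda>j. x (int j)" "\<lambda>j. e (int j + 1)"]
    by (simp add: divide_right_mono)
qed

lemma mean_sq_prediction_error:
  assumes \<mu>k: "\<mu> k > 0" and k: "k \<ge> 1" and C: "orthonormal_set C" "card C \<le> k"
  shows "(1 / real n) * (\<Sum>j<n. (norm (\<Psi> (x (int j)) - Psi_hat n k \<mu> v x (x (int j))))\<^sup>2) \<le>
     2 * (onorm \<Psi>)\<^sup>2 * ((1 / real n) * (\<Sum>j<n. (norm (x (int j) - proj C (x (int j))))\<^sup>2))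
     + 2 / \<mu> k * (hs_norm_sq {..<n} (\<lambda>j. x (int j)) (\<lambda>j. e (int j + 1)) / (real n)\<^sup>2)"
proof -
  interpret bounded_linear \<Psi> by (rule Psi)
  let ?V = "v ` {1..k}"
  let ?s = "\<lambda>y. \<Sum>l=1..k. ((1 / \<mu> l) * inner (v l) y) *\<^sub>R noise_cov (v l)"
  have "(norm (\<Psi> y - Psi_hat n k \<mu> v x y))\<^sup>2 \<le> 2 * (onorm \<Psi>)\<^sup>2 * (norm (y - proj ?V y))\<^sup>2 + 2 * (norm (?s y))\<^sup>2" for y
  proof -
    have "\<Psi> y - Psi_hat n k \<mu> v x y = \<Psi> (y - proj ?V y) - ?s y"
      unfolding Psi_hat_eq[OF \<mu>k] by (simp add: diff)
    moreover have "(norm (\<Psi> (y - proj ?V y)))\<^sup>2 \<le> (onorm \<Psi> * norm (y - proj ?V y))\<^sup>2"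
      by (intro power_mono onorm[OF Psi] norm_ge_zero)
    ultimately show ?thesis
      using norm_diff_sq_le[of "\<Psi> (y - proj ?V y)" "?s y"] by (simp add: power_mult_distrib)
  qed
  then have "(1 / real n) * (\<Sum>j<n. (norm (\<Psi> (x (int j)) - Psi_hat n k \<mu> v x (x (int j))))\<^sup>2) \<le>
      (1 / real n) * (\<Sum>j<n. 2 * (onorm \<Psi>)\<^sup>2 * (norm (x (int j) - proj ?V (x (int j))))\<^sup>2 + 2 * (norm (?s (x (int j))))\<^sup>2)"
    by (intro mult_left_mono sum_mono) auto
  also have "\<dots> = 2 * (onorm \<Psi>)\<^sup>2 * ((1 / real n) * (\<Sum>j<n. (norm (x (int j) - proj ?V (x (int j))))\<^sup>2))
      + 2 * ((1 / real n) * (\<Sum>j<n. (norm (?s (x (int j))))\<^sup>2))"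
    by (simp add: sum.distrib sum_distrib_left distrib_left ac_simps)
  also have "\<dots> \<le> 2 * (onorm \<Psi>)\<^sup>2 * ((1 / real n) * (\<Sum>j<n. (norm (x (int j) - proj C (x (int j))))\<^sup>2))
      + 2 * ((1 / \<mu> k) * (hs_norm_sq {..<n} (\<lambda>j. x (int j)) (\<lambda>j. e (int j + 1)) / (real n)\<^sup>2))"
  proof (intro add_mono mult_left_mono pca_optimal[OF C k])
    have "(1 / real n) * (\<Sum>j<n. (norm (?s (x (int j))))\<^sup>2) = (\<Sum>l=1..k. (1 / \<mu> l) * (norm (noise_cov (v l)))\<^sup>2)"
      by (rule sum_norm_scores[OF \<mu>k])
    also have "\<dots> \<le> (\<Sum>l=1..k. (1 / \<mu> k) * (norm (noise_cov (v l)))\<^sup>2)"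
      using \<mu>_antimono[of _ k] \<mu>k by (intro sum_mono mult_right_mono divide_left_mono mult_pos_pos) fastforce+
    also have "\<dots> \<le> (1 / \<mu> k) * (hs_norm_sq {..<n} (\<lambda>j. x (int j)) (\<lambda>j. e (int j + 1)) / (real n)\<^sup>2)"
      unfolding sum_distrib_left[symmetric] using \<mu>k by (intro mult_left_mono sum_norm_noise_cov) auto
    finally show "(1 / real n) * (\<Sum>j<n. (norm (?s (x (int j))))\<^sup>2) \<le> \<dots>" .
  qed auto
  finally show ?thesis by simp
qed

text \<open>Centering the residuals subtracts the mean of their errors, which can only decrease the sum of
squares, and the mean of the innovations, which is the last term.\<close>

lemma mean_sq_residual_error:
  assumes \<mu>k: "\<mu> k > 0" and k: "k \<ge> 1" and C: "orthonormal_set C" "card C \<le> k"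
  shows "(1 / real n) * (\<Sum>j=1..n. (norm (centered_residual n k \<mu> v x j - e (int j)))\<^sup>2) \<le>
     4 * (onorm \<Psi>)\<^sup>2 * ((1 / real n) * (\<Sum>j<n. (norm (x (int j) - proj C (x (int j))))\<^sup>2))
     + 4 / \<mu> k * (hs_norm_sq {..<n} (\<lambda>j. x (int j)) (\<lambda>j. e (int j + 1)) / (real n)\<^sup>2)
     + 2 * (norm ((1 / real n) *\<^sub>R (\<Sum>j=1..n. e (int j))))\<^sup>2"
proof -
  define d where "d j = residual n k \<mu> v x j - e (int j)" for j
  define m where "m = (1 / real n) *\<^sub>R (\<Sum>j=1..n. d j)"
  define me where "me = (1 / real n) *\<^sub>R (\<Sum>j=1..n. e (int j))"
  have d: "d (Suc j) = \<Psi> (x (int j)) - Psi_hat n k \<mu> v x (x (int j))" if "j < n" for j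
    using ar[OF that] by (simp add: d_def residual_def add.commute)
  have "centered_residual n k \<mu> v x j - e (int j) = (d j - m) - me" for j
    unfolding centered_residual_def d_def m_def me_def
    by (simp add: sum_subtractf scaleR_diff_right)
  then have "(\<Sum>j=1..n. (norm (centered_residual n k \<mu> v x j - e (int j)))\<^sup>2) \<le>
      (\<Sum>j=1..n. 2 * (norm (d j - m))\<^sup>2 + 2 * (norm me)\<^sup>2)"
    by (intro sum_mono) (simp only: norm_diff_sq_le)
  also have "\<dots> = 2 * (\<Sum>j=1..n. (norm (d j - m))\<^sup>2) + 2 * real n * (norm me)\<^sup>2"
    by (simp add: sum.distrib sum_distrib_left)
  also have "\<dots> \<le> 2 * (\<Sum>j=1..n. (norm (d j))\<^sup>2) + 2 * real n * (norm me)\<^sup>2"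
    using sum_norm_centered_le[of "{1..n}" d] n unfolding m_def by simp
  also have "(\<Sum>j=1..n. (norm (d j))\<^sup>2) = (\<Sum>j<n. (norm (\<Psi> (x (int j)) - Psi_hat n k \<mu> v x (x (int j))))\<^sup>2)"
    using sum.atLeast_Suc_atMost_Suc_shift[of "\<lambda>j. (norm (d j))\<^sup>2" 0 "n - 1"] n d
    by (simp add: lessThan_Suc_atMost[symmetric] atMost_atLeast0[symmetric])
  finally have "(1 / real n) * (\<Sum>j=1..n. (norm (centered_residual n k \<mu> v x j - e (int j)))\<^sup>2) \<le>
      (1 / real n) * (2 * (\<Sum>j<n. (norm (\<Psi> (x (int j)) - Psi_hat n k \<mu> v x (x (int j))))\<^sup>2) + 2 * real n * (norm me)\<^sup>2)"
    by (intro mult_left_mono) auto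
  also have "\<dots> = 2 * ((1 / real n) * (\<Sum>j<n. (norm (\<Psi> (x (int j)) - Psi_hat n k \<mu> v x (x (int j))))\<^sup>2)) + 2 * (norm me)\<^sup>2"
    using n by (simp add: distrib_left)
  finally show ?thesis
    using mean_sq_prediction_error[OF \<mu>k k C] unfolding me_def by (simp add: algebra_simps)
qed

end

section \<open>Mallows distance from an empirical distribution\<close>

text \<open>The coupling with the largest possible diagonal: keep the common mass \<open>min p r\<close> on the diagonal and
distribute the two excess parts, of equal mass \<open>\<rho>\<close>, as a product. For \<open>\<rho> = 0\<close> division by zero gives 0,
which is then the correct off-diagonal part.\<close>

lemma maximal_coupling_finite:
  fixes p r :: "'c \<Rightarrow> real"
  assumes A: "finite A" and nonneg: "\<And>a. a \<in> A \<Longrightarrow> 0 \<le> p a" "\<And>a. a \<in> A \<Longrightarrow> 0 \<le> r a"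
    and sums: "sum p A = 1" "sum r A = 1"
  obtains \<theta> :: "'c \<Rightarrow> 'c \<Rightarrow> real" where
    "\<And>a b. a \<in> A \<Longrightarrow> b \<in> A \<Longrightarrow> 0 \<le> \<theta> a b"
    "\<And>a. a \<in> A \<Longrightarrow> (\<Sum>b\<in>A. \<theta> a b) = p a"
    "\<And>b. b \<in> A \<Longrightarrow> (\<Sum>a\<in>A. \<theta> a b) = r b"
    "(\<Sum>a\<in>A. \<Sum>b\<in>A. if a = b then 0 else \<theta> a b) \<le> (\<Sum>a\<in>A. \<bar>p a - r a\<bar>)"
proof -
  define m where "m a = min (p a) (r a)" for a
  define \<rho> where "\<rho> = 1 - sum m A"
  define \<theta> where "\<theta> a b = (if a = b then m a else 0) + (p a - m a) * (r b - m b) / \<rho>" for a b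
  have m: "0 \<le> m a" "m a \<le> p a" "m a \<le> r a" if "a \<in> A" for a
    using nonneg[OF that] by (auto simp: m_def)
  have p\<rho>: "(\<Sum>a\<in>A. p a - m a) = \<rho>" and r\<rho>: "(\<Sum>a\<in>A. r a - m a) = \<rho>"
    by (simp_all add: sum_subtractf sums \<rho>_def)
  have \<rho>0: "0 \<le> \<rho>"
    unfolding p\<rho>[symmetric] by (intro sum_nonneg) (simp add: m)
  have zero: "p a = m a" "r a = m a" if "\<rho> = 0" "a \<in> A" for a
  proof -
    have "\<forall>a\<in>A. p a - m a = 0"
      using p\<rho> that(1) m(2) by (subst sum_nonneg_eq_0_iff[OF A, symmetric]) auto
    then show "p a = m a" using that(2) by simp
    have "\<forall>a\<in>A. r a - m a = 0"
      using r\<rho> that(1) m(3) by (subst sum_nonneg_eq_0_iff[OF A, symmetric]) auto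
    then show "r a = m a" using that(2) by simp
  qed
  have "0 \<le> \<theta> a b" if "a \<in> A" "b \<in> A" for a b
    using m[OF that(1)] m[OF that(2)] \<rho>0 by (simp add: \<theta>_def)
  moreover have "(\<Sum>b\<in>A. \<theta> a b) = p a" if "a \<in> A" for a
  proof -
    have "(\<Sum>b\<in>A. \<theta> a b) = m a + (p a - m a) * \<rho> / \<rho>"
      using A that unfolding \<theta>_def sum.distrib sum_divide_distrib[symmetric] sum_distrib_left[symmetric] r\<rho> by simp
    then show ?thesis using zero[of a] that by (cases "\<rho> = 0") auto
  qed
  moreover have "(\<Sum>a\<in>A. \<theta> a b) = r b" if "b \<in> A" for b
  proof -
    have "(\<Sum>a\<in>A. \<theta> a b) = m b + \<rho> * (r b - m b) / \<rho>"
      using A that unfolding \<theta>_def sum.distrib sum_divide_distrib[symmetric] sum_distrib_right[symmetric] p\<rho> by simp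
    then show ?thesis using zero[of b] that by (cases "\<rho> = 0") auto
  qed
  moreover have "(\<Sum>a\<in>A. \<Sum>b\<in>A. if a = b then 0 else \<theta> a b) \<le> (\<Sum>a\<in>A. \<bar>p a - r a\<bar>)"
  proof -
    have "(\<Sum>a\<in>A. \<Sum>b\<in>A. if a = b then 0 else \<theta> a b) \<le> (\<Sum>a\<in>A. \<Sum>b\<in>A. (p a - m a) * (r b - m b) / \<rho>)"
      using m \<rho>0 by (intro sum_mono) (auto simp: \<theta>_def)
    also have "\<dots> = \<rho> * \<rho> / \<rho>"
      unfolding sum_divide_distrib[symmetric] sum_distrib_left[symmetric] sum_distrib_right[symmetric] p\<rho> r\<rho> ..
    also have "\<dots> = (\<Sum>a\<in>A. p a - m a)"
      by (simp add: p\<rho>)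
    also have "\<dots> \<le> (\<Sum>a\<in>A. \<bar>p a - r a\<bar>)"
      by (intro sum_mono) (auto simp: m_def)
    finally show ?thesis .
  qed
  ultimately show ?thesis by (rule that)
qed

lemma nn_integral_uniform_count:
  assumes "finite A" "A \<noteq> {}"
  shows "(\<integral>\<^sup>+x. f x \<partial>uniform_count_measure A) = ennreal (1 / real (card A)) * (\<Sum>x\<in>A. f x)"
proof -
  have "1 / of_nat (card A) = ennreal (1 / real (card A))"
    using assms divide_ennreal[of 1 "real (card A)"] by (simp add: card_gt_0_iff ennreal_of_nat_eq_real_of_nat)
  then show ?thesis
    unfolding uniform_count_measure_def nn_integral_point_measure_finite[OF assms(1)]
    by (simp add: sum_distrib_left)
qed

lemma nn_integral_finite_range:
  fixes q :: "'b \<Rightarrow> 'c"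
  assumes q: "simple_function F q" and F: "prob_space F" "space F = UNIV"
    and g: "\<And>b. b \<in> range q \<Longrightarrow> 0 \<le> g b"
  shows "(\<integral>\<^sup>+y. ennreal (g (q y)) \<partial>F) = ennreal (\<Sum>b\<in>range q. g b * measure F (q -` {b}))"
proof -
  interpret prob_space F by fact
  have fin: "finite (range q)" and sets: "\<And>b. q -` {b} \<in> sets F"
    using q F(2) simple_functionD[OF q] by auto
  have "ennreal (g (q y)) = (\<Sum>b\<in>range q. ennreal (g b) * indicator (q -` {b}) y)" for y
  proof -
    have "(\<Sum>b\<in>range q. ennreal (g b) * indicator (q -` {b}) y) = (\<Sum>b\<in>range q. if q y = b then ennreal (g b) else 0)"
      by (intro sum.cong refl) (auto simp: indicator_def)
    then show ?thesis using fin by simp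
  qed
  then have "(\<integral>\<^sup>+y. ennreal (g (q y)) \<partial>F) = (\<Sum>b\<in>range q. ennreal (g b) * emeasure F (q -` {b}))"
    using sets by (simp only:) (subst nn_integral_sum, auto simp: nn_integral_cmult_indicator)
  also have "\<dots> = (\<Sum>b\<in>range q. ennreal (g b * measure F (q -` {b})))"
    by (intro sum.cong refl) (simp add: emeasure_eq_measure ennreal_mult'' g)
  also have "\<dots> = ennreal (\<Sum>b\<in>range q. g b * measure F (q -` {b}))"
    using g by (intro sum_ennreal) (auto simp: zero_le_mult_iff)
  finally show ?thesis .
qed

text \<open>Passing from the extended infimum to a real number is harmless because the cost of the given
coupling is finite.\<close>

lemma mallows_dist_sq_le:
  assumes \<pi>: "\<pi> \<in> couplings F G" and B: "0 \<le> B"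
    and cost: "(\<integral>\<^sup>+ z. ennreal ((norm (fst z - snd z))\<^sup>2) \<partial>\<pi>) \<le> ennreal B"
  shows "(mallows_dist F G)\<^sup>2 \<le> B"
proof -
  have "(INF \<pi>\<in>couplings F G. \<integral>\<^sup>+ z. ennreal ((norm (fst z - snd z))\<^sup>2) \<partial>\<pi>) \<le> ennreal B"
    using cost by (rule INF_lower2[OF \<pi>])
  then have "enn2real (INF \<pi>\<in>couplings F G. \<integral>\<^sup>+ z. ennreal ((norm (fst z - snd z))\<^sup>2) \<partial>\<pi>) \<le> B"
    using B by (metis enn2real_ennreal enn2real_mono ennreal_less_top)
  then show ?thesis
    unfolding mallows_dist_def by simp
qed

lemma norm_add3_sq_le:
  fixes x y z :: "'a::real_inner"
  shows "(norm (x + y + z))\<^sup>2 \<le> 3 * (norm x)\<^sup>2 + 3 * (norm y)\<^sup>2 + 3 * (norm z)\<^sup>2"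
proof -
  have "0 \<le> (norm (x - y))\<^sup>2 + (norm (y - z))\<^sup>2 + (norm (x - z))\<^sup>2" by simp
  also have "\<dots> = 3 * (norm x)\<^sup>2 + 3 * (norm y)\<^sup>2 + 3 * (norm z)\<^sup>2 - (norm (x + y + z))\<^sup>2"
    by (simp add: power2_norm_eq_inner inner_add_left inner_add_right inner_diff_left inner_diff_right inner_commute)
  finally show ?thesis by simp
qed

definition cell_freq :: "nat \<Rightarrow> (nat \<Rightarrow> 'a) \<Rightarrow> ('a \<Rightarrow> 'b) \<Rightarrow> 'b \<Rightarrow> real" where
  "cell_freq n e q a = (\<Sum>j=1..n. if q (e j) = a then 1 else 0) / real n"

lemma sum_cell_freq:
  fixes f :: "'b \<Rightarrow> real"
  assumes "finite (range q)"
  shows "(\<Sum>a\<in>range q. cell_freq n e q a * f a) = (1 / real n) * (\<Sum>j=1..n. f (q (e j)))"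
proof -
  have "(\<Sum>a\<in>range q. cell_freq n e q a * f a) = (1 / real n) * (\<Sum>j=1..n. \<Sum>a\<in>range q. if q (e j) = a then f a else 0)"
    unfolding cell_freq_def
    by (subst sum.swap) (auto simp: sum_distrib_right sum_divide_distrib sum_distrib_left intro!: sum.cong)
  then show ?thesis using assms by simp
qed

text \<open>The coupling is built on indices rather than on points: a uniform index \<open>j\<close> and a point \<open>y\<close> of law
\<open>F\<close> get a joint density that depends only on the cells \<open>q (e j)\<close> and \<open>q y\<close> and realizes the maximal
coupling of the two cell distributions. Mapping \<open>j\<close> to \<open>z j\<close> afterwards gives the first marginal for
any points \<open>z\<close>, which replaces a gluing argument for a triangle inequality. The cells of \<open>j\<close> and \<open>y\<close>
differ with probability at most the total variation of the cell distributions, and then their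
representatives are at distance at most \<open>2 K\<close>.\<close>

lemma mallows_dist_empirical_le:
  fixes F :: "'a::{real_inner, second_countable_topology} measure" and e z :: "nat \<Rightarrow> 'a"
  assumes F: "prob_space F" "sets F = sets borel" and n: "n \<ge> 1"
    and q: "simple_function F q" and K: "\<And>y. norm (q y) \<le> K"
    and D: "0 \<le> D" "(\<integral>\<^sup>+ y. ennreal ((norm (q y - y))\<^sup>2) \<partial>F) \<le> ennreal D"
  shows "(mallows_dist (empirical_distribution n z) F)\<^sup>2 \<le>
    3 * ((1 / real n) * (\<Sum>j=1..n. (norm (z j - q (e j)))\<^sup>2))
    + 12 * K\<^sup>2 * (\<Sum>a\<in>range q. \<bar>cell_freq n e q a - measure F (q -` {a})\<bar>)
    + 3 * D"
proof -
  interpret F: prob_space F by fact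
  have space[simp]: "space F = UNIV"
    using sets_eq_imp_space_eq[OF F(2)] by simp
  define I where "I = {1..n}"
  have I: "finite I" "I \<noteq> {}" "card I = n" using n by (auto simp: I_def)
  define U where "U = uniform_count_measure I"
  have setsU: "sets U = sets (count_space I)" and spaceU[simp]: "space U = I"
    by (simp_all add: U_def sets_uniform_count_measure space_uniform_count_measure)
  have U_int: "(\<integral>\<^sup>+j. f j \<partial>U) = ennreal (1 / real n) * (\<Sum>j\<in>I. f j)" for f
    using nn_integral_uniform_count[OF I(1,2)] I(3) by (simp add: U_def)
  define R where "R = range q"
  have R: "finite R" and qR: "\<And>y. q y \<in> R"
    using simple_functionD(1)[OF q] by (auto simp: R_def)
  define p where "p = cell_freq n e q"
  define r where "r a = measure F (q -` {a})" for a
  have p_nonneg: "0 \<le> p a" for a by (auto simp: p_def cell_freq_def intro!: sum_nonneg divide_nonneg_nonneg)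
  have r_nonneg: "0 \<le> r a" for a by (simp add: r_def)
  have sum_p: "(\<Sum>a\<in>R. p a * f a) = (1 / real n) * (\<Sum>j\<in>I. f (q (e j)))" for f
    unfolding R_def p_def I_def using R by (intro sum_cell_freq) (simp add: R_def)
  have int_r: "(\<integral>\<^sup>+y. ennreal (f (q y)) \<partial>F) = ennreal (\<Sum>b\<in>R. f b * r b)" if "\<And>b. b \<in> R \<Longrightarrow> 0 \<le> f b" for f
    unfolding R_def r_def using that by (intro nn_integral_finite_range[OF q F(1)]) (auto simp: R_def)
  have sp: "sum p R = 1"
    using sum_p[of "\<lambda>_. 1"] I n by simp
  have sr: "sum r R = 1"
    using int_r[of "\<lambda>_. 1"] F.emeasure_space_1 by (simp add: sum_nonneg r_nonneg)
  obtain \<theta> where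
    \<theta>_nonneg: "\<And>a b. a \<in> R \<Longrightarrow> b \<in> R \<Longrightarrow> 0 \<le> \<theta> a b" and
    \<theta>_left: "\<And>a. a \<in> R \<Longrightarrow> (\<Sum>b\<in>R. \<theta> a b) = p a" and
    \<theta>_right: "\<And>b. b \<in> R \<Longrightarrow> (\<Sum>a\<in>R. \<theta> a b) = r b" and
    \<theta>_off: "(\<Sum>a\<in>R. \<Sum>b\<in>R. if a = b then 0 else \<theta> a b) \<le> (\<Sum>a\<in>R. \<bar>p a - r a\<bar>)"
    by (rule maximal_coupling_finite[OF R p_nonneg r_nonneg sp sr], rule that)
  define g where "g a b = \<theta> a b / (p a * r b)" for a b
  have g_nonneg: "0 \<le> g a b" if "a \<in> R" "b \<in> R" for a b
    using that by (simp add: g_def \<theta>_nonneg p_nonneg r_nonneg)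
  have \<theta>0: "\<theta> a b = 0" if "a \<in> R" "b \<in> R" "p a = 0 \<or> r b = 0" for a b
  proof (cases "p a = 0")
    case True
    then have "\<forall>b\<in>R. \<theta> a b = 0"
      using \<theta>_left[OF that(1)] \<theta>_nonneg[OF that(1)] by (subst sum_nonneg_eq_0_iff[OF R, symmetric]) auto
    then show ?thesis using that by blast
  next
    case False
    then have "\<forall>a\<in>R. \<theta> a b = 0"
      using that(3) \<theta>_right[OF that(2)] \<theta>_nonneg[OF _ that(2)] by (subst sum_nonneg_eq_0_iff[OF R, symmetric]) auto
    then show ?thesis using that by blast
  qed
  have pgr: "p a * g a b * r b = \<theta> a b" if "a \<in> R" "b \<in> R" for a b
    using \<theta>0[OF that] by (cases "p a = 0 \<or> r b = 0") (simp_all add: g_def)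
  have g_left: "(\<Sum>b\<in>R. g a b * r b) = 1" if "a \<in> R" "p a \<noteq> 0" for a
  proof -
    have "p a * (\<Sum>b\<in>R. g a b * r b) = p a"
      unfolding sum_distrib_left using pgr[OF that(1)] \<theta>_left[OF that(1)] by (simp add: mult.assoc)
    then show ?thesis using that(2) by simp
  qed
  have g_right: "(\<Sum>a\<in>R. p a * g a b) = 1" if "b \<in> R" "r b \<noteq> 0" for b
  proof -
    have "(\<Sum>a\<in>R. p a * g a b) * r b = r b"
      unfolding sum_distrib_right using pgr[OF _ that(1)] \<theta>_right[OF that(1)] by simp
    then show ?thesis using that(2) by simp
  qed
  have p_pos: "p (q (e j)) \<noteq> 0" if "j \<in> I" for j
  proof -
    have "(0::real) < (\<Sum>i\<in>I. if q (e i) = q (e j) then 1 else 0)"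
      using that I(1) by (intro sum_pos2[of _ j]) auto
    then show ?thesis using n by (simp add: p_def cell_freq_def I_def)
  qed
  define h where "h = (\<lambda>(j, y). ennreal (g (q (e j)) (q y)))"
  have meas_q: "(\<lambda>y. f (q y)) \<in> measurable F N" if "range f \<subseteq> space N" for f and N :: "'y measure"
    using that by (intro measurable_compose[OF measurable_simple_function[OF q]]) auto
  have h: "h \<in> borel_measurable (U \<Otimes>\<^sub>M F)"
    unfolding measurable_cong_sets[OF sets_pair_measure_cong[OF setsU refl] refl]
    by (rule measurable_pair_measure_countable1) (auto simp: h_def I countable_finite intro!: meas_q)
  define P where "P = density (U \<Otimes>\<^sub>M F) h"
  have P_int: "(\<integral>\<^sup>+w. f w \<partial>P) = ennreal (1 / real n) * (\<Sum>j\<in>I. \<integral>\<^sup>+y. h (j, y) * f (j, y) \<partial>F)"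
    if [measurable]: "f \<in> borel_measurable (U \<Otimes>\<^sub>M F)" for f
  proof -
    have "(\<integral>\<^sup>+w. f w \<partial>P) = (\<integral>\<^sup>+w. h w * f w \<partial>(U \<Otimes>\<^sub>M F))"
      unfolding P_def using h by (intro nn_integral_density) auto
    also have "\<dots> = (\<integral>\<^sup>+j. \<integral>\<^sup>+y. h (j, y) * f (j, y) \<partial>F \<partial>U)"
      using h by (intro F.nn_integral_fst[symmetric]) auto
    finally show ?thesis by (simp add: U_int)
  qed
  \<comment> \<open>the index is uniform under the coupling, since the density integrates to 1 over \<open>y\<close>\<close>
  have P_fst: "(\<integral>\<^sup>+w. f (fst w) \<partial>P) = ennreal (1 / real n) * (\<Sum>j\<in>I. f j)" for f
  proof -
    have f: "f \<in> borel_measurable U"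
      using setsU by (simp add: measurable_cong_sets[OF setsU refl])
    have "(\<integral>\<^sup>+y. h (j, y) * f j \<partial>F) = f j" if "j \<in> I" for j
    proof -
      have "(\<integral>\<^sup>+y. h (j, y) \<partial>F) = ennreal (\<Sum>b\<in>R. g (q (e j)) b * r b)"
        unfolding h_def split_conv by (intro int_r g_nonneg qR)
      also have "\<dots> = 1" using g_left[OF qR p_pos[OF that]] by simp
      finally show ?thesis
        by (subst nn_integral_multc) (auto simp: h_def intro!: meas_q)
    qed
    then show ?thesis
      using f by (subst P_int) auto
  qed
  \<comment> \<open>the point has law \<open>F\<close>; cells of probability 0 carry no density and are removed as a null set\<close>
  have P_snd: "(\<integral>\<^sup>+w. f (snd w) \<partial>P) = (\<integral>\<^sup>+y. f y \<partial>F)" if f[measurable]: "f \<in> borel_measurable F" for f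
  proof -
    have [measurable]: "(\<lambda>y. h (j, y)) \<in> borel_measurable F" for j
      by (auto simp: h_def intro!: meas_q)
    have "(\<integral>\<^sup>+w. f (snd w) \<partial>P) = ennreal (1 / real n) * (\<Sum>j\<in>I. \<integral>\<^sup>+y. h (j, y) * f y \<partial>F)"
      by (subst P_int) auto
    also have "\<dots> = (\<integral>\<^sup>+y. ennreal (1 / real n) * (\<Sum>j\<in>I. h (j, y)) * f y \<partial>F)"
      by (simp add: nn_integral_sum[symmetric] nn_integral_cmult[symmetric] sum_distrib_right mult.assoc)
    also have "\<dots> = (\<integral>\<^sup>+y. f y \<partial>F)"
    proof (rule nn_integral_cong_AE)
      have "AE y in F. \<forall>b\<in>R. r b = 0 \<longrightarrow> q y \<noteq> b"
      proof (rule AE_finite_allI[OF R])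
        fix b assume "b \<in> R"
        show "AE y in F. r b = 0 \<longrightarrow> q y \<noteq> b"
        proof (cases "r b = 0")
          case True
          have "q -` {b} \<in> null_sets F"
            using True simple_functionD(2)[OF q, of "{b}"]
            by (simp add: null_sets_def r_def F.emeasure_eq_measure)
          then show ?thesis
            by (rule AE_I') auto
        qed simp
      qed
      then show "AE y in F. ennreal (1 / real n) * (\<Sum>j\<in>I. h (j, y)) * f y = f y"
      proof eventually_elim
        case (elim y)
        then have "r (q y) \<noteq> 0" using qR by blast
        have "ennreal (1 / real n) * (\<Sum>j\<in>I. h (j, y)) = ennreal ((1 / real n) * (\<Sum>j\<in>I. g (q (e j)) (q y)))"
          unfolding h_def split_conv by (subst sum_ennreal) (auto simp: g_nonneg qR sum_nonneg simp flip: ennreal_mult')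
        also have "(1 / real n) * (\<Sum>j\<in>I. g (q (e j)) (q y)) = 1"
          using g_right[OF qR \<open>r (q y) \<noteq> 0\<close>] sum_p[of "\<lambda>a. g a (q y)"] by simp
        finally show ?case by simp
      qed
    qed
    finally show ?thesis .
  qed
  have P_q: "(\<integral>\<^sup>+w. ennreal ((norm (q (e (fst w)) - q (snd w)))\<^sup>2) \<partial>P) \<le> ennreal (4 * K\<^sup>2 * (\<Sum>a\<in>R. \<bar>p a - r a\<bar>))"
  proof -
    have K0: "0 \<le> K" using K norm_ge_zero order_trans by blast
    have meas: "(\<lambda>w. ennreal ((norm (q (e (fst w)) - q (snd w)))\<^sup>2)) \<in> borel_measurable (U \<Otimes>\<^sub>M F)"
      unfolding measurable_cong_sets[OF sets_pair_measure_cong[OF setsU refl] refl]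
      by (rule measurable_pair_measure_countable1) (auto simp: I countable_finite intro!: meas_q)
    have "(\<integral>\<^sup>+w. ennreal ((norm (q (e (fst w)) - q (snd w)))\<^sup>2) \<partial>P) =
        ennreal (1 / real n) * (\<Sum>j\<in>I. \<integral>\<^sup>+y. ennreal (g (q (e j)) (q y) * (norm (q (e j) - q y))\<^sup>2) \<partial>F)"
      using meas by (subst P_int) (auto simp: h_def ennreal_mult'' g_nonneg qR)
    also have "(\<Sum>j\<in>I. \<integral>\<^sup>+y. ennreal (g (q (e j)) (q y) * (norm (q (e j) - q y))\<^sup>2) \<partial>F) =
        (\<Sum>j\<in>I. ennreal (\<Sum>b\<in>R. g (q (e j)) b * (norm (q (e j) - b))\<^sup>2 * r b))"
      by (intro sum.cong refl int_r) (simp add: g_nonneg qR)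
    also have "ennreal (1 / real n) * \<dots> = ennreal ((1 / real n) * (\<Sum>j\<in>I. \<Sum>b\<in>R. g (q (e j)) b * (norm (q (e j) - b))\<^sup>2 * r b))"
      by (subst sum_ennreal) (auto simp flip: ennreal_mult' intro!: sum_nonneg mult_nonneg_nonneg g_nonneg qR r_nonneg)
    also have "(1 / real n) * (\<Sum>j\<in>I. \<Sum>b\<in>R. g (q (e j)) b * (norm (q (e j) - b))\<^sup>2 * r b) =
        (\<Sum>a\<in>R. p a * (\<Sum>b\<in>R. g a b * (norm (a - b))\<^sup>2 * r b))"
      using sum_p[of "\<lambda>a. \<Sum>b\<in>R. g a b * (norm (a - b))\<^sup>2 * r b"] by simp
    also have "\<dots> = (\<Sum>a\<in>R. \<Sum>b\<in>R. \<theta> a b * (norm (a - b))\<^sup>2)"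
      by (intro sum.cong refl) (simp add: sum_distrib_left pgr[symmetric] ac_simps)
    also have "\<dots> \<le> (\<Sum>a\<in>R. \<Sum>b\<in>R. (2 * K)\<^sup>2 * (if a = b then 0 else \<theta> a b))"
    proof (intro sum_mono)
      fix a b assume ab: "a \<in> R" "b \<in> R"
      then have "norm (a - b) \<le> 2 * K"
        using K norm_triangle_ineq4[of a b] unfolding R_def by (smt (verit) rangeE)
      then have "(norm (a - b))\<^sup>2 \<le> (2 * K)\<^sup>2" by (intro power_mono) auto
      then show "\<theta> a b * (norm (a - b))\<^sup>2 \<le> (2 * K)\<^sup>2 * (if a = b then 0 else \<theta> a b)"
        using \<theta>_nonneg[OF ab] by (simp add: mult.commute mult_left_mono)
    qed
    also have "\<dots> \<le> (2 * K)\<^sup>2 * (\<Sum>a\<in>R. \<bar>p a - r a\<bar>)"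
      unfolding sum_distrib_left[symmetric] by (intro mult_left_mono \<theta>_off) auto
    finally show ?thesis
      by (simp add: ennreal_leI power_mult_distrib)
  qed
  have P_1: "(\<integral>\<^sup>+w. 1 \<partial>P) = 1"
    using P_fst[of "\<lambda>_. 1"] n I by (simp add: ennreal_of_nat_eq_real_of_nat ennreal_mult[symmetric])
  have prob_P: "prob_space P"
    using P_1 by (intro prob_spaceI) simp
  have setsP: "sets P = sets (U \<Otimes>\<^sub>M F)" by (simp add: P_def)
  define T :: "nat \<times> 'a \<Rightarrow> 'a \<times> 'a" where "T = (\<lambda>(j, y). (z j, y))"
  have T[measurable]: "T \<in> measurable P (borel \<Otimes>\<^sub>M borel)"
    unfolding measurable_cong_sets[OF setsP refl] T_def
    unfolding measurable_cong_sets[OF sets_pair_measure_cong[OF setsU refl] refl]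
    by (rule measurable_pair_measure_countable1) (auto simp: I countable_finite F(2) cong: measurable_cong_sets)
  define \<pi> where "\<pi> = distr P (borel \<Otimes>\<^sub>M borel) T"
  have fst_eq: "distr \<pi> borel fst = distr P borel (\<lambda>w. z (fst w))"
    unfolding \<pi>_def distr_distr[OF measurable_fst T] by (simp add: T_def o_def case_prod_beta)
  have snd_eq: "distr \<pi> borel snd = distr P borel snd"
    unfolding \<pi>_def distr_distr[OF measurable_snd T] by (simp add: T_def o_def case_prod_beta)
  have z_meas: "(\<lambda>w. z (fst w)) \<in> borel_measurable P"
    using measurable_compose[OF T measurable_fst] by (simp add: T_def case_prod_beta)
  have snd_meas: "snd \<in> borel_measurable P"
    using measurable_compose[OF T measurable_snd] by (simp add: T_def case_prod_beta)
  have coupling: "\<pi> \<in> couplings (empirical_distribution n z) F"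
    unfolding couplings_def mem_Collect_eq
  proof (intro conjI)
    show "prob_space \<pi>"
      unfolding \<pi>_def by (rule prob_space.prob_space_distr[OF prob_P T])
    show "sets \<pi> = sets (borel \<Otimes>\<^sub>M borel)" by (simp add: \<pi>_def)
    show "distr \<pi> borel fst = empirical_distribution n z"
    proof (rule measure_eqI)
      fix B assume "B \<in> sets (distr \<pi> borel fst)"
      then have B[measurable]: "B \<in> sets borel" by simp
      have "emeasure (distr \<pi> borel fst) B = (\<integral>\<^sup>+w. indicator B w \<partial>distr \<pi> borel fst)"
        by (simp add: nn_integral_indicator)
      also have "\<dots> = (\<integral>\<^sup>+w. indicator B (z (fst w)) \<partial>P)"
        unfolding fst_eq using z_meas by (subst nn_integral_distr) auto
      also have "\<dots> = (\<integral>\<^sup>+j. indicator B (z j) \<partial>U)"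
        unfolding P_fst[of "\<lambda>j. indicator B (z j)"] U_int ..
      also have "\<dots> = (\<integral>\<^sup>+w. indicator B w \<partial>distr U borel z)"
        by (subst nn_integral_distr) (auto simp: measurable_cong_sets[OF setsU refl])
      also have "\<dots> = emeasure (distr U borel z) B"
        by (simp add: nn_integral_indicator)
      finally show "emeasure (distr \<pi> borel fst) B = emeasure (empirical_distribution n z) B"
        by (simp add: empirical_distribution_def U_def I_def)
    qed (simp add: empirical_distribution_def)
    show "distr \<pi> borel snd = F"
    proof (rule measure_eqI)
      fix B assume "B \<in> sets (distr \<pi> borel snd)"
      then have B[measurable]: "B \<in> sets borel" "B \<in> sets F" by (simp_all add: F(2))
      have "emeasure (distr \<pi> borel snd) B = (\<integral>\<^sup>+w. indicator B w \<partial>distr \<pi> borel snd)"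
        by (simp add: nn_integral_indicator)
      also have "\<dots> = (\<integral>\<^sup>+w. indicator B (snd w) \<partial>P)"
        unfolding snd_eq using snd_meas by (subst nn_integral_distr) auto
      also have "\<dots> = emeasure F B"
        by (subst P_snd) (auto simp: nn_integral_indicator)
      finally show "emeasure (distr \<pi> borel snd) B = emeasure F B" .
    qed (simp add: F(2))
  qed
  have meas_qy: "(\<lambda>y. norm (q y - y)) \<in> borel_measurable F"
    using F(2) borel_measurable_simple_function[OF q] by (auto cong: measurable_cong_sets)
  have meas_U: "f \<in> borel_measurable U" for f :: "nat \<Rightarrow> real"
    by (simp add: measurable_cong_sets[OF setsU refl])
  have meas1: "(\<lambda>w. (norm (z (fst w) - q (e (fst w))))\<^sup>2) \<in> borel_measurable P"
    unfolding measurable_cong_sets[OF setsP refl]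
    by (rule measurable_compose[OF measurable_fst meas_U])
  have meas2: "(\<lambda>w. (norm (q (e (fst w)) - q (snd w)))\<^sup>2) \<in> borel_measurable P"
    unfolding measurable_cong_sets[OF setsP refl]
    unfolding measurable_cong_sets[OF sets_pair_measure_cong[OF setsU refl] refl]
    by (rule measurable_pair_measure_countable1) (auto simp: I countable_finite intro!: meas_q)
  have meas3: "(\<lambda>w. norm (q (snd w) - snd w)) \<in> borel_measurable P"
    unfolding measurable_cong_sets[OF setsP refl]
    by (rule measurable_compose[OF measurable_snd meas_qy])
  have "(\<integral>\<^sup>+ w. ennreal ((norm (fst w - snd w))\<^sup>2) \<partial>\<pi>) \<le>
    ennreal (3 * ((1 / real n) * (\<Sum>j=1..n. (norm (z j - q (e j)))\<^sup>2))
      + 12 * K\<^sup>2 * (\<Sum>a\<in>range q. \<bar>cell_freq n e q a - measure F (q -` {a})\<bar>) + 3 * D)" (is "_ \<le> ennreal ?B")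
  proof -
    have "(\<integral>\<^sup>+ w. ennreal ((norm (fst w - snd w))\<^sup>2) \<partial>\<pi>) = (\<integral>\<^sup>+ w. ennreal ((norm (z (fst w) - snd w))\<^sup>2) \<partial>P)"
      unfolding \<pi>_def by (subst nn_integral_distr[OF T]) (measurable, simp add: T_def case_prod_beta)
    also have "\<dots> \<le> (\<integral>\<^sup>+ w. (ennreal (3 * (norm (z (fst w) - q (e (fst w))))\<^sup>2)
        + ennreal (3 * (norm (q (e (fst w)) - q (snd w)))\<^sup>2)) + ennreal (3 * (norm (q (snd w) - snd w))\<^sup>2) \<partial>P)"
    proof (intro nn_integral_mono)
      fix w
      show "ennreal ((norm (z (fst w) - snd w))\<^sup>2) \<le> (ennreal (3 * (norm (z (fst w) - q (e (fst w))))\<^sup>2)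
        + ennreal (3 * (norm (q (e (fst w)) - q (snd w)))\<^sup>2)) + ennreal (3 * (norm (q (snd w) - snd w))\<^sup>2)"
        using norm_add3_sq_le[of "z (fst w) - q (e (fst w))" "q (e (fst w)) - q (snd w)" "q (snd w) - snd w"]
        by (simp add: ennreal_plus[symmetric] ennreal_leI del: ennreal_plus)
    qed
    also have "\<dots> = (\<integral>\<^sup>+ w. ennreal (3 * (norm (z (fst w) - q (e (fst w))))\<^sup>2) \<partial>P)
        + (\<integral>\<^sup>+ w. ennreal (3 * (norm (q (e (fst w)) - q (snd w)))\<^sup>2) \<partial>P)
        + (\<integral>\<^sup>+ w. ennreal (3 * (norm (q (snd w) - snd w))\<^sup>2) \<partial>P)"
      using meas1 meas2 meas3 by (subst nn_integral_add, measurable)+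
    also have "(\<integral>\<^sup>+ w. ennreal (3 * (norm (z (fst w) - q (e (fst w))))\<^sup>2) \<partial>P) =
        ennreal (3 * ((1 / real n) * (\<Sum>j=1..n. (norm (z j - q (e j)))\<^sup>2)))"
      unfolding P_fst[of "\<lambda>j. ennreal (3 * (norm (z j - q (e j)))\<^sup>2)"]
      by (subst sum_ennreal) (auto simp: I_def sum_distrib_left simp flip: ennreal_mult')
    also have "(\<integral>\<^sup>+ w. ennreal (3 * (norm (q (snd w) - snd w))\<^sup>2) \<partial>P) = (\<integral>\<^sup>+ y. ennreal (3 * (norm (q y - y))\<^sup>2) \<partial>F)"
      by (rule P_snd[of "\<lambda>y. ennreal (3 * (norm (q y - y))\<^sup>2)"]) (use meas_qy in measurable)
    also have "\<dots> = 3 * (\<integral>\<^sup>+ y. ennreal ((norm (q y - y))\<^sup>2) \<partial>F)"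
      using meas_qy by (simp add: ennreal_mult' nn_integral_cmult)
    also have "\<dots> \<le> 3 * ennreal D"
      by (intro mult_left_mono D(2)) auto
    also have "(\<integral>\<^sup>+ w. ennreal (3 * (norm (q (e (fst w)) - q (snd w)))\<^sup>2) \<partial>P) =
        3 * (\<integral>\<^sup>+ w. ennreal ((norm (q (e (fst w)) - q (snd w)))\<^sup>2) \<partial>P)"
      using meas2 by (simp add: ennreal_mult' nn_integral_cmult)
    also have "\<dots> \<le> 3 * ennreal (4 * K\<^sup>2 * (\<Sum>a\<in>R. \<bar>p a - r a\<bar>))"
      by (intro mult_left_mono P_q) auto
    finally have "(\<integral>\<^sup>+ w. ennreal ((norm (fst w - snd w))\<^sup>2) \<partial>\<pi>) \<le>
       ennreal (3 * ((1 / real n) * (\<Sum>j=1..n. (norm (z j - q (e j)))\<^sup>2)))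
       + 3 * ennreal (4 * K\<^sup>2 * (\<Sum>a\<in>R. \<bar>p a - r a\<bar>)) + 3 * ennreal D"
      by (simp add: add_mono)
    also have "\<dots> = ennreal ?B"
    proof -
      have three: "3 * ennreal x = ennreal (3 * x)" for x
        by (simp add: ennreal_mult')
      have "0 \<le> 3 * ((1 / real n) * (\<Sum>j=1..n. (norm (z j - q (e j)))\<^sup>2))" "0 \<le> 3 * (4 * K\<^sup>2 * (\<Sum>a\<in>R. \<bar>p a - r a\<bar>))"
        by (auto intro!: sum_nonneg mult_nonneg_nonneg divide_nonneg_nonneg)
      then show ?thesis
        unfolding three using D(1) by (simp add: R_def p_def r_def mult.assoc flip: ennreal_plus)
    qed
    finally show ?thesis .
  qed
  moreover have "0 \<le> ?B"
    using D(1) by (auto intro!: sum_nonneg mult_nonneg_nonneg divide_nonneg_nonneg add_nonneg_nonneg)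
  ultimately show ?thesis
    by (intro mallows_dist_sq_le[OF coupling])
qed

section \<open>Independence and second moments\<close>

lemma norm_funpow_le:
  fixes \<Psi> :: "'a::real_normed_vector \<Rightarrow> 'a"
  assumes "bounded_linear \<Psi>"
  shows "norm ((\<Psi> ^^ m) x) \<le> onorm \<Psi> ^ m * norm x"
proof (induction m)
  case (Suc m)
  have "norm (\<Psi> ((\<Psi> ^^ m) x)) \<le> onorm \<Psi> * norm ((\<Psi> ^^ m) x)"
    by (rule onorm[OF assms])
  also have "\<dots> \<le> onorm \<Psi> * (onorm \<Psi> ^ m * norm x)"
    by (intro mult_left_mono Suc onorm_pos_le[OF assms])
  finally show ?case by (simp add: mult.assoc)
qed simp

lemma bounded_linear_funpow:
  fixes \<Psi> :: "'a::real_normed_vector \<Rightarrow> 'a"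
  assumes "bounded_linear \<Psi>"
  shows "bounded_linear (\<Psi> ^^ m)"
proof (induction m)
  case 0
  show ?case by (simp add: id_def bounded_linear_ident)
next
  case (Suc m)
  show ?case
    using bounded_linear_compose[OF assms Suc] by (simp add: o_def)
qed

context prob_space
begin

text \<open>The joint law is a product, so Fubini's theorem integrates one argument of the inner product at a
time.\<close>

lemma indep_inner_expectation:
  fixes V Z :: "'a \<Rightarrow> 'b::{real_inner, banach, second_countable_topology}"
  assumes indep: "indep_var borel V borel Z" and V: "integrable M V" and Z: "integrable M Z"
  shows "integrable M (\<lambda>\<omega>. inner (V \<omega>) (Z \<omega>))"
    and "(\<integral>\<omega>. inner (V \<omega>) (Z \<omega>) \<partial>M) = inner (\<integral>\<omega>. V \<omega> \<partial>M) (\<integral>\<omega>. Z \<omega> \<partial>M)"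
proof -
  have [measurable]: "V \<in> borel_measurable M" "Z \<in> borel_measurable M"
    using V Z by auto
  have "indep_var borel (norm \<circ> V) borel (norm \<circ> Z)"
    by (intro indep_var_compose[OF indep]) auto
  then have "integrable M (\<lambda>\<omega>. norm (V \<omega>) * norm (Z \<omega>))"
    using V Z by (intro indep_var_integrable) (auto simp: o_def)
  then show int: "integrable M (\<lambda>\<omega>. inner (V \<omega>) (Z \<omega>))"
    by (rule Bochner_Integration.integrable_bound) (auto intro!: AE_I2 Cauchy_Schwarz_ineq2)
  let ?V = "distr M borel V" and ?Z = "distr M borel Z"
  interpret DV: prob_space ?V by (rule prob_space_distr) simp
  interpret DZ: prob_space ?Z by (rule prob_space_distr) simp
  interpret P: pair_sigma_finite ?V ?Z ..
  have joint: "?V \<Otimes>\<^sub>M ?Z = distr M (borel \<Otimes>\<^sub>M borel) (\<lambda>\<omega>. (V \<omega>, Z \<omega>))"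
    using indep[unfolded indep_var_distribution_eq] by (elim conjE)
  have int2: "integrable (?V \<Otimes>\<^sub>M ?Z) (\<lambda>(x, y). inner x y)"
    unfolding joint using int by (subst integrable_distr_eq) auto
  have "(\<integral>\<omega>. inner (V \<omega>) (Z \<omega>) \<partial>M) = (\<integral>p. (\<lambda>(x, y). inner x y) p \<partial>(?V \<Otimes>\<^sub>M ?Z))"
    unfolding joint by (subst integral_distr) auto
  also have "\<dots> = (\<integral>x. \<integral>y. inner x y \<partial>?Z \<partial>?V)"
    using P.integral_fst'[OF int2] by simp
  also have "\<dots> = (\<integral>x. inner x (\<integral>\<omega>. Z \<omega> \<partial>M) \<partial>?V)"
  proof -
    have "integrable ?Z (\<lambda>y. y)" using Z by (simp add: integrable_distr_eq)
    moreover have "(\<integral>y. y \<partial>?Z) = (\<integral>\<omega>. Z \<omega> \<partial>M)"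
      by (subst integral_distr) auto
    ultimately have "(\<integral>y. inner x y \<partial>?Z) = inner x (\<integral>\<omega>. Z \<omega> \<partial>M)" for x
      by simp
    then show ?thesis by simp
  qed
  also have "\<dots> = (\<integral>\<omega>. inner (V \<omega>) (\<integral>\<omega>. Z \<omega> \<partial>M) \<partial>M)"
    by (subst integral_distr) auto
  also have "\<dots> = inner (\<integral>\<omega>. V \<omega> \<partial>M) (\<integral>\<omega>. Z \<omega> \<partial>M)"
    using V by simp
  finally show "(\<integral>\<omega>. inner (V \<omega>) (Z \<omega>) \<partial>M) = inner (\<integral>\<omega>. V \<omega> \<partial>M) (\<integral>\<omega>. Z \<omega> \<partial>M)" .
qed

lemma integrable_inner_of_squares:
  fixes V Z :: "'a \<Rightarrow> 'b::{real_inner, banach, second_countable_topology}"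
  assumes [measurable]: "V \<in> borel_measurable M" "Z \<in> borel_measurable M"
    and "integrable M (\<lambda>\<omega>. (norm (V \<omega>))\<^sup>2)" "integrable M (\<lambda>\<omega>. (norm (Z \<omega>))\<^sup>2)"
  shows "integrable M (\<lambda>\<omega>. norm (V \<omega>) * norm (Z \<omega>))" "integrable M (\<lambda>\<omega>. inner (V \<omega>) (Z \<omega>))"
proof -
  have bound: "norm (V \<omega>) * norm (Z \<omega>) \<le> (norm (V \<omega>))\<^sup>2 + (norm (Z \<omega>))\<^sup>2" for \<omega>
  proof -
    have "0 \<le> (norm (V \<omega>) - norm (Z \<omega>))\<^sup>2 + ((norm (V \<omega>))\<^sup>2 + (norm (Z \<omega>))\<^sup>2)" by simp
    then show ?thesis by (simp add: power2_diff)
  qed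
  show int: "integrable M (\<lambda>\<omega>. norm (V \<omega>) * norm (Z \<omega>))"
    by (rule Bochner_Integration.integrable_bound[OF Bochner_Integration.integrable_add[OF assms(3,4)]])
       (use bound in \<open>auto intro!: AE_I2\<close>)
  show "integrable M (\<lambda>\<omega>. inner (V \<omega>) (Z \<omega>))"
    by (rule Bochner_Integration.integrable_bound[OF int]) (auto intro!: AE_I2 Cauchy_Schwarz_ineq2)
qed

lemma integrable_of_square:
  fixes V :: "'a \<Rightarrow> 'b::{real_inner, banach, second_countable_topology}"
  assumes [measurable]: "V \<in> borel_measurable M" and V: "integrable M (\<lambda>\<omega>. (norm (V \<omega>))\<^sup>2)"
  shows "integrable M V"
proof -
  have "integrable M (\<lambda>\<omega>. 1 + (norm (V \<omega>))\<^sup>2)" using V by simp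
  then show ?thesis
  proof (rule Bochner_Integration.integrable_bound)
    have "norm x \<le> 1 + (norm x)\<^sup>2" for x :: 'b
    proof -
      have "0 \<le> (norm x - 1)\<^sup>2 + (norm x)\<^sup>2 + 1" by simp
      then show ?thesis by (simp add: power2_diff)
    qed
    then show "AE x in M. norm (V x) \<le> norm (1 + (norm (V x))\<^sup>2)"
      by (intro AE_I2) (simp add: abs_of_nonneg)
  qed simp
qed

text \<open>Orthogonality in mean: only the diagonal of a random Gram matrix contributes to the expectation of
its sum.\<close>

lemma expectation_gram_sum:
  fixes G :: "'i \<Rightarrow> 'i \<Rightarrow> 'a \<Rightarrow> real"
  assumes I: "finite I" and int: "\<And>i j. i \<in> I \<Longrightarrow> j \<in> I \<Longrightarrow> integrable M (G i j)"
    and off: "\<And>i j. i \<in> I \<Longrightarrow> j \<in> I \<Longrightarrow> i \<noteq> j \<Longrightarrow> (\<integral>\<omega>. G i j \<omega> \<partial>M) = 0"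
    and diag: "\<And>i. i \<in> I \<Longrightarrow> (\<integral>\<omega>. G i i \<omega> \<partial>M) = s"
  shows "(\<integral>\<omega>. (\<Sum>i\<in>I. \<Sum>j\<in>I. G i j \<omega>) \<partial>M) = real (card I) * s"
proof -
  have "(\<integral>\<omega>. (\<Sum>i\<in>I. \<Sum>j\<in>I. G i j \<omega>) \<partial>M) = (\<Sum>i\<in>I. \<Sum>j\<in>I. \<integral>\<omega>. G i j \<omega> \<partial>M)"
    using int by (simp add: Bochner_Integration.integral_sum)
  also have "\<dots> = (\<Sum>i\<in>I. \<Sum>j\<in>I. if i = j then s else 0)"
    using off diag by (intro sum.cong refl) auto
  finally show ?thesis using I by simp
qed

end

section \<open>Causal representation of the stationary process\<close>

text \<open>The probabilistic hypotheses that concern the process itself; those on eigenvalues and on the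
truncation level are added where they are used.\<close>

locale far1_process = prob_space M for M :: "'w measure" +
  fixes X \<epsilon> :: "int \<Rightarrow> 'w \<Rightarrow> 'a::{real_inner, banach, second_countable_topology}"
    and \<Psi> :: "'a \<Rightarrow> 'a"
  assumes stationary: "strictly_stationary M X"
    and far1: "\<And>t. AE \<omega> in M. X (t + 1) \<omega> = \<Psi> (X t \<omega>) + \<epsilon> (t + 1) \<omega>"
    and X_integrable: "\<And>t. integrable M (X t)"
    and eps_iid: "iid M \<epsilon>"
    and eps_mean: "\<And>t. integrable M (\<epsilon> t)" "\<And>t. (\<integral>\<omega>. \<epsilon> t \<omega> \<partial>M) = 0"
    and eps_moment: "\<And>t. integrable M (\<lambda>\<omega>. norm (\<epsilon> t \<omega>) ^ 4)"
    and Psi: "bounded_linear \<Psi>" "onorm \<Psi> < 1"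
begin

lemma X_measurable[measurable]: "X t \<in> borel_measurable M"
  and eps_measurable[measurable]: "\<epsilon> t \<in> borel_measurable M"
  using X_integrable eps_mean(1) by auto

lemma distr_X: "distr M borel (X t) = distr M borel (X 0)"
proof -
  let ?P = "Pi\<^sub>M UNIV (\<lambda>_::int. borel :: 'a measure)"
  have [measurable]: "(\<lambda>\<omega> s. X (s + h) \<omega>) \<in> measurable M ?P" for h
    by (rule measurable_PiM_single') auto
  have "distr (distr M ?P (\<lambda>\<omega> s. X (s + t) \<omega>)) borel (\<lambda>p. p 0) = distr (distr M ?P (\<lambda>\<omega> s. X s \<omega>)) borel (\<lambda>p. p 0)"
    using stationary unfolding strictly_stationary_def by simp
  moreover have proj: "distr (distr M ?P (\<lambda>\<omega> s. X (s + h) \<omega>)) borel (\<lambda>p. p 0) = distr M borel (X h)" for h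
    by (subst distr_distr) (auto simp: o_def)
  ultimately show ?thesis
    using proj[of t] proj[of 0] by simp
qed

lemma distr_eps: "distr M borel (\<epsilon> t) = distr M borel (\<epsilon> 0)"
  using eps_iid unfolding iid_def by blast

lemma indep_eps: "indep_vars (\<lambda>_. borel) \<epsilon> UNIV"
  using eps_iid unfolding iid_def by blast

lemma transfer_distr:
  fixes Y :: "'w \<Rightarrow> 'a" and f :: "'a \<Rightarrow> 'b::{banach, second_countable_topology}"
  assumes eq: "distr M borel Y = distr M borel Z" and f: "f \<in> borel_measurable borel"
    and "Y \<in> borel_measurable M" "Z \<in> borel_measurable M"
  shows "integrable M (\<lambda>\<omega>. f (Y \<omega>)) = integrable M (\<lambda>\<omega>. f (Z \<omega>))"
    and "(\<integral>\<omega>. f (Y \<omega>) \<partial>M) = (\<integral>\<omega>. f (Z \<omega>) \<partial>M)"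
  using integrable_distr_eq[OF assms(3) f] integrable_distr_eq[OF assms(4) f]
    integral_distr[OF assms(3) f] integral_distr[OF assms(4) f] eq by simp_all

lemmas transfer_X = transfer_distr[OF distr_X _ X_measurable X_measurable]
lemmas transfer_eps = transfer_distr[OF distr_eps _ eps_measurable eps_measurable]

lemma eps_square_integrable: "integrable M (\<lambda>\<omega>. (norm (\<epsilon> t \<omega>))\<^sup>2)"
  using integrable_of_square[of "\<lambda>\<omega>. (norm (\<epsilon> t \<omega>))\<^sup>2"] eps_moment[of t] by simp

definition "eps_var = (\<integral>\<omega>. (norm (\<epsilon> 0 \<omega>))\<^sup>2 \<partial>M)"
definition "X_var = (\<integral>\<omega>. (norm (X 0 \<omega>))\<^sup>2 \<partial>M)"

lemma eps_var: "(\<integral>\<omega>. (norm (\<epsilon> t \<omega>))\<^sup>2 \<partial>M) = eps_var"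
  unfolding eps_var_def by (rule transfer_eps) simp

lemma X_var: "(\<integral>\<omega>. (norm (X t \<omega>))\<^sup>2 \<partial>M) = X_var"
  unfolding X_var_def by (rule transfer_X) simp

lemma eps_var_nonneg: "0 \<le> eps_var" and X_var_nonneg: "0 \<le> X_var"
  by (simp_all add: eps_var_def X_var_def)

definition ma_sum :: "nat \<Rightarrow> int \<Rightarrow> (int \<Rightarrow> 'a) \<Rightarrow> 'a" where
  "ma_sum m t e = (\<Sum>i<m. (\<Psi> ^^ i) (e (t - int i)))"

lemma far1_AE: "AE \<omega> in M. \<forall>t. X (t + 1) \<omega> = \<Psi> (X t \<omega>) + \<epsilon> (t + 1) \<omega>"
  using far1 by (simp add: AE_all_countable)

lemma X_expand:
  assumes "\<forall>t. X (t + 1) \<omega> = \<Psi> (X t \<omega>) + \<epsilon> (t + 1) \<omega>"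
  shows "X t \<omega> = (\<Psi> ^^ m) (X (t - int m) \<omega>) + ma_sum m t (\<lambda>s. \<epsilon> s \<omega>)"
proof (induction m)
  case (Suc m)
  interpret P: bounded_linear "\<Psi> ^^ m" by (rule bounded_linear_funpow[OF Psi(1)])
  have "X (t - int m) \<omega> = \<Psi> (X (t - int (Suc m)) \<omega>) + \<epsilon> (t - int m) \<omega>"
    using assms[rule_format, of "t - int (Suc m)"] by (simp add: algebra_simps)
  then show ?case
    using Suc by (simp add: P.add ma_sum_def funpow_swap1)
qed (simp add: ma_sum_def)

lemma onorm_Psi_nonneg: "0 \<le> onorm \<Psi>"
  by (rule onorm_pos_le[OF Psi(1)])

lemma ma_sum_measurable[measurable]: "(\<lambda>\<omega>. ma_sum m t (\<lambda>s. \<epsilon> s \<omega>)) \<in> borel_measurable M"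
  unfolding ma_sum_def
  by (intro borel_measurable_sum measurable_compose[OF eps_measurable]
      borel_measurable_continuous_onI linear_continuous_on bounded_linear_funpow Psi)

text \<open>Iterating the equation \<open>m\<close> times leaves the remainder \<open>\<Psi>\<^sup>m X\<^sub>t\<^sub>-\<^sub>m\<close>. By stationarity its mean norm decays
geometrically, so the remainders are summable almost surely.\<close>

lemma ma_sum_tendsto: "AE \<omega> in M. (\<lambda>m. ma_sum m t (\<lambda>s. \<epsilon> s \<omega>)) \<longlonglongrightarrow> X t \<omega>"
proof -
  let ?r = "onorm \<Psi>"
  define c where "c = (\<integral>\<omega>. norm (X 0 \<omega>) \<partial>M)"
  have c: "(\<integral>\<^sup>+\<omega>. ennreal (norm (X s \<omega>)) \<partial>M) = ennreal c" for s
    using X_integrable[of s] transfer_X(2)[of norm s] unfolding c_def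
    by (subst nn_integral_eq_integral) auto
  have "(\<integral>\<^sup>+\<omega>. (\<Sum>m. ennreal (?r ^ m * norm (X (t - int m) \<omega>))) \<partial>M) = (\<Sum>m. ennreal (?r ^ m * c))"
    using onorm_Psi_nonneg by (simp add: nn_integral_suminf ennreal_mult' nn_integral_cmult c)
  also have "\<dots> = ennreal (\<Sum>m. ?r ^ m * c)"
    using onorm_Psi_nonneg Psi(2)
    by (intro suminf_ennreal2 summable_mult2 summable_geometric) (auto simp: c_def)
  also have "\<dots> < \<infinity>" by simp
  finally have "AE \<omega> in M. (\<Sum>m. ennreal (?r ^ m * norm (X (t - int m) \<omega>))) \<noteq> \<infinity>"
    by (intro nn_integral_noteq_infinite) auto
  with far1_AE show ?thesis
  proof eventually_elim
    case (elim \<omega>)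
    have "summable (\<lambda>m. ?r ^ m * norm (X (t - int m) \<omega>))"
      using elim(2) onorm_Psi_nonneg by (intro summable_suminf_not_top) auto
    then have lim: "(\<lambda>m. ?r ^ m * norm (X (t - int m) \<omega>)) \<longlonglongrightarrow> 0"
      by (rule summable_LIMSEQ_zero)
    have "(\<lambda>m. ma_sum m t (\<lambda>s. \<epsilon> s \<omega>) - X t \<omega>) \<longlonglongrightarrow> 0"
    proof (rule Lim_null_comparison[OF _ lim], intro always_eventually allI)
      fix m
      have "ma_sum m t (\<lambda>s. \<epsilon> s \<omega>) - X t \<omega> = - (\<Psi> ^^ m) (X (t - int m) \<omega>)"
        using X_expand[OF elim(1), of t m] by simp
      then show "norm (ma_sum m t (\<lambda>s. \<epsilon> s \<omega>) - X t \<omega>) \<le> ?r ^ m * norm (X (t - int m) \<omega>)"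
        using norm_funpow_le[OF Psi(1)] by simp
    qed
    then show ?case by (rule LIM_zero_cancel)
  qed
qed

text \<open>Cauchy--Schwarz with the geometric weights split as \<open>\<surd>r\<^sup>i \<cdot> \<surd>r\<^sup>i\<close>.\<close>

lemma ma_sum_sq_le:
  "(norm (ma_sum m t e))\<^sup>2 \<le> (1 / (1 - onorm \<Psi>)) * (\<Sum>i<m. onorm \<Psi> ^ i * (norm (e (t - int i)))\<^sup>2)"
proof -
  let ?r = "onorm \<Psi>"
  have r: "0 \<le> ?r" "?r < 1" using onorm_Psi_nonneg Psi(2) by auto
  have "norm (ma_sum m t e) \<le> (\<Sum>i<m. ?r ^ i * norm (e (t - int i)))"
    unfolding ma_sum_def by (rule sum_norm_le) (rule norm_funpow_le[OF Psi(1)])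
  also have "\<dots> = (\<Sum>i<m. sqrt (?r ^ i) * (sqrt (?r ^ i) * norm (e (t - int i))))"
    using r by (simp add: mult.assoc[symmetric])
  finally have "(norm (ma_sum m t e))\<^sup>2 \<le> (\<Sum>i<m. sqrt (?r ^ i) * (sqrt (?r ^ i) * norm (e (t - int i))))\<^sup>2"
    by (intro power_mono) auto
  also have "\<dots> \<le> (\<Sum>i<m. (sqrt (?r ^ i))\<^sup>2) * (\<Sum>i<m. (sqrt (?r ^ i) * norm (e (t - int i)))\<^sup>2)"
    by (rule Cauchy_Schwarz_ineq_sum)
  also have "\<dots> = (\<Sum>i<m. ?r ^ i) * (\<Sum>i<m. ?r ^ i * (norm (e (t - int i)))\<^sup>2)"
    using r by (simp add: power_mult_distrib)
  also have "\<dots> \<le> (1 / (1 - ?r)) * (\<Sum>i<m. ?r ^ i * (norm (e (t - int i)))\<^sup>2)"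
  proof (rule mult_right_mono)
    show "(\<Sum>i<m. ?r ^ i) \<le> 1 / (1 - ?r)"
      using r sum_le_suminf[of "\<lambda>i. ?r ^ i" "{..<m}"] suminf_geometric[of ?r] summable_geometric[of ?r] by simp
  qed (use r in \<open>auto intro!: sum_nonneg\<close>)
  finally show ?thesis .
qed

text \<open>The truncated sums are bounded in mean square, and Fatou's lemma passes this on to their limit.\<close>

lemma X_square_integrable: "integrable M (\<lambda>\<omega>. (norm (X t \<omega>))\<^sup>2)"
proof -
  let ?r = "onorm \<Psi>"
  have r: "0 \<le> ?r" "?r < 1" using onorm_Psi_nonneg Psi(2) by auto
  define B where "B = (1 / (1 - ?r)) * ((1 / (1 - ?r)) * eps_var)"
  have bound: "(\<integral>\<^sup>+\<omega>. ennreal ((norm (ma_sum m t (\<lambda>s. \<epsilon> s \<omega>)))\<^sup>2) \<partial>M) \<le> ennreal B" for m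
  proof -
    have "(\<integral>\<^sup>+\<omega>. ennreal ((norm (ma_sum m t (\<lambda>s. \<epsilon> s \<omega>)))\<^sup>2) \<partial>M) \<le>
        (\<integral>\<^sup>+\<omega>. ennreal ((1 / (1 - ?r)) * (\<Sum>i<m. ?r ^ i * (norm (\<epsilon> (t - int i) \<omega>))\<^sup>2)) \<partial>M)"
      by (intro nn_integral_mono ennreal_leI ma_sum_sq_le)
    also have "\<dots> = ennreal (\<integral>\<omega>. (1 / (1 - ?r)) * (\<Sum>i<m. ?r ^ i * (norm (\<epsilon> (t - int i) \<omega>))\<^sup>2) \<partial>M)"
      using r eps_square_integrable
      by (intro nn_integral_eq_integral) (auto intro!: AE_I2 mult_nonneg_nonneg divide_nonneg_nonneg sum_nonneg)
    also have "(\<integral>\<omega>. (1 / (1 - ?r)) * (\<Sum>i<m. ?r ^ i * (norm (\<epsilon> (t - int i) \<omega>))\<^sup>2) \<partial>M) = (1 / (1 - ?r)) * ((\<Sum>i<m. ?r ^ i) * eps_var)"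
      using eps_square_integrable by (simp add: eps_var sum_distrib_right)
    also have "\<dots> \<le> B"
      unfolding B_def
      using r sum_le_suminf[of "\<lambda>i. ?r ^ i" "{..<m}"] suminf_geometric[of ?r] summable_geometric[of ?r] eps_var_nonneg
      by (intro mult_left_mono mult_right_mono) auto
    finally show ?thesis by (simp add: ennreal_leI)
  qed
  have "(\<integral>\<^sup>+\<omega>. ennreal ((norm (X t \<omega>))\<^sup>2) \<partial>M) =
      (\<integral>\<^sup>+\<omega>. liminf (\<lambda>m. ennreal ((norm (ma_sum m t (\<lambda>s. \<epsilon> s \<omega>)))\<^sup>2)) \<partial>M)"
  proof (rule nn_integral_cong_AE)
    show "AE \<omega> in M. ennreal ((norm (X t \<omega>))\<^sup>2) = liminf (\<lambda>m. ennreal ((norm (ma_sum m t (\<lambda>s. \<epsilon> s \<omega>)))\<^sup>2))"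
      using ma_sum_tendsto[of t]
    proof eventually_elim
      case (elim \<omega>)
      then have "(\<lambda>m. ennreal ((norm (ma_sum m t (\<lambda>s. \<epsilon> s \<omega>)))\<^sup>2)) \<longlonglongrightarrow> ennreal ((norm (X t \<omega>))\<^sup>2)"
        by (intro tendsto_ennrealI tendsto_intros)
      then show ?case
        by (rule lim_imp_Liminf[OF trivial_limit_sequentially, symmetric])
    qed
  qed
  also have "\<dots> \<le> liminf (\<lambda>m. \<integral>\<^sup>+\<omega>. ennreal ((norm (ma_sum m t (\<lambda>s. \<epsilon> s \<omega>)))\<^sup>2) \<partial>M)"
    by (rule nn_integral_liminf) auto
  also have "\<dots> \<le> liminf (\<lambda>m. ennreal B)"
    by (intro Liminf_mono always_eventually allI bound)
  also have "\<dots> < \<infinity>" by (simp add: Liminf_const)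
  finally show ?thesis
    by (intro integrableI_bounded) auto
qed

text \<open>A version of the process that is a function of past innovations at every sample point and not just
almost surely, so that independence can be applied to it.\<close>

definition X_causal :: "int \<Rightarrow> 'w \<Rightarrow> 'a" where
  "X_causal t \<omega> = lim (\<lambda>m. ma_sum m t (\<lambda>s. \<epsilon> s \<omega>))"

lemma X_eq_causal: "AE \<omega> in M. X t \<omega> = X_causal t \<omega>"
  using ma_sum_tendsto[of t] by eventually_elim (simp add: X_causal_def limI)

lemma X_causal_measurable[measurable]: "X_causal t \<in> borel_measurable M"
  unfolding X_causal_def by measurable

definition past :: "int \<Rightarrow> 'w \<Rightarrow> int \<Rightarrow> 'a" where
  "past j \<omega> = (\<lambda>s\<in>{..j}. \<epsilon> s \<omega>)"

lemma X_causal_past: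
  assumes "t \<le> j"
  shows "X_causal t \<omega> = lim (\<lambda>m. ma_sum m t (past j \<omega>))"
  using assms unfolding X_causal_def ma_sum_def past_def by simp

lemma causal_measurable_past:
  assumes "t \<le> j"
  shows "(\<lambda>p. lim (\<lambda>m. ma_sum m t p)) \<in> borel_measurable (PiM {..j} (\<lambda>_. borel))"
proof -
  have "(\<lambda>p. (\<Psi> ^^ i) (p (t - int i))) \<in> borel_measurable (PiM {..j} (\<lambda>_. borel))" for i
    using assms
    by (intro measurable_compose[OF measurable_component_singleton]
      borel_measurable_continuous_onI linear_continuous_on bounded_linear_funpow Psi) auto
  then show ?thesis
    unfolding ma_sum_def by (intro borel_measurable_lim_metric borel_measurable_sum)
qed

lemma indep_past:
  assumes "H \<in> measurable (PiM {..j} (\<lambda>_. borel)) N"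
  shows "indep_var N (\<lambda>\<omega>. H (past j \<omega>)) borel (\<epsilon> (j + 1))"
proof -
  have "indep_var N (H \<circ> (\<lambda>\<omega>. restrict (\<lambda>i. \<epsilon> i \<omega>) {..j})) borel ((\<lambda>p. p (j + 1)) \<circ> (\<lambda>\<omega>. restrict (\<lambda>i. \<epsilon> i \<omega>) {j + 1}))"
    by (rule indep_var_compose[OF indep_var_restrict[OF indep_eps]]) (auto intro: assms)
  then show ?thesis
    by (simp add: o_def past_def)
qed

lemma indep_X_eps: "indep_var borel (X_causal j) borel (\<epsilon> (j + 1))"
  using indep_past[OF causal_measurable_past[of j j]] by (simp flip: X_causal_past)

end

section \<open>Variances of sample averages\<close>

context far1_process
begin

lemma E_X_eps_sq:
  "integrable M (\<lambda>\<omega>. (norm (X j \<omega>))\<^sup>2 * (norm (\<epsilon> (j + 1) \<omega>))\<^sup>2)"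
  "(\<integral>\<omega>. (norm (X j \<omega>))\<^sup>2 * (norm (\<epsilon> (j + 1) \<omega>))\<^sup>2 \<partial>M) = X_var * eps_var"
proof -
  have ae: "AE \<omega> in M. (norm (X j \<omega>))\<^sup>2 = (norm (X_causal j \<omega>))\<^sup>2"
    using X_eq_causal[of j] by eventually_elim simp
  have ae2: "AE \<omega> in M. (norm (X j \<omega>))\<^sup>2 * (norm (\<epsilon> (j + 1) \<omega>))\<^sup>2 = (norm (X_causal j \<omega>))\<^sup>2 * (norm (\<epsilon> (j + 1) \<omega>))\<^sup>2"
    using ae by eventually_elim simp
  have indep: "indep_var borel (\<lambda>\<omega>. (norm (X_causal j \<omega>))\<^sup>2) borel (\<lambda>\<omega>. (norm (\<epsilon> (j + 1) \<omega>))\<^sup>2)"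
    using indep_var_compose[OF indep_X_eps[of j], of "\<lambda>x. (norm x)\<^sup>2" borel "\<lambda>x. (norm x)\<^sup>2" borel] by (simp add: o_def)
  have int: "integrable M (\<lambda>\<omega>. (norm (X_causal j \<omega>))\<^sup>2)"
    using X_square_integrable[of j] integrable_cong_AE[OF _ _ ae] by simp
  have E: "(\<integral>\<omega>. (norm (X_causal j \<omega>))\<^sup>2 \<partial>M) = X_var"
    using integral_cong_AE[OF _ _ ae] X_var[of j] by simp
  show "integrable M (\<lambda>\<omega>. (norm (X j \<omega>))\<^sup>2 * (norm (\<epsilon> (j + 1) \<omega>))\<^sup>2)"
    using indep_var_integrable[OF indep int eps_square_integrable] integrable_cong_AE[OF _ _ ae2] by simp
  show "(\<integral>\<omega>. (norm (X j \<omega>))\<^sup>2 * (norm (\<epsilon> (j + 1) \<omega>))\<^sup>2 \<partial>M) = X_var * eps_var"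
    using indep_var_lebesgue_integral[OF indep int eps_square_integrable] integral_cong_AE[OF _ _ ae2]
    by (simp add: E eps_var)
qed

lemma integrable_gram_X_eps:
  "integrable M (\<lambda>\<omega>. inner (X i \<omega>) (X j \<omega>) * inner (\<epsilon> (i + 1) \<omega>) (\<epsilon> (j + 1) \<omega>))"
proof -
  have *: "integrable M (\<lambda>\<omega>. (norm (norm (X i \<omega>) * norm (\<epsilon> (i + 1) \<omega>)))\<^sup>2)" for i
    using E_X_eps_sq(1)[of i] by (simp add: power_mult_distrib)
  have "integrable M (\<lambda>\<omega>. norm (norm (X i \<omega>) * norm (\<epsilon> (i + 1) \<omega>)) * norm (norm (X j \<omega>) * norm (\<epsilon> (j + 1) \<omega>)))"
    by (rule integrable_inner_of_squares[OF _ _ * *]) auto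
  then show ?thesis
  proof (rule Bochner_Integration.integrable_bound)
    show "AE x in M. norm (inner (X i x) (X j x) * inner (\<epsilon> (i + 1) x) (\<epsilon> (j + 1) x))
        \<le> norm (norm (norm (X i x) * norm (\<epsilon> (i + 1) x)) * norm (norm (X j x) * norm (\<epsilon> (j + 1) x)))"
    proof (rule AE_I2)
      fix x
      have "\<bar>inner (X i x) (X j x)\<bar> * \<bar>inner (\<epsilon> (i + 1) x) (\<epsilon> (j + 1) x)\<bar>
          \<le> (norm (X i x) * norm (X j x)) * (norm (\<epsilon> (i + 1) x) * norm (\<epsilon> (j + 1) x))"
        by (intro mult_mono Cauchy_Schwarz_ineq2) auto
      then show "norm (inner (X i x) (X j x) * inner (\<epsilon> (i + 1) x) (\<epsilon> (j + 1) x))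
        \<le> norm (norm (norm (X i x) * norm (\<epsilon> (i + 1) x)) * norm (norm (X j x) * norm (\<epsilon> (j + 1) x)))"
        by (simp add: abs_mult ac_simps)
    qed
  qed simp
qed

text \<open>The later innovation \<open>\<epsilon>\<^sub>j\<^sub>+\<^sub>1\<close> is independent of the other three factors, which belong to its past,
and has mean zero.\<close>

lemma gram_X_eps_zero:
  assumes "i < j"
  shows "(\<integral>\<omega>. inner (X i \<omega>) (X j \<omega>) * inner (\<epsilon> (i + 1) \<omega>) (\<epsilon> (j + 1) \<omega>) \<partial>M) = 0"
proof -
  define V where "V = (\<lambda>\<omega>. inner (X i \<omega>) (X j \<omega>) *\<^sub>R \<epsilon> (i + 1) \<omega>)"
  define V' where "V' = (\<lambda>\<omega>. inner (X_causal i \<omega>) (X_causal j \<omega>) *\<^sub>R \<epsilon> (i + 1) \<omega>)"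
  have [measurable]: "V \<in> borel_measurable M" "V' \<in> borel_measurable M"
    by (simp_all add: V_def V'_def)
  have ae: "AE \<omega> in M. V \<omega> = V' \<omega>"
    using X_eq_causal[of i] X_eq_causal[of j] by eventually_elim (simp add: V_def V'_def)
  define H where "H = (\<lambda>p. inner (lim (\<lambda>m. ma_sum m i p)) (lim (\<lambda>m. ma_sum m j p)) *\<^sub>R p (i + 1))"
  have H: "H \<in> borel_measurable (PiM {..j} (\<lambda>_. borel))"
    unfolding H_def using assms
    by (intro borel_measurable_scaleR borel_measurable_inner causal_measurable_past measurable_component_singleton) auto
  have V'_eq: "V' = (\<lambda>\<omega>. H (past j \<omega>))"
    using assms by (intro ext) (simp add: V'_def H_def X_causal_past[of i j] X_causal_past[of j j] past_def)
  have indep: "indep_var borel V' borel (\<epsilon> (j + 1))"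
    unfolding V'_eq by (rule indep_past[OF H])
  have "integrable M (\<lambda>\<omega>. (norm (X j \<omega>)) * (norm (X i \<omega>) * norm (\<epsilon> (i + 1) \<omega>)))"
  proof -
    have "integrable M (\<lambda>\<omega>. (norm (norm (X i \<omega>) * norm (\<epsilon> (i + 1) \<omega>)))\<^sup>2)"
      using E_X_eps_sq(1)[of i] by (simp add: power_mult_distrib)
    then have "integrable M (\<lambda>\<omega>. norm (norm (X j \<omega>)) * norm (norm (X i \<omega>) * norm (\<epsilon> (i + 1) \<omega>)))"
      using X_square_integrable[of j] by (intro integrable_inner_of_squares) auto
    then show ?thesis by simp
  qed
  then have "integrable M V"
  proof (rule Bochner_Integration.integrable_bound)
    show "AE x in M. norm (V x) \<le> norm (norm (X j x) * (norm (X i x) * norm (\<epsilon> (i + 1) x)))"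
    proof (rule AE_I2)
      fix x
      show "norm (V x) \<le> norm (norm (X j x) * (norm (X i x) * norm (\<epsilon> (i + 1) x)))"
        using mult_right_mono[OF Cauchy_Schwarz_ineq2[of "X i x" "X j x"], of "norm (\<epsilon> (i + 1) x)"]
        by (simp add: V_def ac_simps)
    qed
  qed simp
  then have "integrable M V'"
    using integrable_cong_AE[OF _ _ ae] by simp
  from indep_inner_expectation(2)[OF indep this eps_mean(1)]
  have "(\<integral>\<omega>. inner (V' \<omega>) (\<epsilon> (j + 1) \<omega>) \<partial>M) = 0"
    by (simp add: eps_mean(2))
  moreover have "(\<integral>\<omega>. inner (V' \<omega>) (\<epsilon> (j + 1) \<omega>) \<partial>M) = (\<integral>\<omega>. inner (V \<omega>) (\<epsilon> (j + 1) \<omega>) \<partial>M)"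
    using ae by (intro integral_cong_AE) auto
  ultimately show ?thesis by (simp add: V_def)
qed

definition noise_hs :: "nat \<Rightarrow> 'w \<Rightarrow> real" where
  "noise_hs n \<omega> = hs_norm_sq {..<n} (\<lambda>j. X (int j) \<omega>) (\<lambda>j. \<epsilon> (int j + 1) \<omega>)"

lemma noise_hs_nonneg: "0 \<le> noise_hs n \<omega>"
  unfolding noise_hs_def by (rule hs_norm_sq_nonneg) simp

lemma E_noise_hs:
  "integrable M (noise_hs n)" "(\<integral>\<omega>. noise_hs n \<omega> \<partial>M) = real n * (X_var * eps_var)"
proof -
  show "integrable M (noise_hs n)"
    unfolding noise_hs_def[abs_def] hs_norm_sq_def
    by (intro Bochner_Integration.integrable_sum integrable_gram_X_eps)
  have "(\<integral>\<omega>. noise_hs n \<omega> \<partial>M) = real (card {..<n}) * (X_var * eps_var)"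
    unfolding noise_hs_def hs_norm_sq_def
  proof (rule expectation_gram_sum)
    show "(\<integral>\<omega>. inner (X (int i) \<omega>) (X (int j) \<omega>) * inner (\<epsilon> (int i + 1) \<omega>) (\<epsilon> (int j + 1) \<omega>) \<partial>M) = 0"
      if "i \<noteq> j" for i j
      using gram_X_eps_zero[of "int i" "int j"] gram_X_eps_zero[of "int j" "int i"] that
      by (cases "i < j") (auto simp: inner_commute)
    show "(\<integral>\<omega>. inner (X (int i) \<omega>) (X (int i) \<omega>) * inner (\<epsilon> (int i + 1) \<omega>) (\<epsilon> (int i + 1) \<omega>) \<partial>M) = X_var * eps_var" for i
      using E_X_eps_sq(2)[of "int i"] by (simp add: power2_norm_eq_inner)
  qed (auto intro: integrable_gram_X_eps)
  then show "(\<integral>\<omega>. noise_hs n \<omega> \<partial>M) = real n * (X_var * eps_var)" by simp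
qed

lemma indep_eps_pair:
  assumes "s \<noteq> t"
  shows "indep_var borel (\<epsilon> s) borel (\<epsilon> t)"
proof -
  have "indep_var borel ((\<lambda>p. p s) \<circ> (\<lambda>\<omega>. restrict (\<lambda>i. \<epsilon> i \<omega>) {s})) borel ((\<lambda>p. p t) \<circ> (\<lambda>\<omega>. restrict (\<lambda>i. \<epsilon> i \<omega>) {t}))"
    using assms by (intro indep_var_compose[OF indep_var_restrict[OF indep_eps]]) auto
  then show ?thesis by (simp add: o_def)
qed

text \<open>Distinct summands are independent and centered, so their inner products have mean zero and only the
\<open>n\<close> diagonal terms remain.\<close>

lemma E_mean_sq:
  fixes g :: "'a \<Rightarrow> 'b::{real_inner, banach, second_countable_topology}"
  assumes g[measurable]: "g \<in> borel_measurable borel" and n: "n \<ge> 1"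
    and sq: "integrable M (\<lambda>\<omega>. (norm (g (\<epsilon> 0 \<omega>)))\<^sup>2)" and zero: "(\<integral>\<omega>. g (\<epsilon> 0 \<omega>) \<partial>M) = 0"
  shows "integrable M (\<lambda>\<omega>. (norm ((1 / real n) *\<^sub>R (\<Sum>j=1..n. g (\<epsilon> (int j) \<omega>))))\<^sup>2)"
    and "(\<integral>\<omega>. (norm ((1 / real n) *\<^sub>R (\<Sum>j=1..n. g (\<epsilon> (int j) \<omega>))))\<^sup>2 \<partial>M) = (\<integral>\<omega>. (norm (g (\<epsilon> 0 \<omega>)))\<^sup>2 \<partial>M) / real n"
proof -
  have sq_t: "integrable M (\<lambda>\<omega>. (norm (g (\<epsilon> t \<omega>)))\<^sup>2)" for t
    using sq transfer_eps(1)[of "\<lambda>x. (norm (g x))\<^sup>2" t] by simp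
  have E_sq: "(\<integral>\<omega>. (norm (g (\<epsilon> t \<omega>)))\<^sup>2 \<partial>M) = (\<integral>\<omega>. (norm (g (\<epsilon> 0 \<omega>)))\<^sup>2 \<partial>M)" for t
    by (rule transfer_eps) simp
  have int: "integrable M (\<lambda>\<omega>. g (\<epsilon> t \<omega>))" for t
    by (rule integrable_of_square[OF _ sq_t]) measurable
  have zero_t: "(\<integral>\<omega>. g (\<epsilon> t \<omega>) \<partial>M) = 0" for t
    using transfer_eps(2)[OF g, of t] zero by simp
  have inner_int: "integrable M (\<lambda>\<omega>. inner (g (\<epsilon> s \<omega>)) (g (\<epsilon> t \<omega>)))" for s t
    by (rule integrable_inner_of_squares(2)[OF _ _ sq_t sq_t]) measurable
  have off: "(\<integral>\<omega>. inner (g (\<epsilon> s \<omega>)) (g (\<epsilon> t \<omega>)) \<partial>M) = 0" if "s \<noteq> t" for s t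
  proof -
    have "indep_var borel (\<lambda>\<omega>. g (\<epsilon> s \<omega>)) borel (\<lambda>\<omega>. g (\<epsilon> t \<omega>))"
      using indep_var_compose[OF indep_eps_pair[OF that] g g] by (simp add: o_def)
    from indep_inner_expectation(2)[OF this int int] show ?thesis
      by (simp add: zero_t)
  qed
  have eq: "(norm ((1 / real n) *\<^sub>R (\<Sum>j=1..n. g (\<epsilon> (int j) \<omega>))))\<^sup>2 =
      (1 / (real n)\<^sup>2) * (\<Sum>i=1..n. \<Sum>j=1..n. inner (g (\<epsilon> (int i) \<omega>)) (g (\<epsilon> (int j) \<omega>)))" for \<omega>
    using norm_sum_scaleR_sq[of "\<lambda>_. 1" "\<lambda>j. g (\<epsilon> (int j) \<omega>)" "{1..n}"]
    by (simp add: power_divide)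
  show "integrable M (\<lambda>\<omega>. (norm ((1 / real n) *\<^sub>R (\<Sum>j=1..n. g (\<epsilon> (int j) \<omega>))))\<^sup>2)"
    unfolding eq by (intro integrable_mult_right Bochner_Integration.integrable_sum inner_int)
  have "(\<integral>\<omega>. (\<Sum>i=1..n. \<Sum>j=1..n. inner (g (\<epsilon> (int i) \<omega>)) (g (\<epsilon> (int j) \<omega>))) \<partial>M) =
      real (card {1..n}) * (\<integral>\<omega>. (norm (g (\<epsilon> 0 \<omega>)))\<^sup>2 \<partial>M)"
  proof (rule expectation_gram_sum)
    show "(\<integral>\<omega>. inner (g (\<epsilon> (int i) \<omega>)) (g (\<epsilon> (int i) \<omega>)) \<partial>M) = (\<integral>\<omega>. (norm (g (\<epsilon> 0 \<omega>)))\<^sup>2 \<partial>M)" for i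
      using E_sq[of "int i"] by (simp only: power2_norm_eq_inner)
  qed (auto intro: inner_int off)
  then show "(\<integral>\<omega>. (norm ((1 / real n) *\<^sub>R (\<Sum>j=1..n. g (\<epsilon> (int j) \<omega>))))\<^sup>2 \<partial>M) = (\<integral>\<omega>. (norm (g (\<epsilon> 0 \<omega>)))\<^sup>2 \<partial>M) / real n"
    unfolding eq using n by (simp add: power2_eq_square del: Bochner_Integration.integral_sum)
qed

lemma E_empirical_mean_error:
  fixes f :: "'a \<Rightarrow> real"
  assumes f[measurable]: "f \<in> borel_measurable borel" and n: "n \<ge> 1"
    and sq: "integrable M (\<lambda>\<omega>. (f (\<epsilon> 0 \<omega>))\<^sup>2)"
  defines "err \<equiv> \<lambda>\<omega>. (1 / real n) * (\<Sum>j=1..n. f (\<epsilon> (int j) \<omega>)) - (\<integral>\<omega>. f (\<epsilon> 0 \<omega>) \<partial>M)"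
  shows "integrable M (\<lambda>\<omega>. (err \<omega>)\<^sup>2)"
    and "(\<integral>\<omega>. (err \<omega>)\<^sup>2 \<partial>M) \<le> (\<integral>\<omega>. (f (\<epsilon> 0 \<omega>))\<^sup>2 \<partial>M) / real n"
proof -
  define m where "m = (\<integral>\<omega>. f (\<epsilon> 0 \<omega>) \<partial>M)"
  have int: "integrable M (\<lambda>\<omega>. f (\<epsilon> 0 \<omega>))"
    by (rule integrable_of_square) (measurable, simp add: sq)
  have eq: "err \<omega> = (1 / real n) *\<^sub>R (\<Sum>j=1..n. f (\<epsilon> (int j) \<omega>) - m)" for \<omega>
    using n by (simp add: err_def m_def sum_subtractf right_diff_distrib)
  have expand: "(norm (f (\<epsilon> 0 \<omega>) - m))\<^sup>2 = (f (\<epsilon> 0 \<omega>))\<^sup>2 - 2 * m * f (\<epsilon> 0 \<omega>) + m\<^sup>2" for \<omega>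
    by (simp add: power2_diff)
  have sq': "integrable M (\<lambda>\<omega>. (norm (f (\<epsilon> 0 \<omega>) - m))\<^sup>2)"
    unfolding expand using sq int by auto
  have zero: "(\<integral>\<omega>. f (\<epsilon> 0 \<omega>) - m \<partial>M) = 0"
    using int by (simp add: m_def prob_space)
  have "(\<integral>\<omega>. (norm (f (\<epsilon> 0 \<omega>) - m))\<^sup>2 \<partial>M) = (\<integral>\<omega>. (f (\<epsilon> 0 \<omega>))\<^sup>2 \<partial>M) - m\<^sup>2"
    unfolding expand using sq int by (simp add: prob_space m_def[symmetric] power2_eq_square)
  then have le: "(\<integral>\<omega>. (norm (f (\<epsilon> 0 \<omega>) - m))\<^sup>2 \<partial>M) \<le> (\<integral>\<omega>. (f (\<epsilon> 0 \<omega>))\<^sup>2 \<partial>M)"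
    by simp
  have "(\<lambda>x. f x - m) \<in> borel_measurable borel" by measurable
  note E = E_mean_sq[of "\<lambda>x. f x - m", OF this n sq' zero]
  show "integrable M (\<lambda>\<omega>. (err \<omega>)\<^sup>2)"
    using E(1) unfolding real_norm_def power2_abs eq .
  show "(\<integral>\<omega>. (err \<omega>)\<^sup>2 \<partial>M) \<le> (\<integral>\<omega>. (f (\<epsilon> 0 \<omega>))\<^sup>2 \<partial>M) / real n"
    using E(2) divide_right_mono[OF le, of "real n"] unfolding real_norm_def power2_abs eq by simp
qed

end

section \<open>Empirical second moments of the innovations\<close>

context far1_process
begin

definition eps_fourth :: real where "eps_fourth = (\<integral>\<omega>. norm (\<epsilon> 0 \<omega>) ^ 4 \<partial>M)"

lemma eps_fourth_nonneg: "0 \<le> eps_fourth"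
  by (simp add: eps_fourth_def)

definition eps_cov_err :: "nat \<Rightarrow> 'a \<Rightarrow> 'a \<Rightarrow> 'w \<Rightarrow> real" where
  "eps_cov_err n b c \<omega> = (1 / real n) * (\<Sum>j=1..n. inner b (\<epsilon> (int j) \<omega>) * inner c (\<epsilon> (int j) \<omega>))
     - (\<integral>\<omega>. inner b (\<epsilon> 0 \<omega>) * inner c (\<epsilon> 0 \<omega>) \<partial>M)"

lemma eps_cov_err_measurable[measurable]: "eps_cov_err n b c \<in> borel_measurable M"
  unfolding eps_cov_err_def[abs_def] by measurable

lemma inner_prod_sq_integrable: "integrable M (\<lambda>\<omega>. (inner b (\<epsilon> 0 \<omega>) * inner c (\<epsilon> 0 \<omega>))\<^sup>2)"
proof -
  have "integrable M (\<lambda>\<omega>. (norm b * norm c)\<^sup>2 * norm (\<epsilon> 0 \<omega>) ^ 4)"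
    using eps_moment by (rule integrable_mult_right)
  then show ?thesis
  proof (rule Bochner_Integration.integrable_bound)
    show "AE x in M. norm ((inner b (\<epsilon> 0 x) * inner c (\<epsilon> 0 x))\<^sup>2) \<le> norm ((norm b * norm c)\<^sup>2 * norm (\<epsilon> 0 x) ^ 4)"
    proof (rule AE_I2)
      fix x
      have "\<bar>inner b (\<epsilon> 0 x)\<bar> * \<bar>inner c (\<epsilon> 0 x)\<bar> \<le> (norm b * norm (\<epsilon> 0 x)) * (norm c * norm (\<epsilon> 0 x))"
        by (intro mult_mono Cauchy_Schwarz_ineq2) auto
      then have "(\<bar>inner b (\<epsilon> 0 x)\<bar> * \<bar>inner c (\<epsilon> 0 x)\<bar>)\<^sup>2 \<le> ((norm b * norm (\<epsilon> 0 x)) * (norm c * norm (\<epsilon> 0 x)))\<^sup>2"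
        by (intro power_mono) auto
      then show "norm ((inner b (\<epsilon> 0 x) * inner c (\<epsilon> 0 x))\<^sup>2) \<le> norm ((norm b * norm c)\<^sup>2 * norm (\<epsilon> 0 x) ^ 4)"
        by (simp add: power_mult_distrib ac_simps flip: power_add)
    qed
  qed simp
qed

lemma inner_prod_integrable: "integrable M (\<lambda>\<omega>. inner b (\<epsilon> 0 \<omega>) * inner c (\<epsilon> 0 \<omega>))"
  by (rule integrable_of_square) (measurable, simp add: inner_prod_sq_integrable)

text \<open>Squared Hilbert--Schmidt norm of the error of the empirical innovation covariance, compressed to the
span of \<open>C\<close>.\<close>

definition eps_cov_err_hs :: "'a set \<Rightarrow> nat \<Rightarrow> 'w \<Rightarrow> real" where
  "eps_cov_err_hs C n \<omega> = (\<Sum>b\<in>C. \<Sum>c\<in>C. (eps_cov_err n b c \<omega>)\<^sup>2)"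

lemma eps_cov_err_hs_measurable[measurable]: "eps_cov_err_hs C n \<in> borel_measurable M"
  unfolding eps_cov_err_hs_def[abs_def] by measurable

text \<open>The bound does not depend on \<open>C\<close>: each entry has variance at most \<open>1/n\<close> times a fourth moment, and
the fourth moments sum to at most \<open>E \<parallel>\<epsilon>\<parallel>\<^sup>4\<close> by Bessel's inequality.\<close>

lemma E_eps_cov_err_hs:
  assumes C: "orthonormal_set C" and n: "n \<ge> 1"
  shows "(\<integral>\<^sup>+\<omega>. ennreal (eps_cov_err_hs C n \<omega>) \<partial>M) \<le> ennreal (eps_fourth / real n)"
proof -
  have E: "integrable M (\<lambda>\<omega>. (eps_cov_err n b c \<omega>)\<^sup>2)"
    "(\<integral>\<omega>. (eps_cov_err n b c \<omega>)\<^sup>2 \<partial>M) \<le> (\<integral>\<omega>. (inner b (\<epsilon> 0 \<omega>) * inner c (\<epsilon> 0 \<omega>))\<^sup>2 \<partial>M) / real n" for b c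
    unfolding eps_cov_err_def
    by (rule E_empirical_mean_error[of "\<lambda>x. inner b x * inner c x", OF _ n inner_prod_sq_integrable], simp)+
  have "(\<integral>\<^sup>+\<omega>. ennreal (eps_cov_err_hs C n \<omega>) \<partial>M) = ennreal (\<integral>\<omega>. eps_cov_err_hs C n \<omega> \<partial>M)"
    unfolding eps_cov_err_hs_def
    by (intro nn_integral_eq_integral Bochner_Integration.integrable_sum E AE_I2 sum_nonneg) auto
  also have "(\<integral>\<omega>. eps_cov_err_hs C n \<omega> \<partial>M) = (\<Sum>b\<in>C. \<Sum>c\<in>C. \<integral>\<omega>. (eps_cov_err n b c \<omega>)\<^sup>2 \<partial>M)"
    unfolding eps_cov_err_hs_def using E by simp
  also have "\<dots> \<le> (\<Sum>b\<in>C. \<Sum>c\<in>C. (\<integral>\<omega>. (inner b (\<epsilon> 0 \<omega>) * inner c (\<epsilon> 0 \<omega>))\<^sup>2 \<partial>M) / real n)"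
    by (intro sum_mono E)
  also have "\<dots> = (\<integral>\<omega>. (\<Sum>b\<in>C. \<Sum>c\<in>C. (inner b (\<epsilon> 0 \<omega>) * inner c (\<epsilon> 0 \<omega>))\<^sup>2) \<partial>M) / real n"
    using inner_prod_sq_integrable by (simp add: sum_divide_distrib)
  also have "(\<integral>\<omega>. (\<Sum>b\<in>C. \<Sum>c\<in>C. (inner b (\<epsilon> 0 \<omega>) * inner c (\<epsilon> 0 \<omega>))\<^sup>2) \<partial>M) \<le> eps_fourth"
    unfolding eps_fourth_def
  proof (rule integral_mono)
    show "integrable M (\<lambda>\<omega>. \<Sum>b\<in>C. \<Sum>c\<in>C. (inner b (\<epsilon> 0 \<omega>) * inner c (\<epsilon> 0 \<omega>))\<^sup>2)"
      by (intro Bochner_Integration.integrable_sum inner_prod_sq_integrable)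
    fix \<omega>
    have "(\<Sum>b\<in>C. \<Sum>c\<in>C. (inner b (\<epsilon> 0 \<omega>) * inner c (\<epsilon> 0 \<omega>))\<^sup>2) = (\<Sum>b\<in>C. (inner b (\<epsilon> 0 \<omega>))\<^sup>2)\<^sup>2"
      by (simp add: power_mult_distrib power2_eq_square[of "sum _ _"] sum_product)
    also have "\<dots> \<le> ((norm (\<epsilon> 0 \<omega>))\<^sup>2)\<^sup>2"
      by (intro power_mono bessel_ineq[OF C] sum_nonneg) auto
    finally show "(\<Sum>b\<in>C. \<Sum>c\<in>C. (inner b (\<epsilon> 0 \<omega>) * inner c (\<epsilon> 0 \<omega>))\<^sup>2) \<le> norm (\<epsilon> 0 \<omega>) ^ 4"
      by simp
  qed (rule eps_moment)
  finally show ?thesis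
    using n by (simp add: divide_right_mono ennreal_leI)
qed

definition eps_form_err :: "nat \<Rightarrow> ('a \<Rightarrow> real) \<Rightarrow> 'w \<Rightarrow> real" where
  "eps_form_err n f \<omega> = (1 / real n) * (\<Sum>j=1..n. (f (\<epsilon> (int j) \<omega>))\<^sup>2) - (\<integral>\<omega>. (f (\<epsilon> 0 \<omega>))\<^sup>2 \<partial>M)"

lemma functional_measurable[measurable_dest]:
  "bounded_linear f \<Longrightarrow> f \<in> borel_measurable borel"
  by (intro borel_measurable_continuous_onI linear_continuous_on)

lemma eps_form_err_proj:
  fixes f :: "'a \<Rightarrow> real"
  assumes f: "bounded_linear f" "onorm f \<le> 1" and C: "orthonormal_set C"
  shows "(eps_form_err n (\<lambda>x. f (proj C x)) \<omega>)\<^sup>2 \<le> eps_cov_err_hs C n \<omega>"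
proof -
  interpret bounded_linear f by fact
  have sq: "(f (proj C x))\<^sup>2 = (\<Sum>b\<in>C. \<Sum>c\<in>C. (f b * f c) * (inner b x * inner c x))" for x
    by (simp add: proj_def sum scaleR power2_eq_square sum_product ac_simps)
  have "eps_form_err n (\<lambda>x. f (proj C x)) \<omega> = (\<Sum>b\<in>C. \<Sum>c\<in>C. (f b * f c) * eps_cov_err n b c \<omega>)"
  proof -
    have "(\<integral>\<omega>. (f (proj C (\<epsilon> 0 \<omega>)))\<^sup>2 \<partial>M) =
        (\<Sum>b\<in>C. \<Sum>c\<in>C. (f b * f c) * (\<integral>\<omega>. inner b (\<epsilon> 0 \<omega>) * inner c (\<epsilon> 0 \<omega>) \<partial>M))"
      unfolding sq using inner_prod_integrable
      by (simp add: Bochner_Integration.integral_sum Bochner_Integration.integrable_sum)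
    moreover have "(1 / real n) * (\<Sum>j=1..n. (f (proj C (\<epsilon> (int j) \<omega>)))\<^sup>2) =
        (\<Sum>b\<in>C. \<Sum>c\<in>C. (f b * f c) * ((1 / real n) * (\<Sum>j=1..n. inner b (\<epsilon> (int j) \<omega>) * inner c (\<epsilon> (int j) \<omega>))))"
      unfolding sq sum_distrib_left
      by (rule trans[OF sum.swap], rule sum.cong[OF refl], rule trans[OF sum.swap], intro sum.cong refl) (simp add: ac_simps)
    ultimately show ?thesis
      unfolding eps_form_err_def eps_cov_err_def by (simp add: right_diff_distrib sum_subtractf)
  qed
  also have "\<dots> = (\<Sum>p\<in>C \<times> C. (f (fst p) * f (snd p)) * eps_cov_err n (fst p) (snd p) \<omega>)"
    by (simp add: sum.cartesian_product case_prod_beta)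
  finally have "(eps_form_err n (\<lambda>x. f (proj C x)) \<omega>)\<^sup>2 \<le>
      (\<Sum>p\<in>C \<times> C. (f (fst p) * f (snd p))\<^sup>2) * (\<Sum>p\<in>C \<times> C. (eps_cov_err n (fst p) (snd p) \<omega>)\<^sup>2)"
    using Cauchy_Schwarz_ineq_sum[of "\<lambda>p. f (fst p) * f (snd p)" "\<lambda>p. eps_cov_err n (fst p) (snd p) \<omega>" "C \<times> C"] by simp
  also have "(\<Sum>p\<in>C \<times> C. (f (fst p) * f (snd p))\<^sup>2) = (\<Sum>b\<in>C. (f b)\<^sup>2)\<^sup>2"
    by (simp add: power_mult_distrib power2_eq_square[of "sum _ _"] sum_product sum.cartesian_product case_prod_beta)
  also have "(\<Sum>p\<in>C \<times> C. (eps_cov_err n (fst p) (snd p) \<omega>)\<^sup>2) = eps_cov_err_hs C n \<omega>"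
    by (simp add: eps_cov_err_hs_def sum.cartesian_product case_prod_beta)
  finally have "(eps_form_err n (\<lambda>x. f (proj C x)) \<omega>)\<^sup>2 \<le> (\<Sum>b\<in>C. (f b)\<^sup>2)\<^sup>2 * eps_cov_err_hs C n \<omega>" .
  moreover have "(\<Sum>b\<in>C. (f b)\<^sup>2)\<^sup>2 \<le> 1"
  proof -
    have "(onorm f)\<^sup>2 \<le> 1" using f onorm_pos_le[OF f(1)] by (simp add: power_le_one)
    then have "(\<Sum>b\<in>C. (f b)\<^sup>2) \<le> 1" using functional_bessel[OF f(1) C] by linarith
    then show ?thesis by (intro power_le_one sum_nonneg) auto
  qed
  ultimately show ?thesis
    using mult_right_mono[of "(\<Sum>b\<in>C. (f b)\<^sup>2)\<^sup>2" 1 "eps_cov_err_hs C n \<omega>"]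
    by (simp add: eps_cov_err_hs_def sum_nonneg)
qed

lemma eps_form_err_proj_tendsto:
  fixes f :: "'a \<Rightarrow> real"
  assumes f: "bounded_linear f" and C: "\<And>m. orthonormal_set (C m)" "\<And>x. (\<lambda>m. proj (C m) x) \<longlonglongrightarrow> x"
  shows "(\<lambda>m. eps_form_err n (\<lambda>x. f (proj (C m) x)) \<omega>) \<longlonglongrightarrow> eps_form_err n f \<omega>"
proof -
  have lim: "(\<lambda>m. (f (proj (C m) x))\<^sup>2) \<longlonglongrightarrow> (f x)\<^sup>2" for x
    by (intro tendsto_power bounded_linear.tendsto[OF f] C)
  have meas_proj[measurable]: "proj (C m) \<in> borel_measurable borel" for m
    unfolding proj_def[abs_def] by measurable
  have meas[measurable]: "f \<in> borel_measurable borel"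
    by (rule functional_measurable[OF f])
  have "(\<lambda>m. \<integral>\<omega>. (f (proj (C m) (\<epsilon> 0 \<omega>)))\<^sup>2 \<partial>M) \<longlonglongrightarrow> (\<integral>\<omega>. (f (\<epsilon> 0 \<omega>))\<^sup>2 \<partial>M)"
  proof (rule integral_dominated_convergence[where w="\<lambda>\<omega>. (onorm f)\<^sup>2 * (norm (\<epsilon> 0 \<omega>))\<^sup>2"])
    show "integrable M (\<lambda>\<omega>. (onorm f)\<^sup>2 * (norm (\<epsilon> 0 \<omega>))\<^sup>2)"
      by (intro integrable_mult_right eps_square_integrable)
    show "AE \<omega> in M. norm ((f (proj (C m) (\<epsilon> 0 \<omega>)))\<^sup>2) \<le> (onorm f)\<^sup>2 * (norm (\<epsilon> 0 \<omega>))\<^sup>2" for m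
    proof (rule AE_I2)
      fix \<omega>
      have "\<bar>f (proj (C m) (\<epsilon> 0 \<omega>))\<bar> \<le> onorm f * norm (proj (C m) (\<epsilon> 0 \<omega>))"
        using onorm[OF f, of "proj (C m) (\<epsilon> 0 \<omega>)"] by simp
      also have "\<dots> \<le> onorm f * norm (\<epsilon> 0 \<omega>)"
        by (intro mult_left_mono norm_proj_le C onorm_pos_le[OF f])
      finally have "\<bar>f (proj (C m) (\<epsilon> 0 \<omega>))\<bar>\<^sup>2 \<le> (onorm f * norm (\<epsilon> 0 \<omega>))\<^sup>2"
        by (intro power_mono) auto
      then show "norm ((f (proj (C m) (\<epsilon> 0 \<omega>)))\<^sup>2) \<le> (onorm f)\<^sup>2 * (norm (\<epsilon> 0 \<omega>))\<^sup>2"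
        by (simp add: power_mult_distrib)
    qed
  qed (auto intro: lim)
  then show ?thesis
    unfolding eps_form_err_def by (intro tendsto_intros lim)
qed

lemma eps_form_err_scale: "eps_form_err n (\<lambda>x. a * f x) \<omega> = a\<^sup>2 * eps_form_err n f \<omega>"
  by (simp add: eps_form_err_def power_mult_distrib right_diff_distrib sum_distrib_left ac_simps)

text \<open>The deviations of the finite rank functionals \<open>f \<circ> proj (C m)\<close> converge to that of \<open>f\<close> and are
bounded by the compressed Hilbert--Schmidt norms. The bound uses their limit inferior, which is
measurable and independent of \<open>f\<close>, and to which Fatou's lemma applies.\<close>

lemma eps_form_err_bound:
  assumes C: "\<And>m. orthonormal_set (C m)" "\<And>x. (\<lambda>m. proj (C m) x) \<longlonglongrightarrow> x"
    and R: "liminf (\<lambda>m. ennreal (eps_cov_err_hs (C m) n \<omega>)) \<le> ennreal (\<rho>\<^sup>2)" "0 \<le> \<rho>"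
    and f: "bounded_linear f"
  shows "\<bar>eps_form_err n f \<omega>\<bar> \<le> \<rho> * (onorm f)\<^sup>2"
proof -
  have unit: "\<bar>eps_form_err n g \<omega>\<bar> \<le> \<rho>" if g: "bounded_linear g" "onorm g \<le> 1" for g
  proof -
    have "(\<lambda>m. ennreal ((eps_form_err n (\<lambda>x. g (proj (C m) x)) \<omega>)\<^sup>2)) \<longlonglongrightarrow> ennreal ((eps_form_err n g \<omega>)\<^sup>2)"
      by (intro tendsto_ennrealI tendsto_power eps_form_err_proj_tendsto g C)
    then have "ennreal ((eps_form_err n g \<omega>)\<^sup>2) = liminf (\<lambda>m. ennreal ((eps_form_err n (\<lambda>x. g (proj (C m) x)) \<omega>)\<^sup>2))"
      by (rule lim_imp_Liminf[OF trivial_limit_sequentially, symmetric])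
    also have "\<dots> \<le> liminf (\<lambda>m. ennreal (eps_cov_err_hs (C m) n \<omega>))"
      by (intro Liminf_mono always_eventually allI ennreal_leI eps_form_err_proj g C)
    also note R(1)
    finally have "(eps_form_err n g \<omega>)\<^sup>2 \<le> \<rho>\<^sup>2"
      by simp
    then show ?thesis
      using R(2) by (simp add: abs_le_square_iff[symmetric])
  qed
  show ?thesis
  proof (cases "onorm f = 0")
    case True
    then have "f x = 0" for x using onorm[OF f, of x] by simp
    then show ?thesis using R(2) by (simp add: eps_form_err_def)
  next
    case False
    then have pos: "onorm f > 0" using onorm_pos_le[OF f] by simp
    have "onorm (\<lambda>x. (1 / onorm f) * f x) = 1"
      using onorm_scaleR[OF f, of "1 / onorm f"] pos by simp
    then have "\<bar>eps_form_err n (\<lambda>x. (1 / onorm f) * f x) \<omega>\<bar> \<le> \<rho>"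
      using f by (intro unit bounded_linear_const_mult) auto
    then show ?thesis
      using pos unfolding eps_form_err_scale by (simp add: abs_mult power_divide field_simps)
  qed
qed

end

section \<open>Uniform error of the empirical covariance form\<close>

context far1_process
begin

definition X_form_err :: "nat \<Rightarrow> ('a \<Rightarrow> real) \<Rightarrow> 'w \<Rightarrow> real" where
  "X_form_err n f \<omega> = (1 / real n) * (\<Sum>j<n. (f (X (int j) \<omega>))\<^sup>2) - (\<integral>\<omega>. (f (X 0 \<omega>))\<^sup>2 \<partial>M)"

lemma functional_sq_le:
  fixes f :: "'a \<Rightarrow> real"
  assumes "bounded_linear f"
  shows "(f x)\<^sup>2 \<le> (onorm f)\<^sup>2 * (norm x)\<^sup>2"
  using power_mono[OF onorm[OF assms, of x], of 2] by (simp add: power_mult_distrib)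

lemma functional_sq_integrable:
  fixes f :: "'a \<Rightarrow> real"
  assumes f: "bounded_linear f"
    and [measurable]: "Y \<in> borel_measurable M" and Y: "integrable M (\<lambda>\<omega>. (norm (Y \<omega>))\<^sup>2)"
  shows "integrable M (\<lambda>\<omega>. (f (Y \<omega>))\<^sup>2)"
proof -
  note [measurable] = functional_measurable[OF f]
  show ?thesis
    by (rule Bochner_Integration.integrable_bound[OF integrable_mult_right[OF Y, of "(onorm f)\<^sup>2"]])
       (auto simp: functional_sq_le[OF f])
qed

lemma bounded_linear_comp_Psi:
  fixes f :: "'a \<Rightarrow> real"
  shows "bounded_linear f \<Longrightarrow> bounded_linear (\<lambda>x. f (\<Psi> x))"
  by (rule bounded_linear_compose[OF _ Psi(1)])

lemma onorm_comp_Psi: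
  fixes f :: "'a \<Rightarrow> real"
  shows "bounded_linear f \<Longrightarrow> onorm (\<lambda>x. f (\<Psi> x)) \<le> onorm f * onorm \<Psi>"
  using onorm_compose[of f \<Psi>] Psi(1) by (simp add: o_def)

text \<open>By stationarity the left-hand side may be computed at time 1, where \<open>f (X 1) = f (\<Psi> (X 0)) + f (\<epsilon> 1)\<close>
with independent centered summands.\<close>

lemma variance_decomposition:
  fixes f :: "'a \<Rightarrow> real"
  assumes f: "bounded_linear f"
  shows "(\<integral>\<omega>. (f (X 0 \<omega>))\<^sup>2 \<partial>M) = (\<integral>\<omega>. (f (\<Psi> (X 0 \<omega>)))\<^sup>2 \<partial>M) + (\<integral>\<omega>. (f (\<epsilon> 0 \<omega>))\<^sup>2 \<partial>M)"
proof -
  interpret f: bounded_linear f by fact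
  let ?g = "\<lambda>x. f (\<Psi> x)"
  have g: "bounded_linear ?g" by (rule bounded_linear_comp_Psi[OF f])
  have [measurable]: "f \<in> borel_measurable borel" "?g \<in> borel_measurable borel"
    by (rule functional_measurable[OF f], rule functional_measurable[OF g])
  have gX: "integrable M (\<lambda>\<omega>. (?g (X 0 \<omega>))\<^sup>2)"
    by (rule functional_sq_integrable[OF g X_measurable X_square_integrable])
  have fe: "integrable M (\<lambda>\<omega>. (f (\<epsilon> t \<omega>))\<^sup>2)" for t
    by (rule functional_sq_integrable[OF f eps_measurable eps_square_integrable])
  have ae: "AE \<omega> in M. ?g (X 0 \<omega>) = ?g (X_causal 0 \<omega>)"
    using X_eq_causal[of 0] by eventually_elim simp
  have ae2: "AE \<omega> in M. ?g (X 0 \<omega>) * f (\<epsilon> 1 \<omega>) = ?g (X_causal 0 \<omega>) * f (\<epsilon> 1 \<omega>)"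
    using ae by eventually_elim simp
  have indep: "indep_var borel (\<lambda>\<omega>. ?g (X_causal 0 \<omega>)) borel (\<lambda>\<omega>. f (\<epsilon> 1 \<omega>))"
    using indep_var_compose[OF indep_X_eps[of 0], of ?g borel f borel] by (simp add: o_def)
  have int_g: "integrable M (\<lambda>\<omega>. ?g (X_causal 0 \<omega>))"
  proof -
    have "integrable M (\<lambda>\<omega>. ?g (X 0 \<omega>))"
      by (rule integrable_of_square) (measurable, simp add: gX)
    then show ?thesis using integrable_cong_AE[OF _ _ ae] by simp
  qed
  have int_f: "integrable M (\<lambda>\<omega>. f (\<epsilon> 1 \<omega>))"
    by (rule integrable_bounded_linear[OF f eps_mean(1)])
  have zero: "(\<integral>\<omega>. f (\<epsilon> 1 \<omega>) \<partial>M) = 0"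
    using integral_bounded_linear[OF f eps_mean(1)[of 1]] eps_mean(2)[of 1] by (simp add: f.zero)
  have cross_int: "integrable M (\<lambda>\<omega>. ?g (X 0 \<omega>) * f (\<epsilon> 1 \<omega>))"
    using indep_var_integrable[OF indep int_g int_f] integrable_cong_AE[OF _ _ ae2] by simp
  have cross: "(\<integral>\<omega>. ?g (X 0 \<omega>) * f (\<epsilon> 1 \<omega>) \<partial>M) = 0"
    using indep_var_lebesgue_integral[OF indep int_g int_f] integral_cong_AE[OF _ _ ae2] zero by simp
  have "(\<integral>\<omega>. (f (X 0 \<omega>))\<^sup>2 \<partial>M) = (\<integral>\<omega>. (f (X 1 \<omega>))\<^sup>2 \<partial>M)"
    using transfer_X(2)[of "\<lambda>x. (f x)\<^sup>2" 1] by simp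
  also have "\<dots> = (\<integral>\<omega>. (?g (X 0 \<omega>))\<^sup>2 + 2 * (?g (X 0 \<omega>) * f (\<epsilon> 1 \<omega>)) + (f (\<epsilon> 1 \<omega>))\<^sup>2 \<partial>M)"
  proof (rule integral_cong_AE)
    show "AE \<omega> in M. (f (X 1 \<omega>))\<^sup>2 = (?g (X 0 \<omega>))\<^sup>2 + 2 * (?g (X 0 \<omega>) * f (\<epsilon> 1 \<omega>)) + (f (\<epsilon> 1 \<omega>))\<^sup>2"
      using far1[of 0] by eventually_elim (simp add: f.add power2_sum algebra_simps)
  qed measurable
  also have "\<dots> = (\<integral>\<omega>. (?g (X 0 \<omega>))\<^sup>2 \<partial>M) + (\<integral>\<omega>. (f (\<epsilon> 1 \<omega>))\<^sup>2 \<partial>M)"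
    using gX fe cross_int cross by simp
  also have "(\<integral>\<omega>. (f (\<epsilon> 1 \<omega>))\<^sup>2 \<partial>M) = (\<integral>\<omega>. (f (\<epsilon> 0 \<omega>))\<^sup>2 \<partial>M)"
    using transfer_eps(2)[of "\<lambda>x. (f x)\<^sup>2" 1] by simp
  finally show ?thesis .
qed

text \<open>Shift the time index by one, which costs the boundary term, and square the autoregressive
equation; \<open>variance_decomposition\<close> is the same identity for the expectations.\<close>

lemma X_form_err_recursion:
  fixes f :: "'a \<Rightarrow> real"
  assumes f: "bounded_linear f" and \<omega>: "\<forall>t. X (t + 1) \<omega> = \<Psi> (X t \<omega>) + \<epsilon> (t + 1) \<omega>"
  shows "X_form_err n f \<omega> = X_form_err n (\<lambda>x. f (\<Psi> x)) \<omega>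
    + 2 * ((1 / real n) * (\<Sum>j<n. f (\<Psi> (X (int j) \<omega>)) * f (\<epsilon> (int j + 1) \<omega>)))
    + eps_form_err n f \<omega> + ((f (X 0 \<omega>))\<^sup>2 - (f (X (int n) \<omega>))\<^sup>2) / real n"
proof -
  interpret f: bounded_linear f by fact
  have "(\<Sum>j<n. (f (X (int j) \<omega>))\<^sup>2) + (f (X (int n) \<omega>))\<^sup>2 = (f (X 0 \<omega>))\<^sup>2 + (\<Sum>j<n. (f (X (int j + 1) \<omega>))\<^sup>2)"
    using sum.lessThan_Suc_shift[of "\<lambda>j. (f (X (int j) \<omega>))\<^sup>2" n] by (simp add: add.commute)
  moreover have "(\<Sum>j<n. (f (X (int j + 1) \<omega>))\<^sup>2) = (\<Sum>j<n. (f (\<Psi> (X (int j) \<omega>)))\<^sup>2)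
      + 2 * (\<Sum>j<n. f (\<Psi> (X (int j) \<omega>)) * f (\<epsilon> (int j + 1) \<omega>)) + (\<Sum>j<n. (f (\<epsilon> (int j + 1) \<omega>))\<^sup>2)"
  proof -
    have "(f (X (int j + 1) \<omega>))\<^sup>2 = (f (\<Psi> (X (int j) \<omega>)))\<^sup>2
        + 2 * (f (\<Psi> (X (int j) \<omega>)) * f (\<epsilon> (int j + 1) \<omega>)) + (f (\<epsilon> (int j + 1) \<omega>))\<^sup>2" for j
      unfolding \<omega>[rule_format, of "int j"] f.add power2_sum by simp
    then show ?thesis by (simp add: sum.distrib sum_distrib_left)
  qed
  moreover have "(\<Sum>j<n. (f (\<epsilon> (int j + 1) \<omega>))\<^sup>2) = (\<Sum>j=1..n. (f (\<epsilon> (int j) \<omega>))\<^sup>2)"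
    using sum.atLeast1_atMost_eq[of "\<lambda>j. (f (\<epsilon> (int j) \<omega>))\<^sup>2" n] by (simp add: add.commute)
  ultimately have sum_eq: "(\<Sum>j<n. (f (X (int j) \<omega>))\<^sup>2) = (\<Sum>j<n. (f (\<Psi> (X (int j) \<omega>)))\<^sup>2)
      + 2 * (\<Sum>j<n. f (\<Psi> (X (int j) \<omega>)) * f (\<epsilon> (int j + 1) \<omega>)) + (\<Sum>j=1..n. (f (\<epsilon> (int j) \<omega>))\<^sup>2)
      + ((f (X 0 \<omega>))\<^sup>2 - (f (X (int n) \<omega>))\<^sup>2)"
    by simp
  show ?thesis
    unfolding X_form_err_def eps_form_err_def variance_decomposition[OF f] sum_eq
    by (simp add: add_divide_distrib diff_divide_distrib)
qed

lemma cross_term_bound: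
  fixes f :: "'a \<Rightarrow> real"
  assumes f: "bounded_linear f"
  shows "\<bar>\<Sum>j<n. f (\<Psi> (X (int j) \<omega>)) * f (\<epsilon> (int j + 1) \<omega>)\<bar> \<le> (onorm f)\<^sup>2 * sqrt (noise_hs n \<omega>)"
proof -
  interpret f: bounded_linear f by fact
  let ?g = "\<lambda>x. f (\<Psi> x)"
  let ?w = "\<Sum>j<n. ?g (X (int j) \<omega>) *\<^sub>R \<epsilon> (int j + 1) \<omega>"
  have f0: "0 \<le> onorm f" by (rule onorm_pos_le[OF f])
  have "onorm ?g \<le> onorm f * onorm \<Psi>"
    by (rule onorm_comp_Psi[OF f])
  also have "\<dots> \<le> onorm f"
    using Psi(2) f0 by (simp add: mult_left_le)
  finally have g: "(onorm ?g)\<^sup>2 \<le> (onorm f)\<^sup>2"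
    by (intro power_mono onorm_pos_le bounded_linear_comp_Psi f)
  have "(norm ?w)\<^sup>2 \<le> (onorm ?g)\<^sup>2 * noise_hs n \<omega>"
    unfolding noise_hs_def by (intro hs_norm_sq_functional bounded_linear_comp_Psi f) simp
  also have "\<dots> \<le> (onorm f)\<^sup>2 * noise_hs n \<omega>"
    by (intro mult_right_mono g noise_hs_nonneg)
  also have "\<dots> = (onorm f * sqrt (noise_hs n \<omega>))\<^sup>2"
    by (simp add: power_mult_distrib noise_hs_nonneg)
  finally have "norm ?w \<le> onorm f * sqrt (noise_hs n \<omega>)"
    by (rule power2_le_imp_le) (simp add: f0 noise_hs_nonneg)
  moreover have "f ?w = (\<Sum>j<n. f (\<Psi> (X (int j) \<omega>)) * f (\<epsilon> (int j + 1) \<omega>))"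
    by (simp add: f.sum f.scaleR)
  ultimately show ?thesis
    using onorm[OF f, of ?w] mult_left_mono[of "norm ?w" _ "onorm f"] f0
    by (fastforce simp: power2_eq_square mult.assoc)
qed

text \<open>The fixed point of \<open>K \<mapsto> \<parallel>\<Psi>\<parallel>\<^sup>2 K + A\<close>, where \<open>A\<close> collects the error terms of the recursion and \<open>\<rho>\<close>
bounds the deviation for the innovations.\<close>

definition cov_err_bound :: "nat \<Rightarrow> real \<Rightarrow> 'w \<Rightarrow> real" where
  "cov_err_bound n \<rho> \<omega> = (\<rho> + 2 * (sqrt (noise_hs n \<omega>) / real n)
     + ((norm (X 0 \<omega>))\<^sup>2 + (norm (X (int n) \<omega>))\<^sup>2) / real n) / (1 - (onorm \<Psi>)\<^sup>2)"

text \<open>If the deviation is at most \<open>K \<parallel>f\<parallel>\<^sup>2\<close> for all functionals \<open>f\<close>, the recursion improves \<open>K\<close> to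
\<open>\<parallel>\<Psi>\<parallel>\<^sup>2 K + A\<close>. Starting from a crude bound and iterating gives the fixed point. Quantifying over all
functionals makes the class stable under \<open>f \<mapsto> f \<circ> \<Psi>\<close>.\<close>

lemma X_form_err_bound:
  fixes f :: "'a \<Rightarrow> real"
  assumes \<rho>: "\<And>f. bounded_linear f \<Longrightarrow> \<bar>eps_form_err n f \<omega>\<bar> \<le> \<rho> * (onorm f)\<^sup>2" and \<rho>0: "0 \<le> \<rho>"
    and \<omega>: "\<forall>t. X (t + 1) \<omega> = \<Psi> (X t \<omega>) + \<epsilon> (t + 1) \<omega>"
    and n: "n \<ge> 1" and f: "bounded_linear f"
  shows "\<bar>X_form_err n f \<omega>\<bar> \<le> cov_err_bound n \<rho> \<omega> * (onorm f)\<^sup>2"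
proof -
  define s where "s = (onorm \<Psi>)\<^sup>2"
  have s: "0 \<le> s" "s < 1"
    using onorm_Psi_nonneg Psi(2) by (simp_all add: s_def power_less_one_iff abs_less_iff)
  define A where "A = \<rho> + 2 * (sqrt (noise_hs n \<omega>) / real n)
     + ((norm (X 0 \<omega>))\<^sup>2 + (norm (X (int n) \<omega>))\<^sup>2) / real n"
  define K0 where "K0 = (1 / real n) * (\<Sum>j<n. (norm (X (int j) \<omega>))\<^sup>2) + X_var"
  have K0: "0 \<le> K0"
    unfolding K0_def using X_var_nonneg by (intro add_nonneg_nonneg mult_nonneg_nonneg sum_nonneg) auto
  define B where "B = A / (1 - s)"
  have A_eq: "A = B - s * B"
  proof -
    have "(1 - s) * B = A" using s by (simp add: B_def)
    then show ?thesis by (simp add: algebra_simps)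
  qed
  define K where "K i = B + s ^ i * (K0 - B)" for i :: nat
  have K_Suc: "K (Suc i) = s * K i + A" for i
    unfolding K_def A_eq by (simp add: algebra_simps)
  have K_nonneg: "0 \<le> K i" for i
  proof -
    have B: "0 \<le> B"
      unfolding B_def A_def using \<rho>0 s noise_hs_nonneg by (intro divide_nonneg_nonneg add_nonneg_nonneg) auto
    have "K i = (1 - s ^ i) * B + s ^ i * K0"
      by (simp add: K_def algebra_simps)
    moreover have "s ^ i \<le> 1" using s by (simp add: power_le_one)
    ultimately show ?thesis
      using B K0 s by simp
  qed
  have bound: "\<bar>X_form_err n g \<omega>\<bar> \<le> K i * (onorm g)\<^sup>2" if "bounded_linear g" for i g
    using that
  proof (induction i arbitrary: g)
    case 0
    have "(\<Sum>j<n. (g (X (int j) \<omega>))\<^sup>2) \<le> (onorm g)\<^sup>2 * (\<Sum>j<n. (norm (X (int j) \<omega>))\<^sup>2)"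
      unfolding sum_distrib_left by (intro sum_mono functional_sq_le 0)
    then have 1: "(1 / real n) * (\<Sum>j<n. (g (X (int j) \<omega>))\<^sup>2) \<le> (onorm g)\<^sup>2 * ((1 / real n) * (\<Sum>j<n. (norm (X (int j) \<omega>))\<^sup>2))"
      using n by (simp add: divide_right_mono)
    have "(\<integral>\<omega>. (g (X 0 \<omega>))\<^sup>2 \<partial>M) \<le> (\<integral>\<omega>. (onorm g)\<^sup>2 * (norm (X 0 \<omega>))\<^sup>2 \<partial>M)"
      by (rule integral_mono[OF functional_sq_integrable[OF 0 X_measurable X_square_integrable]
            integrable_mult_right[OF X_square_integrable] functional_sq_le[OF 0]])
    then have 2: "(\<integral>\<omega>. (g (X 0 \<omega>))\<^sup>2 \<partial>M) \<le> (onorm g)\<^sup>2 * X_var"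
      by (simp add: X_var)
    have "0 \<le> (1 / real n) * (\<Sum>j<n. (g (X (int j) \<omega>))\<^sup>2)" "0 \<le> (\<integral>\<omega>. (g (X 0 \<omega>))\<^sup>2 \<partial>M)"
      by (simp_all add: sum_nonneg)
    moreover have "K 0 * (onorm g)\<^sup>2 =
        (onorm g)\<^sup>2 * ((1 / real n) * (\<Sum>j<n. (norm (X (int j) \<omega>))\<^sup>2)) + (onorm g)\<^sup>2 * X_var"
      by (simp add: K_def K0_def algebra_simps)
    ultimately show ?case
      using 1 2 unfolding X_form_err_def by linarith
  next
    case (Suc i)
    let ?h = "\<lambda>x. g (\<Psi> x)"
    have h: "bounded_linear ?h" by (rule bounded_linear_comp_Psi[OF Suc.prems])
    have "(onorm ?h)\<^sup>2 \<le> (onorm g * onorm \<Psi>)\<^sup>2"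
      by (intro power_mono onorm_comp_Psi Suc.prems onorm_pos_le h)
    then have "\<bar>X_form_err n ?h \<omega>\<bar> \<le> K i * ((onorm g)\<^sup>2 * s)"
      unfolding s_def power_mult_distrib
      by (rule order_trans[OF Suc.IH[OF h] mult_left_mono[OF _ K_nonneg]])
    moreover have "\<bar>(1 / real n) * (\<Sum>j<n. g (\<Psi> (X (int j) \<omega>)) * g (\<epsilon> (int j + 1) \<omega>))\<bar> \<le> (onorm g)\<^sup>2 * sqrt (noise_hs n \<omega>) / real n"
      using cross_term_bound[OF Suc.prems, of \<omega> n] n by (simp add: abs_mult divide_right_mono)
    moreover have "\<bar>eps_form_err n g \<omega>\<bar> \<le> \<rho> * (onorm g)\<^sup>2"
      by (rule \<rho>[OF Suc.prems])
    moreover have "\<bar>((g (X 0 \<omega>))\<^sup>2 - (g (X (int n) \<omega>))\<^sup>2) / real n\<bar> \<le>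
        ((onorm g)\<^sup>2 * (norm (X 0 \<omega>))\<^sup>2 + (onorm g)\<^sup>2 * (norm (X (int n) \<omega>))\<^sup>2) / real n"
    proof -
      have "\<bar>(g (X 0 \<omega>))\<^sup>2 - (g (X (int n) \<omega>))\<^sup>2\<bar> \<le> (g (X 0 \<omega>))\<^sup>2 + (g (X (int n) \<omega>))\<^sup>2"
        by (simp add: abs_le_iff)
      also have "\<dots> \<le> (onorm g)\<^sup>2 * (norm (X 0 \<omega>))\<^sup>2 + (onorm g)\<^sup>2 * (norm (X (int n) \<omega>))\<^sup>2"
        by (intro add_mono functional_sq_le Suc.prems)
      finally show ?thesis by (simp add: divide_right_mono)
    qed
    ultimately have "\<bar>X_form_err n g \<omega>\<bar> \<le> K i * ((onorm g)\<^sup>2 * s) + 2 * ((onorm g)\<^sup>2 * sqrt (noise_hs n \<omega>) / real n)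
        + \<rho> * (onorm g)\<^sup>2 + ((onorm g)\<^sup>2 * (norm (X 0 \<omega>))\<^sup>2 + (onorm g)\<^sup>2 * (norm (X (int n) \<omega>))\<^sup>2) / real n"
      unfolding X_form_err_recursion[OF Suc.prems \<omega>, of n] by linarith
    also have "\<dots> = K (Suc i) * (onorm g)\<^sup>2"
      unfolding K_Suc A_def by (simp add: algebra_simps add_divide_distrib)
    finally show ?case .
  qed
  have "K \<longlonglongrightarrow> B + 0 * (K0 - B)"
    unfolding K_def using s by (intro tendsto_intros LIMSEQ_realpow_zero) auto
  then have "(\<lambda>i. K i * (onorm f)\<^sup>2) \<longlonglongrightarrow> B * (onorm f)\<^sup>2"
    by (intro tendsto_intros) simp
  then have "\<bar>X_form_err n f \<omega>\<bar> \<le> B * (onorm f)\<^sup>2"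
    by (rule LIMSEQ_le_const) (use bound[OF f] in blast)
  then show ?thesis
    by (simp add: cov_err_bound_def B_def A_def s_def)
qed

end

section \<open>Empirical eigenvalues, quantization and cell frequencies\<close>

lemma strict_decreasing_from_1:
  fixes lam :: "nat \<Rightarrow> real"
  assumes dec: "\<And>j. j \<ge> 1 \<Longrightarrow> lam (Suc j) < lam j" and ij: "1 \<le> i" "i < j"
  shows "lam j < lam i"
proof -
  have "Suc i \<le> j" using ij by simp
  then show ?thesis
  proof (induction j rule: dec_induct)
    case base show ?case using dec ij by simp
  next
    case (step j) then show ?case using dec[of j] ij by auto
  qed
qed

context far1_process
begin

lemma inner_X_integrable: "integrable M (\<lambda>\<omega>. inner (X 0 \<omega>) y * inner (X 0 \<omega>) z)"
proof -
  have *: "integrable M (\<lambda>\<omega>. (norm (inner (X 0 \<omega>) y))\<^sup>2)" for y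
    by (simp, rule functional_sq_integrable[OF bounded_linear_inner_left X_measurable X_square_integrable])
  have "integrable M (\<lambda>\<omega>. inner (inner (X 0 \<omega>) y) (inner (X 0 \<omega>) z))"
    by (rule integrable_inner_of_squares(2)[OF _ _ * *]) measurable
  then show ?thesis by simp
qed

lemma inner_covariance_op:
  "inner (covariance_op M (X 0) y) z = (\<integral>\<omega>. inner (X 0 \<omega>) y * inner (X 0 \<omega>) z \<partial>M)"
proof -
  have "integrable M (\<lambda>\<omega>. norm y * (norm (X 0 \<omega>))\<^sup>2)"
    by (rule integrable_mult_right[OF X_square_integrable])
  then have "integrable M (\<lambda>\<omega>. inner (X 0 \<omega>) y *\<^sub>R X 0 \<omega>)"
  proof (rule Bochner_Integration.integrable_bound)
    show "AE \<omega> in M. norm (inner (X 0 \<omega>) y *\<^sub>R X 0 \<omega>) \<le> norm (norm y * (norm (X 0 \<omega>))\<^sup>2)"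
    proof (rule AE_I2)
      fix \<omega>
      show "norm (inner (X 0 \<omega>) y *\<^sub>R X 0 \<omega>) \<le> norm (norm y * (norm (X 0 \<omega>))\<^sup>2)"
        using mult_right_mono[OF Cauchy_Schwarz_ineq2[of "X 0 \<omega>" y], of "norm (X 0 \<omega>)"]
        by (simp add: power2_eq_square ac_simps)
    qed
  qed simp
  then have "inner (\<integral>\<omega>. inner (X 0 \<omega>) y *\<^sub>R X 0 \<omega> \<partial>M) z = (\<integral>\<omega>. inner (inner (X 0 \<omega>) y *\<^sub>R X 0 \<omega>) z \<partial>M)"
    by (simp only: integral_inner_left)
  then show ?thesis
    by (simp add: covariance_op_def tensor_op_def)
qed

text \<open>Normalized eigenvectors for distinct eigenvalues of a symmetric operator are orthonormal.\<close>

lemma covariance_eigenvectors: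
  assumes eig: "lam ` {1..} \<subseteq> eigenvalues (covariance_op M (X 0))"
    and dec: "\<And>j. j \<ge> 1 \<Longrightarrow> lam (Suc j) < lam j"
  obtains w where "\<And>i. i \<ge> 1 \<Longrightarrow> covariance_op M (X 0) (w i) = lam i *\<^sub>R w i"
    "\<And>i j. i \<ge> 1 \<Longrightarrow> j \<ge> 1 \<Longrightarrow> inner (w i) (w j) = (if i = j then 1 else 0)"
proof -
  let ?G = "covariance_op M (X 0)"
  have "\<exists>x. norm x = 1 \<and> ?G x = lam i *\<^sub>R x" if i: "i \<ge> 1" for i
  proof -
    obtain x where x: "x \<noteq> 0" "?G x = lam i *\<^sub>R x"
      using eig i unfolding eigenvalues_def by fastforce
    have "?G (sgn x) = (1 / norm x) *\<^sub>R ?G x"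
      unfolding covariance_op_def tensor_op_def sgn_div_norm
      by (simp add: inverse_eq_divide flip: integral_scaleR_right)
    then show ?thesis
      using x by (intro exI[of _ "sgn x"]) (simp add: norm_sgn sgn_div_norm inverse_eq_divide)
  qed
  then obtain w where w: "\<And>i. i \<ge> 1 \<Longrightarrow> norm (w i) = 1" "\<And>i. i \<ge> 1 \<Longrightarrow> ?G (w i) = lam i *\<^sub>R w i"
    by metis
  have "inner (w i) (w j) = 0" if ij: "i \<ge> 1" "j \<ge> 1" "i \<noteq> j" for i j
  proof -
    have "inner (?G (w i)) (w j) = inner (?G (w j)) (w i)"
      by (simp add: inner_covariance_op mult.commute)
    then have "lam i * inner (w i) (w j) = lam j * inner (w i) (w j)"
      using w(2)[OF ij(1)] w(2)[OF ij(2)] by (simp add: inner_commute)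
    moreover have "lam i \<noteq> lam j"
      using strict_decreasing_from_1[of lam i j] strict_decreasing_from_1[of lam j i] dec ij
      by (metis linorder_neqE_nat order_less_irrefl)
    ultimately show ?thesis by simp
  qed
  then have "inner (w i) (w j) = (if i = j then 1 else 0)" if "i \<ge> 1" "j \<ge> 1" for i j
    using that w(1) by (auto simp: norm_eq_1)
  with w(2) show ?thesis using that by blast
qed

text \<open>On the span of the first \<open>k\<close> eigenvectors the covariance form is diagonal with entries at least
\<open>lam k\<close>.\<close>

lemma second_moment_lower_bound:
  assumes w: "\<And>i. i \<ge> 1 \<Longrightarrow> covariance_op M (X 0) (w i) = lam i *\<^sub>R w i"
      "\<And>i j. i \<ge> 1 \<Longrightarrow> j \<ge> 1 \<Longrightarrow> inner (w i) (w j) = (if i = j then 1 else 0)"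
    and dec: "\<And>j. j \<ge> 1 \<Longrightarrow> lam (Suc j) < lam j" and y: "y \<in> span (w ` {1..k})"
  shows "lam k * (norm y)\<^sup>2 \<le> (\<integral>\<omega>. (inner (X 0 \<omega>) y)\<^sup>2 \<partial>M)"
proof -
  let ?W = "w ` {1..k}"
  have W: "orthonormal_set ?W" "inj_on w {1..k}"
    using w(2) by (auto intro!: orthonormal_set_imageI)
  have form_w: "(\<integral>\<omega>. inner (X 0 \<omega>) (w i) * inner (X 0 \<omega>) y \<partial>M) = lam i * inner (w i) y" if "i \<ge> 1" for i
    using inner_covariance_op[of "w i" y] w(1)[OF that] by simp
  have y_eq: "y = (\<Sum>i=1..k. inner (w i) y *\<^sub>R w i)"
    using proj_span[OF W(1) y] sum.reindex[OF W(2), of "\<lambda>c. inner c y *\<^sub>R c"] by (simp only: proj_def o_def)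
  have "(\<integral>\<omega>. (inner (X 0 \<omega>) y)\<^sup>2 \<partial>M) = (\<integral>\<omega>. (\<Sum>i=1..k. inner (w i) y * (inner (X 0 \<omega>) (w i) * inner (X 0 \<omega>) y)) \<partial>M)"
  proof -
    have "(inner (X 0 \<omega>) y)\<^sup>2 = (\<Sum>i=1..k. inner (w i) y * (inner (X 0 \<omega>) (w i) * inner (X 0 \<omega>) y))" for \<omega>
    proof -
      have "inner (X 0 \<omega>) y = (\<Sum>i=1..k. inner (w i) y * inner (X 0 \<omega>) (w i))"
        by (subst y_eq) (simp add: inner_sum_right)
      then show ?thesis
        by (simp add: power2_eq_square sum_distrib_right mult.assoc)
    qed
    then show ?thesis by simp
  qed
  also have "\<dots> = (\<Sum>i=1..k. inner (w i) y * (\<integral>\<omega>. inner (X 0 \<omega>) (w i) * inner (X 0 \<omega>) y \<partial>M))"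
    using inner_X_integrable by simp
  also have "\<dots> = (\<Sum>i=1..k. lam i * (inner (w i) y)\<^sup>2)"
    by (intro sum.cong refl) (simp add: form_w power2_eq_square)
  also have "\<dots> \<ge> (\<Sum>i=1..k. lam k * (inner (w i) y)\<^sup>2)"
    using strict_decreasing_from_1[of lam _ k, OF dec] 
    by (intro sum_mono mult_right_mono) (auto simp: le_less)
  also have "(\<Sum>i=1..k. lam k * (inner (w i) y)\<^sup>2) = lam k * (norm y)\<^sup>2"
  proof -
    have "(norm y)\<^sup>2 = (\<Sum>c\<in>?W. (inner c y)\<^sup>2)"
      using norm_proj[OF W(1), of y] proj_span[OF W(1) y] by simp
    also have "\<dots> = (\<Sum>i=1..k. (inner (w i) y)\<^sup>2)"
      using sum.reindex[OF W(2), of "\<lambda>c. (inner c y)\<^sup>2"] by (simp only: o_def)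
    finally show ?thesis by (simp add: sum_distrib_left)
  qed
  finally show ?thesis .
qed

lemma cov_err_bound_nonneg:
  assumes "0 \<le> \<rho>"
  shows "0 \<le> cov_err_bound n \<rho> \<omega>"
proof -
  have "(onorm \<Psi>)\<^sup>2 < 1"
    using onorm_Psi_nonneg Psi(2) by (simp add: power_less_one_iff abs_less_iff)
  then show ?thesis
    unfolding cov_err_bound_def using assms noise_hs_nonneg
    by (intro divide_nonneg_nonneg add_nonneg_nonneg) auto
qed

lemma empirical_eigenvalue_lower_bound:
  assumes sys: "ordered_eigensystem (emp_cov n (\<lambda>t. X t \<omega>)) \<mu> v" and n: "n \<ge> 1" and k: "k \<ge> 1"
    and W: "orthonormal_set W" "card W = k"
    and l: "\<And>y. y \<in> span W \<Longrightarrow> l * (norm y)\<^sup>2 \<le> (\<integral>\<omega>. (inner (X 0 \<omega>) y)\<^sup>2 \<partial>M)"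
    and \<rho>: "\<And>f. bounded_linear f \<Longrightarrow> \<bar>eps_form_err n f \<omega>\<bar> \<le> \<rho> * (onorm f)\<^sup>2" "0 \<le> \<rho>"
    and \<omega>: "\<forall>t. X (t + 1) \<omega> = \<Psi> (X t \<omega>) + \<epsilon> (t + 1) \<omega>"
  shows "l - cov_err_bound n \<rho> \<omega> \<le> \<mu> k"
proof -
  interpret empirical_eigensystem n "\<lambda>t. X t \<omega>" \<mu> v
    by unfold_locales (fact n sys)+
  show ?thesis
  proof (rule min_max_lower_bound[OF W k])
    fix y assume y: "y \<in> span W"
    let ?f = "\<lambda>x. inner x y"
    have f: "bounded_linear ?f" by (rule bounded_linear_inner_left)
    have "onorm ?f \<le> norm y"
      by (rule onorm_bound) (simp_all add: Cauchy_Schwarz_ineq2 mult.commute)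
    then have "(onorm ?f)\<^sup>2 \<le> (norm y)\<^sup>2"
      by (intro power_mono onorm_pos_le f)
    then have "cov_err_bound n \<rho> \<omega> * (onorm ?f)\<^sup>2 \<le> cov_err_bound n \<rho> \<omega> * (norm y)\<^sup>2"
      by (intro mult_left_mono cov_err_bound_nonneg \<rho>)
    moreover have "\<bar>X_form_err n ?f \<omega>\<bar> \<le> cov_err_bound n \<rho> \<omega> * (onorm ?f)\<^sup>2"
      by (rule X_form_err_bound[OF \<rho> \<omega> n f])
    moreover have "emp_form n (\<lambda>t. X t \<omega>) y y = X_form_err n ?f \<omega> + (\<integral>\<omega>. (inner (X 0 \<omega>) y)\<^sup>2 \<partial>M)"
      by (simp add: emp_form_def X_form_err_def power2_eq_square)
    ultimately show "(l - cov_err_bound n \<rho> \<omega>) * (norm y)\<^sup>2 \<le> emp_form n (\<lambda>t. X t \<omega>) y y"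
      using l[OF y] by (simp add: left_diff_distrib)
  qed
qed

abbreviation "F \<equiv> distr M borel (\<epsilon> 0)"

lemma prob_F: "prob_space F"
  by (rule prob_space_distr) simp

text \<open>Approximate the identity pointwise by simple functions that grow at most linearly, and use dominated
convergence.\<close>

lemma quantizer_exists:
  assumes "\<delta> > 0"
  obtains q K where "simple_function F q" "\<And>y. norm (q y) \<le> K" "q \<in> borel_measurable borel"
    "integrable M (\<lambda>\<omega>. (norm (q (\<epsilon> 0 \<omega>) - \<epsilon> 0 \<omega>))\<^sup>2)"
    "(\<integral>\<omega>. (norm (q (\<epsilon> 0 \<omega>) - \<epsilon> 0 \<omega>))\<^sup>2 \<partial>M) < \<delta>"
proof -
  have "(\<lambda>x. x) \<in> borel_measurable F" by simp
  from borel_measurable_implies_sequence_metric[OF this, of 0]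
  obtain Q where Q: "\<And>i. simple_function F (Q i)" "\<And>y. (\<lambda>i. Q i y) \<longlonglongrightarrow> y"
      "\<And>i y. norm (Q i y) \<le> 2 * norm y"
    by (auto simp: dist_norm)
  have meas[measurable]: "Q i \<in> borel_measurable borel" for i
    using borel_measurable_simple_function[OF Q(1), of i] by simp
  have bound: "norm ((norm (Q i y - y))\<^sup>2) \<le> 9 * (norm y)\<^sup>2" for i y
  proof -
    have "norm (Q i y - y) \<le> 3 * norm y"
      using norm_triangle_ineq4[of "Q i y" y] Q(3)[of i y] by linarith
    then have "(norm (Q i y - y))\<^sup>2 \<le> (3 * norm y)\<^sup>2" by (intro power_mono) auto
    then show ?thesis by (simp add: power_mult_distrib)
  qed
  have int: "integrable M (\<lambda>\<omega>. (norm (Q i (\<epsilon> 0 \<omega>) - \<epsilon> 0 \<omega>))\<^sup>2)" for i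
    by (rule Bochner_Integration.integrable_bound[OF integrable_mult_right[OF eps_square_integrable, of 9 0]])
       (use bound in auto)
  have "(\<lambda>i. \<integral>\<omega>. (norm (Q i (\<epsilon> 0 \<omega>) - \<epsilon> 0 \<omega>))\<^sup>2 \<partial>M) \<longlonglongrightarrow> (\<integral>\<omega>. 0 \<partial>M)"
  proof (rule integral_dominated_convergence[where w="\<lambda>\<omega>. 9 * (norm (\<epsilon> 0 \<omega>))\<^sup>2"])
    show "integrable M (\<lambda>\<omega>. 9 * (norm (\<epsilon> 0 \<omega>))\<^sup>2)"
      by (intro integrable_mult_right eps_square_integrable)
    show "AE \<omega> in M. (\<lambda>i. (norm (Q i (\<epsilon> 0 \<omega>) - \<epsilon> 0 \<omega>))\<^sup>2) \<longlonglongrightarrow> 0"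
    proof (rule AE_I2)
      fix \<omega>
      have "(\<lambda>i. (norm (Q i (\<epsilon> 0 \<omega>) - \<epsilon> 0 \<omega>))\<^sup>2) \<longlonglongrightarrow> (norm (\<epsilon> 0 \<omega> - \<epsilon> 0 \<omega>))\<^sup>2"
        by (intro tendsto_intros Q)
      then show "(\<lambda>i. (norm (Q i (\<epsilon> 0 \<omega>) - \<epsilon> 0 \<omega>))\<^sup>2) \<longlonglongrightarrow> 0" by simp
    qed
  qed (use bound in auto)
  then have "\<forall>\<^sub>F i in sequentially. (\<integral>\<omega>. (norm (Q i (\<epsilon> 0 \<omega>) - \<epsilon> 0 \<omega>))\<^sup>2 \<partial>M) < \<delta>"
    using assms by (intro order_tendstoD(2)) auto
  then obtain i where i: "(\<integral>\<omega>. (norm (Q i (\<epsilon> 0 \<omega>) - \<epsilon> 0 \<omega>))\<^sup>2 \<partial>M) < \<delta>"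
    by (auto simp: eventually_sequentially)
  have "finite (range (Q i))"
    using simple_functionD(1)[OF Q(1), of i] by simp
  then obtain K where "\<And>y. norm (Q i y) \<le> K"
    using finite_imp_bounded[of "range (Q i)"] unfolding bounded_iff by auto
  then show ?thesis
    using that Q(1) int i meas by blast
qed

text \<open>The variance of the frequency is at most \<open>1/n\<close>; the inequality between arithmetic and geometric mean
turns this into a bound for the mean absolute error.\<close>

lemma E_cell_freq_err:
  fixes q :: "'a \<Rightarrow> 'a"
  assumes q: "simple_function F q" "q \<in> borel_measurable borel" and n: "n \<ge> 1"
  shows "integrable M (\<lambda>\<omega>. \<bar>cell_freq n (\<lambda>j. \<epsilon> (int j) \<omega>) q a - measure F (q -` {a})\<bar>)"
    and "(\<integral>\<omega>. \<bar>cell_freq n (\<lambda>j. \<epsilon> (int j) \<omega>) q a - measure F (q -` {a})\<bar> \<partial>M) \<le> 1 / sqrt (real n)"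
proof -
  define f :: "'a \<Rightarrow> real" where "f = indicator (q -` {a})"
  have A[measurable]: "q -` {a} \<in> sets borel"
    using measurable_sets[OF q(2), of "{a}"] by simp
  have [measurable]: "f \<in> borel_measurable borel" by (simp add: f_def)
  have f01: "(f x)\<^sup>2 = f x" "0 \<le> f x" "f x \<le> 1" for x by (auto simp: f_def indicator_def)
  have f_int: "integrable M (\<lambda>\<omega>. f (\<epsilon> 0 \<omega>))"
    using f01 by (intro integrable_const_bound[of _ 1]) auto
  have Ef: "(\<integral>\<omega>. f (\<epsilon> 0 \<omega>) \<partial>M) = measure F (q -` {a})"
  proof -
    have "(\<integral>\<omega>. f (\<epsilon> 0 \<omega>) \<partial>M) = (\<integral>x. f x \<partial>F)"
      by (subst integral_distr) auto
    then show ?thesis by (simp add: f_def)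
  qed
  define err where "err \<omega> = (1 / real n) * (\<Sum>j=1..n. f (\<epsilon> (int j) \<omega>)) - (\<integral>\<omega>. f (\<epsilon> 0 \<omega>) \<partial>M)" for \<omega>
  have err: "cell_freq n (\<lambda>j. \<epsilon> (int j) \<omega>) q a - measure F (q -` {a}) = err \<omega>" for \<omega>
  proof -
    have "f x = (if q x = a then 1 else 0)" for x by (simp add: f_def indicator_def)
    then show ?thesis unfolding err_def Ef by (simp add: cell_freq_def)
  qed
  have [measurable]: "err \<in> borel_measurable M"
    unfolding err_def[abs_def] by measurable
  have sq: "integrable M (\<lambda>\<omega>. (f (\<epsilon> 0 \<omega>))\<^sup>2)"
    using f_int by (simp add: f01)
  have E: "integrable M (\<lambda>\<omega>. (err \<omega>)\<^sup>2)" "(\<integral>\<omega>. (err \<omega>)\<^sup>2 \<partial>M) \<le> (\<integral>\<omega>. (f (\<epsilon> 0 \<omega>))\<^sup>2 \<partial>M) / real n"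
    unfolding err_def by (rule E_empirical_mean_error[OF _ n sq], measurable)+
  have int: "integrable M err"
    by (rule integrable_of_square) (measurable, simp add: E)
  then show "integrable M (\<lambda>\<omega>. \<bar>cell_freq n (\<lambda>j. \<epsilon> (int j) \<omega>) q a - measure F (q -` {a})\<bar>)"
    unfolding err by simp
  have "(\<integral>\<omega>. (f (\<epsilon> 0 \<omega>))\<^sup>2 \<partial>M) \<le> (\<integral>\<omega>. 1 \<partial>M)"
    using sq f01 by (intro integral_mono) auto
  then have E2: "(\<integral>\<omega>. (err \<omega>)\<^sup>2 \<partial>M) \<le> 1 / real n"
    using E(2) n by (simp add: prob_space divide_right_mono order_trans)
  define s where "s = sqrt (real n)"
  have s: "s > 0" "real n = s * s" using n by (auto simp: s_def)
  have "\<bar>err \<omega>\<bar> \<le> (s * (err \<omega>)\<^sup>2 + 1 / s) / 2" for \<omega>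
  proof -
    have "0 \<le> (s * \<bar>err \<omega>\<bar> - 1)\<^sup>2" by simp
    then have "2 * (s * \<bar>err \<omega>\<bar>) \<le> s\<^sup>2 * (err \<omega>)\<^sup>2 + 1"
      by (simp add: power2_diff power_mult_distrib)
    then have "s * (2 * \<bar>err \<omega>\<bar>) \<le> s * (s * (err \<omega>)\<^sup>2 + 1 / s)"
      using s(1) by (simp add: power2_eq_square[of s] distrib_left mult.assoc)
    then show ?thesis using s(1) by simp
  qed
  then have "(\<integral>\<omega>. \<bar>err \<omega>\<bar> \<partial>M) \<le> (\<integral>\<omega>. (s * (err \<omega>)\<^sup>2 + 1 / s) / 2 \<partial>M)"
    using int E(1) by (intro integral_mono) auto
  also have "\<dots> = (s * (\<integral>\<omega>. (err \<omega>)\<^sup>2 \<partial>M) + 1 / s) / 2"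
    using E(1) by (simp add: prob_space)
  also have "\<dots> \<le> (s * (1 / real n) + 1 / s) / 2"
    using E2 s by (intro divide_right_mono add_right_mono mult_left_mono) auto
  also have "\<dots> = 1 / s" using s by (simp add: field_simps)
  finally show "(\<integral>\<omega>. \<bar>cell_freq n (\<lambda>j. \<epsilon> (int j) \<omega>) q a - measure F (q -` {a})\<bar> \<partial>M) \<le> 1 / sqrt (real n)"
    unfolding err s_def .
qed

end

section \<open>Expected loss\<close>

context far1_process
begin

definition pca_loss :: "'a set \<Rightarrow> nat \<Rightarrow> 'w \<Rightarrow> real" where
  "pca_loss C n \<omega> = (1 / real n) * (\<Sum>j<n. (norm (X (int j) \<omega> - proj C (X (int j) \<omega>)))\<^sup>2)"

definition eps_mean_sq :: "nat \<Rightarrow> 'w \<Rightarrow> real" where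
  "eps_mean_sq n \<omega> = (norm ((1 / real n) *\<^sub>R (\<Sum>j=1..n. \<epsilon> (int j) \<omega>)))\<^sup>2"

definition quant_loss :: "('a \<Rightarrow> 'a) \<Rightarrow> nat \<Rightarrow> 'w \<Rightarrow> real" where
  "quant_loss q n \<omega> = (1 / real n) * (\<Sum>j=1..n. (norm (q (\<epsilon> (int j) \<omega>) - \<epsilon> (int j) \<omega>))\<^sup>2)"

definition freq_loss :: "('a \<Rightarrow> 'a) \<Rightarrow> nat \<Rightarrow> 'w \<Rightarrow> real" where
  "freq_loss q n \<omega> = (\<Sum>a\<in>range q. \<bar>cell_freq n (\<lambda>j. \<epsilon> (int j) \<omega>) q a - measure F (q -` {a})\<bar>)"

text \<open>The constants come from the squared triangle inequality: the coupling contributes a factor 3,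
separating the quantization error a factor 2, and \<open>mean_sq_residual_error\<close> the factors 4, 4 and 2,
where \<open>1/\<mu>\<^sub>k\<close> is replaced by \<open>2/l\<close>.\<close>

definition total_loss :: "'a set \<Rightarrow> ('a \<Rightarrow> 'a) \<Rightarrow> real \<Rightarrow> real \<Rightarrow> real \<Rightarrow> nat \<Rightarrow> 'w \<Rightarrow> real" where
  "total_loss C q K D l n \<omega> = 24 * pca_loss C n \<omega> + 48 / l * (noise_hs n \<omega> / (real n)\<^sup>2)
     + 12 * eps_mean_sq n \<omega> + 6 * quant_loss q n \<omega> + 12 * K\<^sup>2 * freq_loss q n \<omega> + 3 * D"

lemma mallows_dist_le_total_loss:
  assumes sys: "ordered_eigensystem (emp_cov n (\<lambda>t. X t \<omega>)) \<mu> v" and n: "n \<ge> 1" and k: "k \<ge> 1"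
    and l: "0 < l" "l / 2 \<le> \<mu> k"
    and C: "orthonormal_set C" "card C \<le> k"
    and q: "simple_function F q" "\<And>y. norm (q y) \<le> K" "q \<in> borel_measurable borel"
    and D: "integrable M (\<lambda>\<omega>. (norm (q (\<epsilon> 0 \<omega>) - \<epsilon> 0 \<omega>))\<^sup>2)"
      "(\<integral>\<omega>. (norm (q (\<epsilon> 0 \<omega>) - \<epsilon> 0 \<omega>))\<^sup>2 \<partial>M) \<le> D"
    and \<omega>: "\<forall>t. X (t + 1) \<omega> = \<Psi> (X t \<omega>) + \<epsilon> (t + 1) \<omega>"
  shows "(mallows_dist (empirical_distribution n (centered_residual n k \<mu> v (\<lambda>t. X t \<omega>))) F)\<^sup>2
    \<le> total_loss C q K D l n \<omega>"
proof -
  have contraction: "onorm \<Psi> < 1" by (rule Psi(2))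
  interpret empirical_ar n "\<lambda>t. X t \<omega>" \<mu> v "\<lambda>t. \<epsilon> t \<omega>" \<Psi>
    by (intro empirical_ar.intro empirical_eigensystem.intro empirical_ar_axioms.intro n sys Psi(1))
       (use \<omega> in blast)
  note [measurable] = q(3)
  let ?z = "centered_residual n k \<mu> v (\<lambda>t. X t \<omega>)"
  let ?e = "\<lambda>j::nat. \<epsilon> (int j) \<omega>"
  have \<mu>k: "0 < \<mu> k" using l by linarith
  have D0: "0 \<le> D"
    using D(2) by (rule order_trans[rotated]) simp
  have "(\<integral>\<^sup>+ y. ennreal ((norm (q y - y))\<^sup>2) \<partial>F) = (\<integral>\<^sup>+ \<omega>. ennreal ((norm (q (\<epsilon> 0 \<omega>) - \<epsilon> 0 \<omega>))\<^sup>2) \<partial>M)"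
    by (subst nn_integral_distr) auto
  also have "\<dots> = ennreal (\<integral>\<omega>. (norm (q (\<epsilon> 0 \<omega>) - \<epsilon> 0 \<omega>))\<^sup>2 \<partial>M)"
    by (rule nn_integral_eq_integral[OF D(1)]) simp
  also have "\<dots> \<le> ennreal D" by (rule ennreal_leI[OF D(2)])
  finally have "(mallows_dist (empirical_distribution n ?z) F)\<^sup>2 \<le>
      3 * ((1 / real n) * (\<Sum>j=1..n. (norm (?z j - q (?e j)))\<^sup>2)) + 12 * K\<^sup>2 * freq_loss q n \<omega> + 3 * D"
    unfolding freq_loss_def
    by (intro mallows_dist_empirical_le prob_F q n D0) auto
  moreover have "(1 / real n) * (\<Sum>j=1..n. (norm (?z j - q (?e j)))\<^sup>2) \<le>
      2 * ((1 / real n) * (\<Sum>j=1..n. (norm (?z j - ?e j))\<^sup>2)) + 2 * quant_loss q n \<omega>"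
  proof -
    have "(norm (?z j - q (?e j)))\<^sup>2 \<le> 2 * (norm (?z j - ?e j))\<^sup>2 + 2 * (norm (q (?e j) - ?e j))\<^sup>2" for j
      using norm_diff_sq_le[of "?z j - ?e j" "q (?e j) - ?e j"] by simp
    then have "(1 / real n) * (\<Sum>j=1..n. (norm (?z j - q (?e j)))\<^sup>2) \<le>
        (1 / real n) * (\<Sum>j=1..n. 2 * (norm (?z j - ?e j))\<^sup>2 + 2 * (norm (q (?e j) - ?e j))\<^sup>2)"
      by (intro mult_left_mono sum_mono) auto
    also have "\<dots> = 2 * ((1 / real n) * (\<Sum>j=1..n. (norm (?z j - ?e j))\<^sup>2)) + 2 * quant_loss q n \<omega>"
      by (simp add: quant_loss_def sum.distrib sum_distrib_left[symmetric] add_divide_distrib)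
    finally show ?thesis .
  qed
  moreover have "(1 / real n) * (\<Sum>j=1..n. (norm (?z j - ?e j))\<^sup>2) \<le>
      4 * pca_loss C n \<omega> + 8 / l * (noise_hs n \<omega> / (real n)\<^sup>2) + 2 * eps_mean_sq n \<omega>"
  proof -
    have "(onorm \<Psi>)\<^sup>2 \<le> 1"
      using onorm_Psi_nonneg contraction by (simp add: power_le_one)
    then have "4 * (onorm \<Psi>)\<^sup>2 * pca_loss C n \<omega> \<le> 4 * 1 * pca_loss C n \<omega>"
      by (intro mult_right_mono mult_left_mono) (auto simp: pca_loss_def sum_nonneg)
    moreover have "4 / \<mu> k * (noise_hs n \<omega> / (real n)\<^sup>2) \<le> 8 / l * (noise_hs n \<omega> / (real n)\<^sup>2)"
      using l \<mu>k by (intro mult_right_mono divide_nonneg_nonneg noise_hs_nonneg) (simp_all add: field_simps)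
    ultimately show ?thesis
      using mean_sq_residual_error[OF \<mu>k k C]
      unfolding pca_loss_def noise_hs_def eps_mean_sq_def by linarith
  qed
  ultimately show ?thesis
    unfolding total_loss_def by linarith
qed

lemma E_pca_loss:
  assumes C: "orthonormal_set C" and n: "n \<ge> 1"
  shows "integrable M (pca_loss C n)"
    "(\<integral>\<omega>. pca_loss C n \<omega> \<partial>M) = (\<integral>\<omega>. (norm (X 0 \<omega> - proj C (X 0 \<omega>)))\<^sup>2 \<partial>M)"
proof -
  have [measurable]: "proj C \<in> borel_measurable borel"
    unfolding proj_def[abs_def] by measurable
  have int: "integrable M (\<lambda>\<omega>. (norm (X t \<omega> - proj C (X t \<omega>)))\<^sup>2)" for t
    by (rule Bochner_Integration.integrable_bound[OF X_square_integrable[of t]])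
       (auto intro!: power_mono norm_diff_proj_le[OF C])
  have E: "(\<integral>\<omega>. (norm (X (int j) \<omega> - proj C (X (int j) \<omega>)))\<^sup>2 \<partial>M) = (\<integral>\<omega>. (norm (X 0 \<omega> - proj C (X 0 \<omega>)))\<^sup>2 \<partial>M)" for j
    by (rule transfer_X(2)[of "\<lambda>x. (norm (x - proj C x))\<^sup>2"]) simp
  show "integrable M (pca_loss C n)"
    unfolding pca_loss_def[abs_def]
    by (intro integrable_mult_right Bochner_Integration.integrable_sum int)
  show "(\<integral>\<omega>. pca_loss C n \<omega> \<partial>M) = (\<integral>\<omega>. (norm (X 0 \<omega> - proj C (X 0 \<omega>)))\<^sup>2 \<partial>M)"
  proof -
    have "(\<integral>\<omega>. pca_loss C n \<omega> \<partial>M) =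
        (1 / real n) * (\<Sum>j<n. \<integral>\<omega>. (norm (X (int j) \<omega> - proj C (X (int j) \<omega>)))\<^sup>2 \<partial>M)"
      unfolding pca_loss_def using int by simp
    then show ?thesis
      unfolding E using n by simp
  qed
qed

lemma E_quant_loss:
  assumes q[measurable]: "q \<in> borel_measurable borel" and n: "n \<ge> 1"
    and D: "integrable M (\<lambda>\<omega>. (norm (q (\<epsilon> 0 \<omega>) - \<epsilon> 0 \<omega>))\<^sup>2)"
  shows "integrable M (quant_loss q n)"
    "(\<integral>\<omega>. quant_loss q n \<omega> \<partial>M) = (\<integral>\<omega>. (norm (q (\<epsilon> 0 \<omega>) - \<epsilon> 0 \<omega>))\<^sup>2 \<partial>M)"
proof -
  have int: "integrable M (\<lambda>\<omega>. (norm (q (\<epsilon> t \<omega>) - \<epsilon> t \<omega>))\<^sup>2)" for t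
    using D transfer_eps(1)[of "\<lambda>x. (norm (q x - x))\<^sup>2" t] by simp
  have E: "(\<integral>\<omega>. (norm (q (\<epsilon> (int j) \<omega>) - \<epsilon> (int j) \<omega>))\<^sup>2 \<partial>M) = (\<integral>\<omega>. (norm (q (\<epsilon> 0 \<omega>) - \<epsilon> 0 \<omega>))\<^sup>2 \<partial>M)" for j
    by (rule transfer_eps(2)[of "\<lambda>x. (norm (q x - x))\<^sup>2"]) simp
  show "integrable M (quant_loss q n)"
    unfolding quant_loss_def[abs_def]
    by (intro integrable_mult_right Bochner_Integration.integrable_sum int)
  show "(\<integral>\<omega>. quant_loss q n \<omega> \<partial>M) = (\<integral>\<omega>. (norm (q (\<epsilon> 0 \<omega>) - \<epsilon> 0 \<omega>))\<^sup>2 \<partial>M)"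
  proof -
    have "(\<integral>\<omega>. quant_loss q n \<omega> \<partial>M) =
        (1 / real n) * (\<Sum>j=1..n. \<integral>\<omega>. (norm (q (\<epsilon> (int j) \<omega>) - \<epsilon> (int j) \<omega>))\<^sup>2 \<partial>M)"
      unfolding quant_loss_def using int by simp
    then show ?thesis
      unfolding E using n by simp
  qed
qed

lemma E_total_loss:
  assumes C: "orthonormal_set C" and n: "n \<ge> 1" and l: "0 < l"
    and q: "simple_function F q" "q \<in> borel_measurable borel"
    and D: "integrable M (\<lambda>\<omega>. (norm (q (\<epsilon> 0 \<omega>) - \<epsilon> 0 \<omega>))\<^sup>2)"
      "(\<integral>\<omega>. (norm (q (\<epsilon> 0 \<omega>) - \<epsilon> 0 \<omega>))\<^sup>2 \<partial>M) \<le> D"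
  shows "integrable M (total_loss C q K D l n)"
    "(\<integral>\<omega>. total_loss C q K D l n \<omega> \<partial>M) \<le>
      24 * (\<integral>\<omega>. (norm (X 0 \<omega> - proj C (X 0 \<omega>)))\<^sup>2 \<partial>M) + 9 * D
      + 48 * (X_var * eps_var) * (1 / (real n * l)) + 12 * eps_var * (1 / real n)
      + 12 * K\<^sup>2 * real (card (range q)) * (1 / sqrt (real n))"
proof -
  have int_e: "integrable M (eps_mean_sq n)" and E_e: "(\<integral>\<omega>. eps_mean_sq n \<omega> \<partial>M) = eps_var / real n"
    using E_mean_sq[of "\<lambda>x. x", OF _ n] eps_square_integrable[of 0] eps_mean(2)[of 0]
    unfolding eps_mean_sq_def eps_var_def by simp_all
  have int_f: "integrable M (freq_loss q n)"
    unfolding freq_loss_def[abs_def]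
    by (intro Bochner_Integration.integrable_sum E_cell_freq_err q n)
  have E_f: "(\<integral>\<omega>. freq_loss q n \<omega> \<partial>M) \<le> real (card (range q)) * (1 / sqrt (real n))"
  proof -
    have "(\<integral>\<omega>. freq_loss q n \<omega> \<partial>M) = (\<Sum>a\<in>range q. \<integral>\<omega>. \<bar>cell_freq n (\<lambda>j. \<epsilon> (int j) \<omega>) q a - measure F (q -` {a})\<bar> \<partial>M)"
      unfolding freq_loss_def by (intro Bochner_Integration.integral_sum E_cell_freq_err q n)
    also have "\<dots> \<le> (\<Sum>a\<in>range q. 1 / sqrt (real n))"
      by (intro sum_mono E_cell_freq_err q n)
    finally show ?thesis by simp
  qed
  note ints = E_pca_loss(1)[OF C n] E_noise_hs(1)[of n] int_e E_quant_loss(1)[OF q(2) n D(1)] int_f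
  show "integrable M (total_loss C q K D l n)"
    unfolding total_loss_def[abs_def] using ints by auto
  have "(\<integral>\<omega>. total_loss C q K D l n \<omega> \<partial>M) = 24 * (\<integral>\<omega>. pca_loss C n \<omega> \<partial>M)
     + 48 / l * ((\<integral>\<omega>. noise_hs n \<omega> \<partial>M) / (real n)\<^sup>2) + 12 * (\<integral>\<omega>. eps_mean_sq n \<omega> \<partial>M)
     + 6 * (\<integral>\<omega>. quant_loss q n \<omega> \<partial>M) + 12 * K\<^sup>2 * (\<integral>\<omega>. freq_loss q n \<omega> \<partial>M) + 3 * D"
    unfolding total_loss_def using ints by (simp add: prob_space)
  also have "48 / l * ((\<integral>\<omega>. noise_hs n \<omega> \<partial>M) / (real n)\<^sup>2) = 48 * (X_var * eps_var) * (1 / (real n * l))"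
    using n l by (simp add: E_noise_hs(2) power2_eq_square)
  finally show "(\<integral>\<omega>. total_loss C q K D l n \<omega> \<partial>M) \<le>
      24 * (\<integral>\<omega>. (norm (X 0 \<omega> - proj C (X 0 \<omega>)))\<^sup>2 \<partial>M) + 9 * D
      + 48 * (X_var * eps_var) * (1 / (real n * l)) + 12 * eps_var * (1 / real n)
      + 12 * K\<^sup>2 * real (card (range q)) * (1 / sqrt (real n))"
    using E_pca_loss(2)[OF C n] E_quant_loss(2)[OF q(2) n D(1)] D(2) E_e mult_left_mono[OF E_f, of "12 * K\<^sup>2"]
    by (simp add: mult.assoc)
qed

lemma pca_loss_tendsto_0:
  assumes C: "\<And>m. orthonormal_set (C m)" "\<And>x. (\<lambda>m. proj (C m) x) \<longlonglongrightarrow> x"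
  shows "(\<lambda>m. \<integral>\<omega>. (norm (X 0 \<omega> - proj (C m) (X 0 \<omega>)))\<^sup>2 \<partial>M) \<longlonglongrightarrow> 0"
proof -
  have [measurable]: "proj (C m) \<in> borel_measurable borel" for m
    unfolding proj_def[abs_def] by measurable
  have "(\<lambda>m. \<integral>\<omega>. (norm (X 0 \<omega> - proj (C m) (X 0 \<omega>)))\<^sup>2 \<partial>M) \<longlonglongrightarrow> (\<integral>\<omega>. 0 \<partial>M)"
  proof (rule integral_dominated_convergence[where w="\<lambda>\<omega>. (norm (X 0 \<omega>))\<^sup>2"])
    show "AE \<omega> in M. (\<lambda>m. (norm (X 0 \<omega> - proj (C m) (X 0 \<omega>)))\<^sup>2) \<longlonglongrightarrow> 0"
    proof (rule AE_I2)
      fix \<omega>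
      have "(\<lambda>m. (norm (X 0 \<omega> - proj (C m) (X 0 \<omega>)))\<^sup>2) \<longlonglongrightarrow> (norm (X 0 \<omega> - X 0 \<omega>))\<^sup>2"
        by (intro tendsto_intros C)
      then show "(\<lambda>m. (norm (X 0 \<omega> - proj (C m) (X 0 \<omega>)))\<^sup>2) \<longlonglongrightarrow> 0" by simp
    qed
    show "AE \<omega> in M. norm ((norm (X 0 \<omega> - proj (C m) (X 0 \<omega>)))\<^sup>2) \<le> (norm (X 0 \<omega>))\<^sup>2" for m
      using norm_diff_proj_le[OF C(1)] by (auto intro!: power_mono)
  qed (auto intro: X_square_integrable)
  then show ?thesis by simp
qed

end

section \<open>Convergence in probability\<close>

text \<open>Markov's inequality for the strict upper level sets of an extended nonnegative variable with a
finite bound on its mean.\<close>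

lemma (in prob_space) markov_bound:
  assumes u[measurable]: "u \<in> borel_measurable M" and s: "0 < s"
    and b: "(\<integral>\<^sup>+\<omega>. u \<omega> \<partial>M) \<le> ennreal b"
  shows "emeasure M {\<omega>\<in>space M. ennreal s < u \<omega>} \<le> ennreal (b / s)"
proof -
  have sub: "{\<omega>\<in>space M. ennreal s < u \<omega>} \<subseteq> {\<omega>\<in>space M. 1 \<le> ennreal (1 / s) * u \<omega>}"
  proof safe
    fix \<omega> assume "ennreal s < u \<omega>"
    then have "ennreal (1 / s) * ennreal s \<le> ennreal (1 / s) * u \<omega>"
      by (intro mult_left_mono) auto
    then show "1 \<le> ennreal (1 / s) * u \<omega>"
      using s by (simp flip: ennreal_mult')
  qed
  then have "emeasure M {\<omega>\<in>space M. ennreal s < u \<omega>} \<le> emeasure M {\<omega>\<in>space M. 1 \<le> ennreal (1 / s) * u \<omega>}"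
    by (intro emeasure_mono) auto
  also have "\<dots> \<le> ennreal (1 / s) * (\<integral>\<^sup>+\<omega>. u \<omega> \<partial>M)"
    using nn_integral_Markov_inequality[of u "space M" M "ennreal (1 / s)"]
    by (simp add: Int_def conj_commute cong: nn_integral_cong)
  also have "\<dots> \<le> ennreal (1 / s) * ennreal b"
    by (intro mult_left_mono b) auto
  also have "\<dots> = ennreal (b / s)"
    using s by (simp flip: ennreal_mult')
  finally show ?thesis .
qed

lemma (in prob_space) markov_bound_real:
  fixes U :: "'a \<Rightarrow> real"
  assumes U: "integrable M U" "\<And>\<omega>. 0 \<le> U \<omega>" and s: "0 < s" and b: "(\<integral>\<omega>. U \<omega> \<partial>M) \<le> b"
  shows "emeasure M {\<omega>\<in>space M. s < U \<omega>} \<le> ennreal (b / s)"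
proof -
  have "(\<integral>\<^sup>+\<omega>. ennreal (U \<omega>) \<partial>M) \<le> ennreal b"
    using U b by (simp add: nn_integral_eq_integral ennreal_leI)
  then have "emeasure M {\<omega>\<in>space M. ennreal s < ennreal (U \<omega>)} \<le> ennreal (b / s)"
    using U(1) s by (intro markov_bound) auto
  then show ?thesis
    using s by (simp add: ennreal_less_iff)
qed

context far1_process
begin

lemma total_loss_nonneg:
  assumes "0 < l" "0 \<le> D"
  shows "0 \<le> total_loss C q K D l n \<omega>"
  unfolding total_loss_def pca_loss_def eps_mean_sq_def quant_loss_def freq_loss_def
  using assms noise_hs_nonneg
  by (intro add_nonneg_nonneg mult_nonneg_nonneg divide_nonneg_nonneg sum_nonneg) auto

lemma E_liminf_eps_cov_err_hs:
  assumes C: "\<And>m. orthonormal_set (C m)" and n: "n \<ge> 1"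
  shows "(\<integral>\<^sup>+\<omega>. liminf (\<lambda>m. ennreal (eps_cov_err_hs (C m) n \<omega>)) \<partial>M) \<le> ennreal (eps_fourth / real n)"
proof -
  have "(\<integral>\<^sup>+\<omega>. liminf (\<lambda>m. ennreal (eps_cov_err_hs (C m) n \<omega>)) \<partial>M) \<le>
      liminf (\<lambda>m. \<integral>\<^sup>+\<omega>. ennreal (eps_cov_err_hs (C m) n \<omega>) \<partial>M)"
    by (rule nn_integral_liminf) measurable
  also have "\<dots> \<le> liminf (\<lambda>m. ennreal (eps_fourth / real n))"
    by (intro Liminf_mono always_eventually allI E_eps_cov_err_hs C n)
  finally show ?thesis by (simp add: Liminf_const)
qed

text \<open>Three error terms of size at most \<open>slack * l\<close>, divided by \<open>1 - \<parallel>\<Psi>\<parallel>\<^sup>2\<close>, add up to \<open>l / 2\<close>.\<close>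

definition slack :: real where "slack = (1 - (onorm \<Psi>)\<^sup>2) / 6"

lemma slack_pos: "0 < slack"
  using onorm_Psi_nonneg Psi(2) by (simp add: slack_def power_less_one_iff abs_less_iff)

lemma cov_err_bound_le:
  assumes n: "n \<ge> 1" and l: "0 < l"
    and noise: "noise_hs n \<omega> \<le> (slack * l * real n / 2)\<^sup>2"
    and bdry: "(norm (X 0 \<omega>))\<^sup>2 + (norm (X (int n) \<omega>))\<^sup>2 \<le> slack * l * real n"
  shows "cov_err_bound n (slack * l) \<omega> \<le> l / 2"
proof -
  have "sqrt (noise_hs n \<omega>) \<le> slack * l * real n / 2"
    using noise slack_pos l by (intro real_le_lsqrt) auto
  then have 1: "2 * (sqrt (noise_hs n \<omega>) / real n) \<le> slack * l"
    using n by (simp add: field_simps)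
  have 2: "((norm (X 0 \<omega>))\<^sup>2 + (norm (X (int n) \<omega>))\<^sup>2) / real n \<le> slack * l"
    using bdry n by (simp add: field_simps)
  have pos: "1 - (onorm \<Psi>)\<^sup>2 = 6 * slack" by (simp add: slack_def)
  have "cov_err_bound n (slack * l) \<omega> \<le> (3 * (slack * l)) / (6 * slack)"
    unfolding cov_err_bound_def pos
  proof (rule divide_right_mono)
    show "slack * l + 2 * (sqrt (noise_hs n \<omega>) / real n) + ((norm (X 0 \<omega>))\<^sup>2 + (norm (X (int n) \<omega>))\<^sup>2) / real n
        \<le> 3 * (slack * l)"
      using 1 2 by linarith
  qed (use slack_pos in simp)
  then show ?thesis using slack_pos by simp
qed

text \<open>The exceptional set is covered by a null set and four measurable events: three on which
\<open>cov_err_bound\<close> may exceed \<open>l / 2\<close>, and one on which the loss is large. Outside of them the empirical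
eigenvalue is at least \<open>l / 2\<close> and \<open>mallows_dist_le_total_loss\<close> applies. The distance itself, as a function of
the sample point, is never integrated, hence the outer measure.\<close>

lemma mallows_dist_probability_bound:
  assumes n: "n \<ge> 1" and k: "k \<ge> 1" and l: "0 < l"
    and sys: "\<And>\<omega>. \<omega> \<in> space M \<Longrightarrow> ordered_eigensystem (emp_cov n (\<lambda>t. X t \<omega>)) (\<mu> \<omega>) (v \<omega>)"
    and W: "orthonormal_set W" "card W = k"
      "\<And>y. y \<in> span W \<Longrightarrow> l * (norm y)\<^sup>2 \<le> (\<integral>\<omega>. (inner (X 0 \<omega>) y)\<^sup>2 \<partial>M)"
    and C: "\<And>m. orthonormal_set (C m)" "\<And>x. (\<lambda>m. proj (C m) x) \<longlonglongrightarrow> x" "card (C m) \<le> k"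
    and q: "simple_function F q" "\<And>y. norm (q y) \<le> K" "q \<in> borel_measurable borel"
    and D: "integrable M (\<lambda>\<omega>. (norm (q (\<epsilon> 0 \<omega>) - \<epsilon> 0 \<omega>))\<^sup>2)"
      "(\<integral>\<omega>. (norm (q (\<epsilon> 0 \<omega>) - \<epsilon> 0 \<omega>))\<^sup>2 \<partial>M) \<le> D"
    and e: "e > 0"
    and b: "24 * (\<integral>\<omega>. (norm (X 0 \<omega> - proj (C m) (X 0 \<omega>)))\<^sup>2 \<partial>M) + 9 * D
      + 48 * (X_var * eps_var) * (1 / (real n * l)) + 12 * eps_var * (1 / real n)
      + 12 * K\<^sup>2 * real (card (range q)) * (1 / sqrt (real n)) \<le> b"
  shows "outer_measure_of M {\<omega>\<in>space M. dist (mallows_dist (empirical_distribution n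
           (centered_residual n k (\<mu> \<omega>) (v \<omega>) (\<lambda>t. X t \<omega>))) F) 0 > e}
    \<le> ennreal (eps_fourth / slack\<^sup>2 * (1 / (real n * l\<^sup>2)) + 4 * (X_var * eps_var) / slack\<^sup>2 * (1 / (real n * l\<^sup>2))
        + 2 * X_var / slack * (1 / (real n * l)) + b / e\<^sup>2)" (is "outer_measure_of M ?A \<le> _")
proof -
  let ?R = "\<lambda>\<omega>. liminf (\<lambda>m. ennreal (eps_cov_err_hs (C m) n \<omega>))"
  let ?L = "total_loss (C m) q K D l n"
  have sl: "0 < slack * l" using slack_pos l by simp
  have D0: "0 \<le> D" using D(2) by (rule order_trans[rotated]) simp
  define S1 where "S1 = {\<omega>\<in>space M. ennreal ((slack * l)\<^sup>2) < ?R \<omega>}"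
  define S2 where "S2 = {\<omega>\<in>space M. (slack * l * real n / 2)\<^sup>2 < noise_hs n \<omega>}"
  define S3 where "S3 = {\<omega>\<in>space M. slack * l * real n < (norm (X 0 \<omega>))\<^sup>2 + (norm (X (int n) \<omega>))\<^sup>2}"
  define S4 where "S4 = {\<omega>\<in>space M. e\<^sup>2 < ?L \<omega>}"
  have [measurable]: "noise_hs n \<in> borel_measurable M" "?L \<in> borel_measurable M"
    using E_noise_hs(1)[of n] E_total_loss(1)[OF C(1) n l q(1,3) D] by auto
  have sets: "S1 \<in> sets M" "S2 \<in> sets M" "S3 \<in> sets M" "S4 \<in> sets M"
    unfolding S1_def S2_def S3_def S4_def by measurable
  obtain N where N: "N \<in> null_sets M" "{\<omega>\<in>space M. \<not> (\<forall>t. X (t + 1) \<omega> = \<Psi> (X t \<omega>) + \<epsilon> (t + 1) \<omega>)} \<subseteq> N"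
    using far1_AE unfolding eventually_ae_filter by blast
  have "?A \<subseteq> N \<union> (S1 \<union> (S2 \<union> (S3 \<union> S4)))"
  proof (rule subsetI, rule ccontr)
    fix \<omega> assume A: "\<omega> \<in> ?A" and "\<omega> \<notin> N \<union> (S1 \<union> (S2 \<union> (S3 \<union> S4)))"
    then have \<omega>: "\<omega> \<in> space M" "\<forall>t. X (t + 1) \<omega> = \<Psi> (X t \<omega>) + \<epsilon> (t + 1) \<omega>"
      and R: "?R \<omega> \<le> ennreal ((slack * l)\<^sup>2)"
      and noise: "noise_hs n \<omega> \<le> (slack * l * real n / 2)\<^sup>2"
      and bdry: "(norm (X 0 \<omega>))\<^sup>2 + (norm (X (int n) \<omega>))\<^sup>2 \<le> slack * l * real n"
      and L: "?L \<omega> \<le> e\<^sup>2"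
      using N(2) by (auto simp: S1_def S2_def S3_def S4_def not_less)
    have form: "\<bar>eps_form_err n f \<omega>\<bar> \<le> (slack * l) * (onorm f)\<^sup>2" if "bounded_linear f" for f
      by (rule eps_form_err_bound[OF C(1,2) R less_imp_le[OF sl] that])
    have "l - cov_err_bound n (slack * l) \<omega> \<le> \<mu> \<omega> k"
      by (rule empirical_eigenvalue_lower_bound[OF sys[OF \<omega>(1)] n k W form less_imp_le[OF sl] \<omega>(2)])
    then have "l / 2 \<le> \<mu> \<omega> k"
      using cov_err_bound_le[OF n l noise bdry] by linarith
    then have "(mallows_dist (empirical_distribution n (centered_residual n k (\<mu> \<omega>) (v \<omega>) (\<lambda>t. X t \<omega>))) F)\<^sup>2 \<le> e\<^sup>2"
      using mallows_dist_le_total_loss[OF sys[OF \<omega>(1)] n k l _ C(1,3) q D \<omega>(2)] L by linarith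
    then have "\<bar>mallows_dist (empirical_distribution n (centered_residual n k (\<mu> \<omega>) (v \<omega>) (\<lambda>t. X t \<omega>))) F\<bar> \<le> e"
      using e abs_le_square_iff[of _ e] by simp
    then show False using A by simp
  qed
  then have "outer_measure_of M ?A \<le> outer_measure_of M (N \<union> (S1 \<union> (S2 \<union> (S3 \<union> S4))))"
    by (rule outer_measure_of_mono)
  also have "\<dots> = emeasure M (N \<union> (S1 \<union> (S2 \<union> (S3 \<union> S4))))"
    using sets N(1) by (intro outer_measure_of_eq) auto
  also have "\<dots> = emeasure M (S1 \<union> (S2 \<union> (S3 \<union> S4)))"
    unfolding Un_commute[of N] using sets N(1) by (intro emeasure_Un_null_set) auto
  also have "\<dots> \<le> emeasure M S1 + (emeasure M S2 + (emeasure M S3 + emeasure M S4))"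
    using sets by (intro order_trans[OF emeasure_subadditive] add_left_mono) auto
  also have "\<dots> \<le> ennreal (eps_fourth / real n / (slack * l)\<^sup>2)
      + (ennreal (real n * (X_var * eps_var) / (slack * l * real n / 2)\<^sup>2)
      + (ennreal (2 * X_var / (slack * l * real n)) + ennreal (b / e\<^sup>2)))"
  proof (intro add_mono)
    show "emeasure M S1 \<le> ennreal (eps_fourth / real n / (slack * l)\<^sup>2)"
      unfolding S1_def using sl by (intro markov_bound E_liminf_eps_cov_err_hs C n) auto
    show "emeasure M S2 \<le> ennreal (real n * (X_var * eps_var) / (slack * l * real n / 2)\<^sup>2)"
      unfolding S2_def using slack_pos l n by (intro markov_bound_real E_noise_hs noise_hs_nonneg) (auto simp: E_noise_hs)
    show "emeasure M S3 \<le> ennreal (2 * X_var / (slack * l * real n))"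
      unfolding S3_def using slack_pos l n X_square_integrable
      by (intro markov_bound_real) (auto simp: X_var)
    have "(\<integral>\<omega>. ?L \<omega> \<partial>M) \<le> b"
      using E_total_loss(2)[OF C(1) n l q(1,3) D] b by (rule order_trans)
    then show "emeasure M S4 \<le> ennreal (b / e\<^sup>2)"
      unfolding S4_def using e
      by (intro markov_bound_real E_total_loss(1)[OF C(1) n l q(1,3) D] total_loss_nonneg l D0) auto
  qed
  also have "\<dots> = ennreal (eps_fourth / real n / (slack * l)\<^sup>2
      + (real n * (X_var * eps_var) / (slack * l * real n / 2)\<^sup>2 + (2 * X_var / (slack * l * real n) + b / e\<^sup>2)))"
  proof -
    have "0 \<le> (\<integral>\<omega>. ?L \<omega> \<partial>M)"
      by (intro integral_nonneg_AE AE_I2 total_loss_nonneg l D0)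
    then have "0 \<le> b"
      using E_total_loss(2)[OF C(1) n l q(1,3) D] b by (meson order_trans)
    then show ?thesis
      using slack_pos l eps_fourth_nonneg X_var_nonneg eps_var_nonneg by (simp flip: ennreal_plus)
  qed
  also have "eps_fourth / real n / (slack * l)\<^sup>2
      + (real n * (X_var * eps_var) / (slack * l * real n / 2)\<^sup>2 + (2 * X_var / (slack * l * real n) + b / e\<^sup>2))
      = eps_fourth / slack\<^sup>2 * (1 / (real n * l\<^sup>2)) + 4 * (X_var * eps_var) / slack\<^sup>2 * (1 / (real n * l\<^sup>2))
        + 2 * X_var / slack * (1 / (real n * l)) + b / e\<^sup>2"
    using n l slack_pos by (simp add: power_mult_distrib power_divide power2_eq_square[of "real n"] ac_simps)
  finally show ?thesis .
qed

end

lemma ennreal_tendsto_0_I: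
  fixes f :: "nat \<Rightarrow> ennreal"
  assumes "\<And>\<delta>. \<delta> > 0 \<Longrightarrow> \<forall>\<^sub>F n in sequentially. f n < ennreal \<delta>"
  shows "f \<longlonglongrightarrow> 0"
proof (rule order_tendstoI)
  fix a :: ennreal assume "0 < a"
  then show "\<forall>\<^sub>F n in sequentially. f n < a"
  proof (cases a)
    case (real r)
    then show ?thesis using assms[of r] \<open>0 < a\<close> by (simp add: ennreal_less_zero_iff)
  next
    case top
    have "\<forall>\<^sub>F n in sequentially. f n < ennreal 1" by (rule assms) simp
    then show ?thesis
      by eventually_elim (auto simp: top intro: less_trans)
  qed
qed simp

text \<open>The logarithmic factor is at least 1 from \<open>n = 3\<close> on, so \<open>1 / l n\<close> is at most of order \<open>n\<^sup>1\<^sup>/\<^sup>4\<close> and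
its square divided by \<open>n\<close> is at most of order \<open>n\<^sup>-\<^sup>1\<^sup>/\<^sup>2\<close>. The second limit follows because \<open>l\<close> is bounded.\<close>

lemma inverse_eigenvalue_rate:
  fixes l :: "nat \<Rightarrow> real"
  assumes l: "\<And>n. 0 < l n" "\<And>n. l n \<le> L" and \<beta>: "0 \<le> \<beta>"
    and O: "(\<lambda>n. 1 / l n) \<in> O(\<lambda>n. real n powr (1 / 4) / (ln (real n)) powr \<beta>)"
  shows "(\<lambda>n. 1 / (real n * (l n)\<^sup>2)) \<longlonglongrightarrow> 0" "(\<lambda>n. 1 / (real n * l n)) \<longlonglongrightarrow> 0"
proof -
  obtain c where c: "c > 0" "\<forall>\<^sub>F n in sequentially. norm (1 / l n) \<le> c * norm (real n powr (1 / 4) / (ln (real n)) powr \<beta>)"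
    using landau_o.bigE[OF O] by blast
  have ev: "\<forall>\<^sub>F n in sequentially. norm (1 / (real n * (l n)\<^sup>2)) \<le> c\<^sup>2 * (1 / sqrt (real n))"
    using c(2) eventually_ge_at_top[of 3]
  proof eventually_elim
    case (elim n)
    have "exp 1 \<le> real n" using exp_le elim(2) by linarith
    then have "1 \<le> ln (real n)" using elim(2) by (simp add: ln_ge_iff)
    then have "1 \<le> ln (real n) powr \<beta>" using \<beta> by (rule ge_one_powr_ge_zero)
    then have "real n powr (1 / 4) / (ln (real n)) powr \<beta> \<le> real n powr (1 / 4) / 1"
      by (intro divide_left_mono) auto
    then have "c * norm (real n powr (1 / 4) / (ln (real n)) powr \<beta>) \<le> c * real n powr (1 / 4)"
      using c(1) by (intro mult_left_mono) auto
    then have "1 / l n \<le> c * real n powr (1 / 4)"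
      using elim(1) l(1)[of n] by simp
    then have "(1 / l n)\<^sup>2 \<le> (c * real n powr (1 / 4))\<^sup>2"
      using l(1)[of n] by (intro power_mono) auto
    also have "\<dots> = c\<^sup>2 * sqrt (real n)"
      using elim(2) by (simp add: power_mult_distrib powr_half_sqrt[symmetric] powr_power)
    finally have "(1 / l n)\<^sup>2 / real n \<le> c\<^sup>2 * sqrt (real n) / real n"
      by (intro divide_right_mono) auto
    also have "\<dots> = c\<^sup>2 * (1 / sqrt (real n))"
      using elim(2) by (simp add: field_simps)
    finally show ?case
      by (simp add: power_divide mult.commute)
  qed
  have lim: "(\<lambda>n. c\<^sup>2 * (1 / sqrt (real n))) \<longlonglongrightarrow> 0"
    by real_asymp
  show t: "(\<lambda>n. 1 / (real n * (l n)\<^sup>2)) \<longlonglongrightarrow> 0"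
    by (rule Lim_null_comparison[OF ev lim])
  show "(\<lambda>n. 1 / (real n * l n)) \<longlonglongrightarrow> 0"
  proof (rule Lim_null_comparison[of _ "\<lambda>n. L * (1 / (real n * (l n)\<^sup>2))"])
    show "\<forall>\<^sub>F n in sequentially. norm (1 / (real n * l n)) \<le> L * (1 / (real n * (l n)\<^sup>2))"
    proof (intro always_eventually allI)
      fix n
      have "1 / (real n * l n) = l n * (1 / (real n * (l n)\<^sup>2))"
        using l(1)[of n] by (simp add: power2_eq_square)
      also have "\<dots> \<le> L * (1 / (real n * (l n)\<^sup>2))"
        using l(2)[of n] by (intro mult_right_mono) auto
      finally show "norm (1 / (real n * l n)) \<le> L * (1 / (real n * (l n)\<^sup>2))"
        using l(1)[of n] by simp
    qed
    show "(\<lambda>n. L * (1 / (real n * (l n)\<^sup>2))) \<longlonglongrightarrow> 0"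
      using tendsto_mult_right_zero[OF t] by simp
  qed
qed

theorem theorem3p1:
  fixes M :: "'w measure"
    and X \<epsilon> :: "int \<Rightarrow> 'w \<Rightarrow> 'a::{real_inner, banach, second_countable_topology}"
    and \<Psi> :: "'a \<Rightarrow> 'a"
    and lam :: "nat \<Rightarrow> real"
    and k :: "nat \<Rightarrow> nat"
    and lhat :: "nat \<Rightarrow> 'w \<Rightarrow> nat \<Rightarrow> real"
    and vhat :: "nat \<Rightarrow> 'w \<Rightarrow> nat \<Rightarrow> 'a"
    and \<beta> :: real
  assumes "prob_space M"
    and stationary: "strictly_stationary M X"
    and far1: "\<And>t. AE \<omega> in M. X (t + 1) \<omega> = \<Psi> (X t \<omega>) + \<epsilon> (t + 1) \<omega>"
    and X_mean: "\<And>t. integrable M (X t)" "\<And>t. (\<integral>\<omega>. X t \<omega> \<partial>M) = 0"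
    and eps_iid: "iid M \<epsilon>"
    and eps_mean: "\<And>t. integrable M (\<epsilon> t)" "\<And>t. (\<integral>\<omega>. \<epsilon> t \<omega> \<partial>M) = 0"
    and eps_moment: "\<And>t. integrable M (\<lambda>\<omega>. norm (\<epsilon> t \<omega>) ^ 4)"
    and Psi: "bounded_linear \<Psi>" "hilbert_schmidt \<Psi>" "onorm \<Psi> < 1"
    and eigenvalues_Gamma: "eigenvalues (covariance_op M (X 0)) = lam ` {1..}"
    and eigenvalues_decreasing: "\<And>j. j \<ge> 1 \<Longrightarrow> lam j > lam (Suc j)"
    and eigenvalues_pos: "\<And>j. j \<ge> 1 \<Longrightarrow> lam j > 0"
    and eigenvalues_simple: "\<And>j. j \<ge> 1 \<Longrightarrow> dim (eigenspace (covariance_op M (X 0)) (lam j)) = 1"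
    and eigensystem_hat: "\<And>n \<omega>. n \<ge> 1 \<Longrightarrow> \<omega> \<in> space M \<Longrightarrow>
           ordered_eigensystem (emp_cov n (\<lambda>t. X t \<omega>)) (lhat n \<omega>) (vhat n \<omega>)"
    and k_pos: "\<And>n. k n \<ge> 1"
    and k_lim: "filterlim k at_top sequentially"
    and k_gap: "(\<lambda>n. real (k n) / real n * (\<Sum>j=1..k n. 1 / (eigen_gap lam j)\<^sup>2)) \<longlonglongrightarrow> 0"
    and beta: "\<beta> > 1 / 2"
    and k_eigenvalue:
          "(\<lambda>n. 1 / lam (k n)) \<in> O(\<lambda>n. real n powr (1 / 4) / (ln (real n)) powr \<beta>)"
  shows "tendsto_in_probability M
           (\<lambda>n \<omega>. mallows_dist
              (empirical_distribution n
                 (centered_residual n (k n) (lhat n \<omega>) (vhat n \<omega>) (\<lambda>t. X t \<omega>)))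
              (distr M borel (\<epsilon> 0)))
           0"
proof -
  interpret far1_process M X \<epsilon> \<Psi>
    by (intro far1_process.intro far1_process_axioms.intro assms(1) stationary far1 X_mean(1) eps_iid eps_mean eps_moment Psi(1,3))
  have dec: "\<And>j. j \<ge> 1 \<Longrightarrow> lam (Suc j) < lam j"
    by (rule eigenvalues_decreasing)
  have eig: "lam ` {1..} \<subseteq> eigenvalues (covariance_op M (X 0))"
    using eigenvalues_Gamma by simp
  obtain w where w: "\<And>i. i \<ge> 1 \<Longrightarrow> covariance_op M (X 0) (w i) = lam i *\<^sub>R w i"
      "\<And>i j. i \<ge> 1 \<Longrightarrow> j \<ge> 1 \<Longrightarrow> inner (w i) (w j) = (if i = j then 1 else 0)"
    proof (rule covariance_eigenvectors[of lam])
    show "lam ` {1..} \<subseteq> eigenvalues (covariance_op M (X 0))" by (rule eig)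
  qed (use dec that in blast)+
  obtain C :: "nat \<Rightarrow> 'a set" where C: "\<And>m. orthonormal_set (C m)" "\<And>m. card (C m) \<le> m"
      "\<And>x. (\<lambda>m. proj (C m) x) \<longlonglongrightarrow> x"
    by (rule finite_rank_approximation) (use that in blast)
  define l where "l n = lam (k n)" for n
  have l_pos: "0 < l n" for n
    unfolding l_def by (rule eigenvalues_pos[OF k_pos])
  have l_le: "l n \<le> lam 1" for n
    unfolding l_def using strict_decreasing_from_1[of lam 1 "k n", OF dec] k_pos[of n]
    by (cases "k n = 1") auto
  have rate: "(\<lambda>n. 1 / (real n * (l n)\<^sup>2)) \<longlonglongrightarrow> 0" "(\<lambda>n. 1 / (real n * l n)) \<longlonglongrightarrow> 0"
    using inverse_eigenvalue_rate[of l "lam 1" \<beta>, OF l_pos l_le] beta k_eigenvalue by (simp_all add: l_def)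
  have lim_n: "(\<lambda>n. 1 / real n) \<longlonglongrightarrow> 0" "(\<lambda>n. 1 / sqrt (real n)) \<longlonglongrightarrow> 0"
    by real_asymp+
  show ?thesis
    unfolding tendsto_in_probability_def
  proof (intro allI impI ennreal_tendsto_0_I)
    fix e \<delta> :: real assume e: "e > 0" and \<delta>: "\<delta> > 0"
    \<comment> \<open>in the limit the bound becomes \<open>(24 \<eta> + 9 \<eta>) / e\<^sup>2 = \<delta> / 2\<close>\<close>
    define \<eta> where "\<eta> = \<delta> * e\<^sup>2 / 66"
    have \<eta>: "\<eta> > 0" using e \<delta> by (simp add: \<eta>_def)
    obtain q K where q: "simple_function F q" "\<And>y. norm (q y) \<le> K" "q \<in> borel_measurable borel"
      "integrable M (\<lambda>\<omega>. (norm (q (\<epsilon> 0 \<omega>) - \<epsilon> 0 \<omega>))\<^sup>2)"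
      "(\<integral>\<omega>. (norm (q (\<epsilon> 0 \<omega>) - \<epsilon> 0 \<omega>))\<^sup>2 \<partial>M) < \<eta>"
      using quantizer_exists[OF \<eta>] by blast
    obtain m where m: "(\<integral>\<omega>. (norm (X 0 \<omega> - proj (C m) (X 0 \<omega>)))\<^sup>2 \<partial>M) < \<eta>"
      using order_tendstoD(2)[OF pca_loss_tendsto_0[OF C(1,3)] \<eta>] unfolding eventually_sequentially by blast
    define b where "b n = 24 * \<eta> + 9 * \<eta>
      + 48 * (X_var * eps_var) * (1 / (real n * l n)) + 12 * eps_var * (1 / real n)
      + 12 * K\<^sup>2 * real (card (range q)) * (1 / sqrt (real n))" for n
    define B where "B n = eps_fourth / slack\<^sup>2 * (1 / (real n * (l n)\<^sup>2))
      + 4 * (X_var * eps_var) / slack\<^sup>2 * (1 / (real n * (l n)\<^sup>2))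
      + 2 * X_var / slack * (1 / (real n * l n)) + b n / e\<^sup>2" for n
    have b_lim: "b \<longlonglongrightarrow> 24 * \<eta> + 9 * \<eta> + 48 * (X_var * eps_var) * 0 + 12 * eps_var * 0
      + 12 * K\<^sup>2 * real (card (range q)) * 0"
      unfolding b_def by (intro tendsto_intros rate lim_n)
    have "B \<longlonglongrightarrow> eps_fourth / slack\<^sup>2 * 0 + 4 * (X_var * eps_var) / slack\<^sup>2 * 0 + 2 * X_var / slack * 0
      + (24 * \<eta> + 9 * \<eta> + 48 * (X_var * eps_var) * 0 + 12 * eps_var * 0 + 12 * K\<^sup>2 * real (card (range q)) * 0) / e\<^sup>2"
      unfolding B_def using e by (intro tendsto_add tendsto_mult tendsto_const tendsto_divide rate b_lim) auto
    moreover have "eps_fourth / slack\<^sup>2 * 0 + 4 * (X_var * eps_var) / slack\<^sup>2 * 0 + 2 * X_var / slack * 0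
      + (24 * \<eta> + 9 * \<eta> + 48 * (X_var * eps_var) * 0 + 12 * eps_var * 0 + 12 * K\<^sup>2 * real (card (range q)) * 0) / e\<^sup>2 < \<delta>"
      using e \<delta> by (simp add: \<eta>_def)
    ultimately have "\<forall>\<^sub>F n in sequentially. B n < \<delta>"
      by (rule order_tendstoD(2))
    moreover have "\<forall>\<^sub>F n in sequentially. m \<le> k n"
      using k_lim by (simp add: filterlim_at_top)
    ultimately show "\<forall>\<^sub>F n in sequentially. outer_measure_of M {\<omega>\<in>space M. dist (mallows_dist
        (empirical_distribution n (centered_residual n (k n) (lhat n \<omega>) (vhat n \<omega>) (\<lambda>t. X t \<omega>))) F) 0 > e} < ennreal \<delta>"
      using eventually_ge_at_top[of 1]
    proof eventually_elim
      case (elim n)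
      have W: "orthonormal_set (w ` {1..k n})" "inj_on w {1..k n}"
        by (rule orthonormal_set_imageI; simp add: w(2))+
      have "outer_measure_of M {\<omega>\<in>space M. dist (mallows_dist
          (empirical_distribution n (centered_residual n (k n) (lhat n \<omega>) (vhat n \<omega>) (\<lambda>t. X t \<omega>))) F) 0 > e}
        \<le> ennreal (B n)"
        unfolding B_def
      proof (rule mallows_dist_probability_bound[where W="w ` {1..k n}" and C=C and m=m and q=q and K=K and D=\<eta>])
        show "card (w ` {1..k n}) = k n" using card_image[OF W(2)] by simp
        show "l n * (norm y)\<^sup>2 \<le> (\<integral>\<omega>. (inner (X 0 \<omega>) y)\<^sup>2 \<partial>M)" if "y \<in> span (w ` {1..k n})" for y
          unfolding l_def using second_moment_lower_bound[OF w dec that] .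
        show "card (C m) \<le> k n" using C(2)[of m] elim by linarith
        show "24 * (\<integral>\<omega>. (norm (X 0 \<omega> - proj (C m) (X 0 \<omega>)))\<^sup>2 \<partial>M) + 9 * \<eta>
          + 48 * (X_var * eps_var) * (1 / (real n * l n)) + 12 * eps_var * (1 / real n)
          + 12 * K\<^sup>2 * real (card (range q)) * (1 / sqrt (real n)) \<le> b n"
          unfolding b_def using m by simp
      qed (use elim e k_pos l_pos W C q eigensystem_hat in \<open>auto intro: less_imp_le\<close>)
      also have "\<dots> < ennreal \<delta>"
        using elim \<delta> by (simp add: ennreal_lessI)
      finally show ?case .
    qed
  qed
qed

end
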